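(* Let $a,b,c>0$ and let $g:\mathbb{R}\to\mathbb{R}$ be given by $g(x)=-a$ for $|x|>c$ and $g(x)=b$ for $|x|<c$. Let $\gamma<0$ and $h=\gamma\delta_0$. Let $\omega>0$ be a frequency such that $\sqrt{b}\,\omega\, c\,\frac{2}{\pi}=\frac{p}{q}$ for some positive odd integers $p,q$. Then, with $T=\frac{2\pi}{\omega}$, the equation $g(x)w_{tt}-w_{xx}+h(x)(w_t^3)_t=0$ has infinitely many distinct nontrivial, real-valued, $T$-periodic weak solutions $w$. Moreover, for each such solution $w$ there are constants $C,\rho>0$ with $|w(x,t)|\le Ce^{-\rho|x|}$ for all $(x,t)$.
   Context: Here $\delta_0$ is the Dirac delta at $x=0$. Let $T=2\pi/\omega$, let $\mathbb{T}_T=\mathbb{R}/T\mathbb{Z}$ be the one-dimensional torus of length $T$, and $D=\mathbb{R}\times\mathbb{T}_T$. For $g\in L^\infty(\mathbb{R})$ and $h=\gamma\delta_0$ with $\gamma\in\mathbb{R}\setminus\{0\}$, a weak solution of $g(x)w_{tt}-w_{xx}+h(x)(w_t^3)_t=0$ is a real function $w\in H^1(D)$ with $\partial_t w(0,\cdot)\in L^3(\mathbb{T}_T)$ such that for every $\psi\in C_c^\infty(D)$ $$\int_D\big(-g(x)\,\partial_tw\,\partial_t\psi+\partial_xw\,\partial_x\psi\big)\,d(x,t)-\gamma\int_0^T(\partial_tw(0,t))^3\,\partial_t\psi(0,t)\,dt=0.$$ *)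

theory Defs
  imports "HOL-Analysis.Analysis"
begin

text \<open>Functions on D = R x T_T are represented as functions on R x R
  (pairs (x,t)) that are T-periodic in t.  Integrals over D are integrals
  over the fundamental domain UNIV x {0..T} w.r.t. Lebesgue measure.\<close>

definition Dom :: "real \<Rightarrow> (real \<times> real) set" where
  "Dom T = UNIV \<times> {0..T}"

definition periodic_t :: "real \<Rightarrow> (real \<times> real \<Rightarrow> real) \<Rightarrow> bool" where
  "periodic_t T f \<longleftrightarrow> (\<forall>x t. f (x, t + T) = f (x, t))"

definition px :: "(real \<times> real \<Rightarrow> real) \<Rightarrow> real \<times> real \<Rightarrow> real" where
  "px f z = deriv (\<lambda>s. f (s, snd z)) (fst z)"

definition pt :: "(real \<times> real \<Rightarrow> real) \<Rightarrow> real \<times> real \<Rightarrow> real" where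
  "pt f z = deriv (\<lambda>s. f (fst z, s)) (snd z)"

fun pd :: "bool list \<Rightarrow> (real \<times> real \<Rightarrow> real) \<Rightarrow> real \<times> real \<Rightarrow> real" where
  "pd [] f = f"
| "pd (b # bs) f = (if b then px (pd bs f) else pt (pd bs f))"

definition smooth2 :: "(real \<times> real \<Rightarrow> real) \<Rightarrow> bool" where
  "smooth2 f \<longleftrightarrow> (\<forall>bs. continuous_on UNIV (pd bs f) \<and>
     (\<forall>x t. ((\<lambda>s. pd bs f (s, t)) has_real_derivative px (pd bs f) (x, t)) (at x) \<and>
            ((\<lambda>s. pd bs f (x, s)) has_real_derivative pt (pd bs f) (x, t)) (at t)))"

text \<open>C_c^infinity(D): smooth, T-periodic in t, compact support in D (i.e. bounded in x).\<close>
definition test_fun :: "real \<Rightarrow> (real \<times> real \<Rightarrow> real) \<Rightarrow> bool" where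
  "test_fun T \<psi> \<longleftrightarrow> smooth2 \<psi> \<and> periodic_t T \<psi> \<and>
     (\<exists>R. \<forall>x t. \<bar>x\<bar> > R \<longrightarrow> \<psi> (x, t) = 0)"

definition L2_D :: "real \<Rightarrow> (real \<times> real \<Rightarrow> real) \<Rightarrow> bool" where
  "L2_D T f \<longleftrightarrow> set_borel_measurable lborel (Dom T) f \<and>
     set_integrable lborel (Dom T) (\<lambda>z. (f z)\<^sup>2)"

definition H1_D :: "real \<Rightarrow> (real \<times> real \<Rightarrow> real) \<Rightarrow> (real \<times> real \<Rightarrow> real)
    \<Rightarrow> (real \<times> real \<Rightarrow> real) \<Rightarrow> bool" where
  "H1_D T w wx wt \<longleftrightarrow> periodic_t T w \<and> L2_D T w \<and> L2_D T wx \<and> L2_D T wt \<and>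
     (\<forall>\<psi>. test_fun T \<psi> \<longrightarrow>
        set_lebesgue_integral lborel (Dom T) (\<lambda>z. w z * px \<psi> z)
          = - set_lebesgue_integral lborel (Dom T) (\<lambda>z. wx z * \<psi> z) \<and>
        set_lebesgue_integral lborel (Dom T) (\<lambda>z. w z * pt \<psi> z)
          = - set_lebesgue_integral lborel (Dom T) (\<lambda>z. wt z * \<psi> z))"

text \<open>tau is the trace of w (with weak x-derivative wx) on {x = 0}, characterised by
  the Gauss-Green identity on the half-space x > 0.\<close>
definition trace0 :: "real \<Rightarrow> (real \<times> real \<Rightarrow> real) \<Rightarrow> (real \<times> real \<Rightarrow> real)
    \<Rightarrow> (real \<Rightarrow> real) \<Rightarrow> bool" where
  "trace0 T w wx \<tau> \<longleftrightarrow> set_integrable lborel {0..T} \<tau> \<and>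
     (\<forall>\<psi>. test_fun T \<psi> \<longrightarrow>
        set_lebesgue_integral lborel ({0<..} \<times> {0..T}) (\<lambda>z. w z * px \<psi> z + wx z * \<psi> z)
          = - set_lebesgue_integral lborel {0..T} (\<lambda>t. \<tau> t * \<psi> (0, t)))"

definition dt_trace0_L3 :: "real \<Rightarrow> (real \<times> real \<Rightarrow> real) \<Rightarrow> (real \<times> real \<Rightarrow> real)
    \<Rightarrow> (real \<Rightarrow> real) \<Rightarrow> bool" where
  "dt_trace0_L3 T w wx v \<longleftrightarrow>
     set_borel_measurable lborel {0..T} v \<and>
     set_integrable lborel {0..T} (\<lambda>t. \<bar>v t\<bar> ^ 3) \<and>
     (\<exists>\<tau>. trace0 T w wx \<tau> \<and>
        (\<forall>\<psi>. test_fun T \<psi> \<longrightarrow>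
          set_lebesgue_integral lborel {0..T} (\<lambda>t. \<tau> t * pt \<psi> (0, t))
            = - set_lebesgue_integral lborel {0..T} (\<lambda>t. v t * \<psi> (0, t))))"

definition weak_solution :: "(real \<Rightarrow> real) \<Rightarrow> real \<Rightarrow> real \<Rightarrow> (real \<times> real \<Rightarrow> real) \<Rightarrow> bool" where
  "weak_solution g \<gamma> T w \<longleftrightarrow>
     (\<exists>wx wt v. H1_D T w wx wt \<and> dt_trace0_L3 T w wx v \<and>
       (\<forall>\<psi>. test_fun T \<psi> \<longrightarrow>
          set_lebesgue_integral lborel (Dom T)
              (\<lambda>z. - g (fst z) * wt z * pt \<psi> z + wx z * px \<psi> z)
          - \<gamma> * set_lebesgue_integral lborel {0..T} (\<lambda>t. (v t) ^ 3 * pt \<psi> (0, t)) = 0))"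

end

theory Submission
  imports Defs
begin

text \<open>
  Only odd multiples of a frequency \<open>\<Omega>\<close> with \<open>sqrt b * \<Omega> * c\<close> an odd multiple of \<open>pi / 2\<close> are excited.
  For these, the even solution of the linear equation that decays for \<open>\<bar>x\<bar> > c\<close> has Dirichlet-to-Neumann
  map \<open>(b / sqrt a) * \<bar>d/dt\<bar>\<close> at \<open>x = 0+\<close>, so that the jump condition at the origin becomes, after scaling,
  the equation \<open>V\<^sup>3 = \<bar>d/dt\<bar>\<^sup>-\<^sup>1 V\<close> for \<open>V = w\<^sub>t(0, \<cdot>)\<close>. On odd sine series \<open>\<bar>d/dt\<bar>\<^sup>-\<^sup>1\<close> has a positive kernel on
  \<open>[0, pi]\<close>, hence the iteration \<open>V \<mapsto> (\<bar>d/dt\<bar>\<^sup>-\<^sup>1 V)\<^sup>1\<^sup>/\<^sup>3\<close> started at the subsolution \<open>sin\<close> is increasing; it is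
  bounded because the right-hand side is sublinear, and the smoothing bound \<open>L\<^sup>2 \<rightarrow> L\<^sup>\<infinity>\<close> makes it converge uniformly.
  One profile \<open>V\<close> serves every admissible \<open>\<Omega>\<close>: the amplitude scales like \<open>\<Omega>\<^sup>-\<^sup>1\<^sup>/\<^sup>2\<close>, and \<open>w(0, 0)\<close> like
  \<open>\<Omega>\<^sup>-\<^sup>3\<^sup>/\<^sup>2\<close>, so that the infinitely many admissible \<open>\<Omega>\<close> give distinct solutions.
\<close>

section \<open>Sine series with odd frequencies\<close>

text \<open>Only continuity of \<open>V\<close> is available, so its sine coefficients are merely
  known to be square summable, and this shapes the treatment of \<open>w\<close>. The series of
  \<open>w\<close> and of its trace carry an extra factor 1 / \<open>od j\<close> and converge
  absolutely. The series of the two first derivatives converge in L2 only, through orthogonality in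
  time at fixed x. Every weak identity is therefore established for finite sums of modes and carried
  to the limit by pairing with test functions. For the same reason the trace is not differentiated
  term by term: its series is identified with an integral of \<open>V\<close>, to which the
  fundamental theorem of calculus applies. The condition \<gamma> < 0 is a sign condition on the
  amplitude: the flux jump of an even decaying mode has a fixed sign, and a real amplitude balances
  it against the cubic term when \<gamma> is negative. The frequencies used are
  \<open>od n * q * \<omega>\<close>: the factor \<open>q\<close> clears the denominator of p / q,
  and since odd numbers are closed under multiplication, resonance holds at each of them and at all
  of their odd harmonics.\<close>

definition od :: "nat \<Rightarrow> real" where
  "od j = 2 * real j + 1"

definition sine_coeff :: "(real \<Rightarrow> real) \<Rightarrow> nat \<Rightarrow> real" where
  "sine_coeff f j = 2 / pi * integral {0..pi} (\<lambda>s. f s * sin (od j * s))"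

text \<open>The operator \<open>\<bar>d/dt\<bar>\<^sup>-\<^sup>1\<close>, restricted to odd frequencies.\<close>

definition smoothing :: "(real \<Rightarrow> real) \<Rightarrow> real \<Rightarrow> real" where
  "smoothing f t = (\<Sum>j. sine_coeff f j / od j * sin (od j * t))"

lemma od_ge_1: "od j \<ge> 1" and od_pos [simp]: "od j > 0" and od_nonzero [simp]: "od j \<noteq> 0"
  by (auto simp: od_def)

lemma od_eq_of_nat: "od j = real (2 * j + 1)"
  by (simp add: od_def)

lemma od_eq_iff [simp]: "od i = od j \<longleftrightarrow> i = j"
  by (simp add: od_def)

lemma abs_mult_le_left:
  fixes x e :: real
  assumes "\<bar>e\<bar> \<le> 1"
  shows "\<bar>x * e\<bar> \<le> \<bar>x\<bar>"
  using assms by (simp add: abs_mult mult_right_le_one_le)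

lemma summable_inverse_od_squared: "summable (\<lambda>j. 1 / (od j)\<^sup>2)"
proof (rule summable_comparison_test')
  show "summable (\<lambda>j. inverse ((real (Suc j))^2))"
    using inverse_power_summable[of 2, where 'a=real]
    by (subst summable_Suc_iff[of "\<lambda>n. inverse ((real n)\<^sup>2)"]) simp
  show "norm (1 / (od j)\<^sup>2) \<le> inverse ((real (Suc j))^2)" for j
  proof -
    have "(real (Suc j))\<^sup>2 \<le> (od j)\<^sup>2" by (intro power_mono) (auto simp: od_def)
    then show ?thesis by (simp add: divide_inverse le_imp_inverse_le)
  qed
qed

lemma has_integral_cos_zero:
  fixes \<mu> T :: real
  assumes "\<mu> \<noteq> 0" "sin (\<mu> * T) = 0" "T \<ge> 0"
  shows "((\<lambda>t. cos (\<mu> * t)) has_integral 0) {0..T}"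
proof -
  have "((\<lambda>t. cos (\<mu> * t)) has_integral (sin (\<mu> * T) / \<mu> - sin (\<mu> * 0) / \<mu>)) {0..T}"
    using assms
    by (intro fundamental_theorem_of_calculus)
      (auto intro!: derivative_eq_intros simp flip: has_real_derivative_iff_has_vector_derivative)
  then show ?thesis using assms by simp
qed

lemma sin_2_pi_of_int: "sin (2 * pi * real_of_int n) = 0"
  using sin_int_2pin[of n] by (simp add: mult_ac)

text \<open>Sums and differences of odd numbers are even, so the product-to-sum formulas leave only
  frequencies that complete full periods as soon as \<Omega> * T is a multiple of pi, not just of 2
  * pi. The half period \<open>{0..pi}\<close> is the case k = 1; the time interval
  \<open>{0..T}\<close> uses an even multiple.\<close>

lemma od_modes_orthogonal:
  fixes \<Omega> T :: real and k :: nat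
  assumes T: "T \<ge> 0" and \<Omega>: "\<Omega> > 0" "\<Omega> * T = pi * real k"
  shows "((\<lambda>t. cos (od i * \<Omega> * t) * cos (od j * \<Omega> * t)) has_integral (if i = j then T / 2 else 0)) {0..T}"
    and "((\<lambda>t. sin (od i * \<Omega> * t) * sin (od j * \<Omega> * t)) has_integral (if i = j then T / 2 else 0)) {0..T}"
proof -
  define D where "D = (if i = j then T else 0)"
  have sin0: "sin (2 * real_of_int n * \<Omega> * T) = 0" for n
  proof -
    have "2 * real_of_int n * \<Omega> * T = 2 * pi * real_of_int (n * int k)"
      using \<Omega>(2) by (simp add: mult_ac)
    then show ?thesis
      using sin_2_pi_of_int[of "n * int k"] by metis
  qed
  have diff: "((\<lambda>t. cos ((od i - od j) * \<Omega> * t)) has_integral D) {0..T}"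
  proof (cases "i = j")
    case True
    then show ?thesis using has_integral_const_real[of "1::real" 0 T] T by (simp add: D_def)
  next
    case False
    have e: "od i - od j = 2 * real_of_int (int i - int j)"
      by (simp add: od_def)
    show ?thesis
      using has_integral_cos_zero[of "(od i - od j) * \<Omega>" T] False \<Omega> T sin0[of "int i - int j"]
      by (simp add: D_def e)
  qed
  have plus: "((\<lambda>t. cos ((od i + od j) * \<Omega> * t)) has_integral 0) {0..T}"
  proof -
    have e: "od i + od j = 2 * real_of_int (int i + int j + 1)"
      by (simp add: od_def)
    have "od i + od j > 0" by (simp add: add_pos_pos)
    then show ?thesis
      using has_integral_cos_zero[of "(od i + od j) * \<Omega>" T] \<Omega> T sin0[of "int i + int j + 1"]
      by (simp add: e)
  qed
  have "((\<lambda>t. (cos ((od i - od j) * \<Omega> * t) + cos ((od i + od j) * \<Omega> * t)) / 2) has_integral (D + 0) / 2) {0..T}"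
    by (intro has_integral_divide has_integral_add diff plus)
  moreover have "(\<lambda>t. (cos ((od i - od j) * \<Omega> * t) + cos ((od i + od j) * \<Omega> * t)) / 2)
      = (\<lambda>t. cos (od i * \<Omega> * t) * cos (od j * \<Omega> * t))"
    by (auto simp: algebra_simps cos_add cos_diff)
  ultimately show "((\<lambda>t. cos (od i * \<Omega> * t) * cos (od j * \<Omega> * t)) has_integral (if i = j then T / 2 else 0)) {0..T}"
    by (auto simp: D_def)
  have "((\<lambda>t. (cos ((od i - od j) * \<Omega> * t) - cos ((od i + od j) * \<Omega> * t)) / 2) has_integral (D - 0) / 2) {0..T}"
    by (intro has_integral_divide has_integral_diff diff plus)
  moreover have "(\<lambda>t. (cos ((od i - od j) * \<Omega> * t) - cos ((od i + od j) * \<Omega> * t)) / 2)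
      = (\<lambda>t. sin (od i * \<Omega> * t) * sin (od j * \<Omega> * t))"
    by (auto simp: algebra_simps cos_add cos_diff)
  ultimately show "((\<lambda>t. sin (od i * \<Omega> * t) * sin (od j * \<Omega> * t)) has_integral (if i = j then T / 2 else 0)) {0..T}"
    by (auto simp: D_def)
qed

lemma has_integral_orthogonal_sum_squared:
  fixes e :: "nat \<Rightarrow> real \<Rightarrow> real"
  assumes "finite F"
    and "\<And>i j. ((\<lambda>t. e i t * e j t) has_integral (if i = j then L else 0)) S"
  shows "((\<lambda>t. (\<Sum>j\<in>F. c j * e j t)\<^sup>2) has_integral L * (\<Sum>j\<in>F. (c j)\<^sup>2)) S"
proof -
  have "((\<lambda>t. \<Sum>i\<in>F. \<Sum>j\<in>F. c i * c j * (e i t * e j t)) has_integral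
      (\<Sum>i\<in>F. \<Sum>j\<in>F. c i * c j * (if i = j then L else 0))) S"
    by (intro has_integral_sum assms has_integral_mult_right)
  moreover have "(\<lambda>t. \<Sum>i\<in>F. \<Sum>j\<in>F. c i * c j * (e i t * e j t)) = (\<lambda>t. (\<Sum>j\<in>F. c j * e j t)\<^sup>2)"
    by (auto simp: power2_eq_square sum_product mult_ac)
  moreover have "(\<Sum>i\<in>F. \<Sum>j\<in>F. c i * c j * (if i = j then L else 0)) = (\<Sum>i\<in>F. L * (c i)\<^sup>2)"
    using assms(1) by (intro sum.cong refl) (simp add: if_distrib power2_eq_square mult_ac cong: if_cong)
  ultimately show ?thesis
    by (simp add: sum_distrib_left)
qed

lemma sine_orthogonal:
  "((\<lambda>s. sin (od i * s) * sin (od j * s)) has_integral (if i = j then pi / 2 else 0)) {0..pi}"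
  using od_modes_orthogonal(2)[of pi 1 1 i j] by simp

lemma bessel_sine:
  assumes f: "continuous_on {0..pi} f"
  shows "(\<Sum>j<n. (sine_coeff f j)\<^sup>2) \<le> 2 / pi * integral {0..pi} (\<lambda>s. (f s)\<^sup>2)"
proof -
  define c where "c = sine_coeff f"
  define S where "S = (\<lambda>s. \<Sum>j<n. c j * sin (od j * s))"
  have [continuous_intros]: "continuous_on A (\<lambda>s. sin (od j * s))" for A j
    by (intro continuous_intros)
  have 1: "((\<lambda>s. f s * sin (od j * s)) has_integral pi / 2 * c j) {0..pi}" for j
  proof -
    have "(\<lambda>s. f s * sin (od j * s)) integrable_on {0..pi}"
      by (intro integrable_continuous_real continuous_intros f)
    then show ?thesis by (simp add: has_integral_integral c_def sine_coeff_def)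
  qed
  have 2: "((\<lambda>s. \<Sum>j<n. c j * (f s * sin (od j * s))) has_integral (\<Sum>j<n. c j * (pi / 2 * c j))) {0..pi}"
    by (intro has_integral_sum has_integral_mult_right 1) auto
  have 3: "((\<lambda>s. (S s)\<^sup>2) has_integral pi / 2 * (\<Sum>j<n. (c j)\<^sup>2)) {0..pi}"
    unfolding S_def by (intro has_integral_orthogonal_sum_squared sine_orthogonal) auto
  have 4: "((\<lambda>s. (f s)\<^sup>2) has_integral integral {0..pi} (\<lambda>s. (f s)\<^sup>2)) {0..pi}"
    by (intro integrable_integral integrable_continuous_real continuous_intros f)
  have "((\<lambda>s. (f s)\<^sup>2 - 2 * (\<Sum>j<n. c j * (f s * sin (od j * s))) + (S s)\<^sup>2) has_integral
     integral {0..pi} (\<lambda>s. (f s)\<^sup>2) - 2 * (\<Sum>j<n. c j * (pi / 2 * c j)) + pi / 2 * (\<Sum>j<n. (c j)\<^sup>2)) {0..pi}"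
    by (intro has_integral_add has_integral_diff has_integral_mult_right 2 3 4)
  moreover have "(f s)\<^sup>2 - 2 * (\<Sum>j<n. c j * (f s * sin (od j * s))) + (S s)\<^sup>2 \<ge> 0" for s
  proof -
    have "(\<Sum>j<n. c j * (f s * sin (od j * s))) = f s * S s"
      by (simp add: S_def sum_distrib_left mult_ac)
    then have "(f s)\<^sup>2 - 2 * (\<Sum>j<n. c j * (f s * sin (od j * s))) + (S s)\<^sup>2 = (f s - S s)\<^sup>2"
      by (simp add: power2_diff)
    then show ?thesis by simp
  qed
  ultimately have "0 \<le> integral {0..pi} (\<lambda>s. (f s)\<^sup>2) - 2 * (\<Sum>j<n. c j * (pi / 2 * c j)) + pi / 2 * (\<Sum>j<n. (c j)\<^sup>2)"
    by (rule has_integral_nonneg)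
  moreover have "(\<Sum>j<n. c j * (pi / 2 * c j)) = pi / 2 * (\<Sum>j<n. (c j)\<^sup>2)"
    by (simp add: sum_distrib_left power2_eq_square mult_ac)
  ultimately have "pi / 2 * (\<Sum>j<n. (c j)\<^sup>2) \<le> integral {0..pi} (\<lambda>s. (f s)\<^sup>2)"
    by linarith
  then show ?thesis by (simp add: c_def field_simps)
qed

lemma summable_sine_coeff_squared:
  assumes "continuous_on {0..pi} f"
  shows "summable (\<lambda>j. (sine_coeff f j)\<^sup>2)"
  using bessel_sine[OF assms] by (intro summableI_nonneg_bounded) auto

text \<open>The two constants met in bounding the sum of |c_j| / \<open>od j\<close>: the
  Cauchy-Schwarz factor, the sum of 1 / \<open>od j\<close> squared, and the factor 2 / pi of
  Bessel's inequality.\<close>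

definition smoothing_const :: real where
  "smoothing_const = (\<Sum>j. 1 / (od j)\<^sup>2) * 2 / pi"

lemma smoothing_const_pos: "smoothing_const > 0"
  unfolding smoothing_const_def
  by (intro divide_pos_pos mult_pos_pos suminf_pos summable_inverse_od_squared) auto

text \<open>Cauchy-Schwarz pairs the square summable coefficients of Bessel's inequality with the
  square summable 1 / \<open>od j\<close>. This is the gain from L2 to absolute convergence on which
  all later pointwise series rest.\<close>

lemma sine_coeff_over_od:
  assumes f: "continuous_on {0..pi} f"
  defines "B \<equiv> sqrt (smoothing_const * integral {0..pi} (\<lambda>s. (f s)\<^sup>2))"
  shows "summable (\<lambda>j. \<bar>sine_coeff f j / od j\<bar>)" "(\<Sum>j. \<bar>sine_coeff f j / od j\<bar>) \<le> B"
proof -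
  have I: "integral {0..pi} (\<lambda>s. (f s)\<^sup>2) \<ge> 0"
    by (intro integral_nonneg integrable_continuous_real continuous_intros f) auto
  have le: "(\<Sum>j<n. \<bar>sine_coeff f j / od j\<bar>) \<le> B" for n
  proof -
    have "(\<Sum>j<n. \<bar>sine_coeff f j / od j\<bar>)\<^sup>2 = (\<Sum>j<n. \<bar>sine_coeff f j\<bar> * (1 / od j))\<^sup>2"
      by (simp add: abs_divide abs_of_pos)
    also have "\<dots> \<le> (\<Sum>j<n. \<bar>sine_coeff f j\<bar>\<^sup>2) * (\<Sum>j<n. (1 / od j)\<^sup>2)"
      by (rule Cauchy_Schwarz_ineq_sum)
    also have "\<dots> \<le> (2 / pi * integral {0..pi} (\<lambda>s. (f s)\<^sup>2)) * (\<Sum>j. 1 / (od j)\<^sup>2)"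
      using bessel_sine[OF f, of n] I sum_le_suminf[OF summable_inverse_od_squared, of "{..<n}"]
      by (intro mult_mono) (auto simp: power_divide intro!: sum_nonneg)
    also have "\<dots> = smoothing_const * integral {0..pi} (\<lambda>s. (f s)\<^sup>2)"
      by (simp add: smoothing_const_def)
    finally show ?thesis
      unfolding B_def by (rule real_le_rsqrt)
  qed
  show s: "summable (\<lambda>j. \<bar>sine_coeff f j / od j\<bar>)"
    by (rule summableI_nonneg_bounded[OF _ le]) auto
  show "(\<Sum>j. \<bar>sine_coeff f j / od j\<bar>) \<le> B"
    by (rule suminf_le_const[OF s le])
qed

lemma summable_smoothing:
  assumes f: "continuous_on {0..pi} f" and "\<And>j. \<bar>e j\<bar> \<le> 1"
  shows "summable (\<lambda>j. sine_coeff f j / od j * e j)"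
  by (rule summable_comparison_test'[OF sine_coeff_over_od(1)[OF f]])
    (simp only: real_norm_def, intro abs_mult_le_left assms(2))

lemma abs_smoothing_le:
  assumes f: "continuous_on {0..pi} f"
  shows "\<bar>smoothing f t\<bar> \<le> sqrt (smoothing_const * integral {0..pi} (\<lambda>s. (f s)\<^sup>2))"
proof -
  have le: "\<bar>sine_coeff f j / od j * sin (od j * t)\<bar> \<le> \<bar>sine_coeff f j / od j\<bar>" for j
    by (rule abs_mult_le_left) simp
  have s: "summable (\<lambda>j. \<bar>sine_coeff f j / od j * sin (od j * t)\<bar>)"
    by (rule summable_comparison_test'[OF sine_coeff_over_od(1)[OF f]]) (use le in auto)
  have "\<bar>smoothing f t\<bar> \<le> (\<Sum>j. \<bar>sine_coeff f j / od j * sin (od j * t)\<bar>)"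
    unfolding smoothing_def using summable_rabs[OF s] .
  also have "\<dots> \<le> (\<Sum>j. \<bar>sine_coeff f j / od j\<bar>)"
    by (intro suminf_le s le sine_coeff_over_od(1)[OF f])
  finally show ?thesis using sine_coeff_over_od(2)[OF f] by linarith
qed

lemma continuous_on_suminf_abs:
  fixes c :: "nat \<Rightarrow> real" and e :: "nat \<Rightarrow> 'a::topological_space \<Rightarrow> real"
  assumes "summable (\<lambda>j. \<bar>c j\<bar>)" "\<And>j x. x \<in> A \<Longrightarrow> \<bar>e j x\<bar> \<le> M" "\<And>j. continuous_on A (e j)"
  shows "continuous_on A (\<lambda>x. \<Sum>j. c j * e j x)"
proof (rule uniform_limit_theorem)
  show "uniform_limit A (\<lambda>n x. \<Sum>j<n. c j * e j x) (\<lambda>x. \<Sum>j. c j * e j x) sequentially"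
  proof (rule Weierstrass_m_test)
    show "summable (\<lambda>j. \<bar>c j\<bar> * M)"
      by (rule summable_mult2[OF assms(1)])
    show "norm (c j * e j x) \<le> \<bar>c j\<bar> * M" if "x \<in> A" for j x
      using assms(2)[OF that] by (auto simp: abs_mult intro!: mult_left_mono)
  qed
  show "\<forall>\<^sub>F n in sequentially. continuous_on A (\<lambda>x. \<Sum>j<n. c j * e j x)"
    by (intro always_eventually allI continuous_intros assms(3))
qed auto

lemma continuous_on_smoothing:
  assumes f: "continuous_on {0..pi} f"
  shows "continuous_on A (smoothing f)"
  unfolding smoothing_def
  by (rule continuous_on_suminf_abs[where M = 1, OF sine_coeff_over_od(1)[OF f]])
    (auto intro!: continuous_intros)

lemma sine_coeff_diff:
  assumes "continuous_on {0..pi} f" "continuous_on {0..pi} h"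
  shows "sine_coeff (\<lambda>s. f s - h s) j = sine_coeff f j - sine_coeff h j"
proof -
  have "integral {0..pi} (\<lambda>s. (f s - h s) * sin (od j * s))
     = integral {0..pi} (\<lambda>s. f s * sin (od j * s) - h s * sin (od j * s))"
    by (simp add: algebra_simps)
  also have "\<dots> = integral {0..pi} (\<lambda>s. f s * sin (od j * s)) - integral {0..pi} (\<lambda>s. h s * sin (od j * s))"
    by (intro Henstock_Kurzweil_Integration.integral_diff integrable_continuous_real continuous_intros assms)
  finally show ?thesis by (simp add: sine_coeff_def right_diff_distrib)
qed

lemma smoothing_diff:
  assumes "continuous_on {0..pi} f" "continuous_on {0..pi} h"
  shows "smoothing (\<lambda>s. f s - h s) t = smoothing f t - smoothing h t"
proof -
  have "smoothing f t - smoothing h t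
    = (\<Sum>j. sine_coeff f j / od j * sin (od j * t) - sine_coeff h j / od j * sin (od j * t))"
    unfolding smoothing_def by (intro suminf_diff summable_smoothing assms) auto
  then show ?thesis
    by (simp add: smoothing_def sine_coeff_diff[OF assms] diff_divide_distrib left_diff_distrib)
qed

section \<open>Closed forms of Abel means and positivity of the smoothing operator\<close>

text \<open>Twice the power series of artanh: in the difference of the two logarithmic series the
  even powers cancel and the odd ones double.\<close>

lemma od_power_series_Ln:
  assumes "norm z < 1"
  shows "(\<lambda>j. 2 * z ^ (2 * j + 1) / complex_of_real (od j)) sums (Ln (1 + z) - Ln (1 - z))"
proof -
  define f where "f = (\<lambda>n. - ((-z)^n) / of_nat n - - (z^n) / of_nat n)"
  have "f sums (Ln (1 + z) - Ln (1 - z))"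
    unfolding f_def using Ln_series'[of z] Ln_series'[of "-z"] assms by (intro sums_diff) auto
  moreover have "(\<lambda>j. f (2 * j + 1)) sums (Ln (1 + z) - Ln (1 - z)) \<longleftrightarrow> f sums (Ln (1 + z) - Ln (1 - z))"
  proof (rule sums_mono_reindex)
    show "strict_mono (\<lambda>j::nat. 2 * j + 1)" by (auto simp: strict_mono_def)
    show "f n = 0" if "n \<notin> range (\<lambda>j. 2 * j + 1)" for n
    proof -
      have "even n" using that by (metis oddE rangeI)
      then show ?thesis by (simp add: f_def)
    qed
  qed
  moreover have "f (2 * j + 1) = 2 * z ^ (2 * j + 1) / complex_of_real (od j)" for j
  proof -
    have "complex_of_real (od j) = of_nat (2 * j + 1)"
      unfolding od_eq_of_nat by (rule of_real_of_nat_eq)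
    moreover have "(-z) ^ (2 * j + 1) = - (z ^ (2 * j + 1))" by simp
    ultimately show ?thesis unfolding f_def by (simp add: diff_divide_distrib)
  qed
  ultimately show ?thesis by simp
qed

text \<open>Real and imaginary parts of artanh at z = r * cis \<theta>. The real part is a logarithm
  of |1 + z| / |1 - z|, the imaginary part half the difference of the arguments of 1 + z and 1 -
  z.\<close>

lemma od_cos_sin_series:
  fixes r \<theta> :: real
  assumes r: "0 < r" "r < 1"
  shows od_cos_series: "(\<lambda>j. r ^ (2 * j + 1) / od j * cos (od j * \<theta>)) sums
      (ln ((1 + r\<^sup>2 + 2 * r * cos \<theta>) / (1 + r\<^sup>2 - 2 * r * cos \<theta>)) / 4)"
    and od_sin_series: "(\<lambda>j. r ^ (2 * j + 1) / od j * sin (od j * \<theta>)) sums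
      (arctan (2 * r * sin \<theta> / (1 - r\<^sup>2)) / 2)"
proof -
  define z where "z = complex_of_real r * cis \<theta>"
  have nz: "norm z < 1" using r by (simp add: z_def norm_mult)
  have nz': "norm (cnj z) < 1" using nz by simp
  have pos: "Re (1 + z) > 0" "Re (1 - z) > 0" "Re (1 - cnj z) > 0"
    using abs_Re_le_cmod[of z] nz by (auto simp: abs_le_iff)
  then have non0: "1 + z \<noteq> 0" "1 - z \<noteq> 0" "1 - cnj z \<noteq> 0" by (metis zero_complex.sel(1) less_irrefl)+
  have pw: "2 * z ^ (2 * j + 1) / complex_of_real (od j) = complex_of_real (2 * r ^ (2 * j + 1) / od j) * cis (od j * \<theta>)" for j
  proof -
    have "z ^ (2 * j + 1) = complex_of_real (r ^ (2 * j + 1)) * cis (real (2 * j + 1) * \<theta>)"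
      unfolding z_def power_mult_distrib of_real_power Complex.DeMoivre by (rule refl)
    then show ?thesis unfolding od_eq_of_nat by simp
  qed
  have s: "(\<lambda>j. complex_of_real (2 * r ^ (2 * j + 1) / od j) * cis (od j * \<theta>)) sums (Ln (1 + z) - Ln (1 - z))"
    using od_power_series_Ln[OF nz] unfolding pw .
  have re: "(\<lambda>j. 2 * r ^ (2 * j + 1) / od j * cos (od j * \<theta>)) sums Re (Ln (1 + z) - Ln (1 - z))"
    using sums_Re[OF s] by simp
  have im: "(\<lambda>j. 2 * r ^ (2 * j + 1) / od j * sin (od j * \<theta>)) sums Im (Ln (1 + z) - Ln (1 - z))"
    using sums_Im[OF s] by simp
  have half: "2 * x / y * w / 2 = x / y * w" for x y w :: real by simp
  have n1: "(norm (1 + z))\<^sup>2 = 1 + r\<^sup>2 + 2 * r * cos \<theta>"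
  proof -
    have "(norm (1 + z))\<^sup>2 = (1 + r * cos \<theta>)\<^sup>2 + (r * sin \<theta>)\<^sup>2"
      unfolding cmod_power2 by (simp add: z_def)
    also have "\<dots> = 1 + r\<^sup>2 * ((sin \<theta>)\<^sup>2 + (cos \<theta>)\<^sup>2) + 2 * r * cos \<theta>"
      by algebra
    finally show ?thesis by simp
  qed
  have n2: "(norm (1 - z))\<^sup>2 = 1 + r\<^sup>2 - 2 * r * cos \<theta>"
  proof -
    have "(norm (1 - z))\<^sup>2 = (1 - r * cos \<theta>)\<^sup>2 + (r * sin \<theta>)\<^sup>2"
      unfolding cmod_power2 by (simp add: z_def)
    also have "\<dots> = 1 + r\<^sup>2 * ((sin \<theta>)\<^sup>2 + (cos \<theta>)\<^sup>2) - 2 * r * cos \<theta>"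
      by algebra
    finally show ?thesis by simp
  qed
  have "ln ((1 + r\<^sup>2 + 2 * r * cos \<theta>) / (1 + r\<^sup>2 - 2 * r * cos \<theta>))
      = ln ((norm (1 + z))\<^sup>2) - ln ((norm (1 - z))\<^sup>2)"
    unfolding n1[symmetric] n2[symmetric] using non0 by (intro ln_divide_pos) auto
  also have "\<dots> = 2 * Re (Ln (1 + z) - Ln (1 - z))"
    using non0 by (simp add: ln_realpow)
  finally have "Re (Ln (1 + z) - Ln (1 - z)) / 2 = ln ((1 + r\<^sup>2 + 2 * r * cos \<theta>) / (1 + r\<^sup>2 - 2 * r * cos \<theta>)) / 4"
    by simp
  then show "(\<lambda>j. r ^ (2 * j + 1) / od j * cos (od j * \<theta>)) sums
      (ln ((1 + r\<^sup>2 + 2 * r * cos \<theta>) / (1 + r\<^sup>2 - 2 * r * cos \<theta>)) / 4)"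
    using sums_divide[OF re, of 2] unfolding half by (simp only:)
  \<comment> \<open>Conjugating the second factor turns the difference of arguments into a sum. Both
    factors lie in the right half-plane, so the arguments add without a branch jump, and the product
    again has positive real part, which makes its argument an arctan.\<close>
  have "Im (Ln (1 + z) - Ln (1 - z)) = Im (Ln (1 + z) + Ln (1 - cnj z))"
  proof -
    have "Ln (cnj (1 - z)) = cnj (Ln (1 - z))"
      using pos(2) by (intro cnj_Ln[symmetric]) (auto simp: complex_nonpos_Reals_iff)
    then show ?thesis by simp
  qed
  also have "Ln (1 + z) + Ln (1 - cnj z) = Ln ((1 + z) * (1 - cnj z))"
    using Re_Ln_pos_lt_imp[OF pos(1)] Re_Ln_pos_lt_imp[OF pos(3)] non0
    by (intro Ln_times_simple[symmetric]) (auto simp: abs_less_iff)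
  also have "(1 + z) * (1 - cnj z) = Complex (1 - r\<^sup>2) (2 * r * sin \<theta>)"
  proof -
    have "r * (r * (cos \<theta> * cos \<theta>)) + r * (r * (sin \<theta> * sin \<theta>)) = r\<^sup>2 * ((sin \<theta>)\<^sup>2 + (cos \<theta>)\<^sup>2)"
      by (simp only: distrib_left power2_eq_square mult.assoc add.commute)
    then have "r * (r * (cos \<theta> * cos \<theta>)) + r * (r * (sin \<theta> * sin \<theta>)) = r\<^sup>2"
      by simp
    then show ?thesis
      by (simp add: complex_eq_iff z_def algebra_simps power2_eq_square)
  qed
  also have "Im (Ln (Complex (1 - r\<^sup>2) (2 * r * sin \<theta>))) = arctan (2 * r * sin \<theta> / (1 - r\<^sup>2))"
  proof -
    have "1 - r\<^sup>2 > 0" using r by (simp add: power_less_one_iff abs_square_less_1)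
    moreover from this have "Complex (1 - r\<^sup>2) (2 * r * sin \<theta>) \<noteq> 0"
      by (auto simp: complex_eq_iff)
    ultimately show ?thesis by (subst Im_Ln_eq) auto
  qed
  finally show "(\<lambda>j. r ^ (2 * j + 1) / od j * sin (od j * \<theta>)) sums
      (arctan (2 * r * sin \<theta> / (1 - r\<^sup>2)) / 2)"
    using sums_divide[OF im, of 2] unfolding half by simp
qed

text \<open>The series is the kernel of the Abel means of \<^const>\<open>smoothing\<close>, which is therefore order preserving.\<close>

lemma od_sin_sin_series_nonneg:
  fixes r s t :: real
  assumes r: "0 < r" "r < 1" and "s \<in> {0..pi}" "t \<in> {0..pi}"
  shows "(\<Sum>j. r ^ (2 * j + 1) / od j * (sin (od j * t) * sin (od j * s))) \<ge> 0"
proof -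
  define C where "C = (\<lambda>\<theta>. ln ((1 + r\<^sup>2 + 2 * r * cos \<theta>) / (1 + r\<^sup>2 - 2 * r * cos \<theta>)) / 4)"
  have "(\<lambda>j. (r ^ (2 * j + 1) / od j * cos (od j * (t - s)) - r ^ (2 * j + 1) / od j * cos (od j * (t + s))) / 2)
      sums ((C (t - s) - C (t + s)) / 2)"
    unfolding C_def by (intro sums_divide sums_diff od_cos_series r)
  moreover have "(r ^ (2 * j + 1) / od j * cos (od j * (t - s)) - r ^ (2 * j + 1) / od j * cos (od j * (t + s))) / 2
     = r ^ (2 * j + 1) / od j * (sin (od j * t) * sin (od j * s))" for j
    by (simp add: distrib_left right_diff_distrib cos_add cos_diff)
  ultimately have "(\<Sum>j. r ^ (2 * j + 1) / od j * (sin (od j * t) * sin (od j * s))) = (C (t - s) - C (t + s)) / 2"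
    by (simp add: sums_iff)
  \<comment> \<open>\<open>C \<theta>\<close> depends on \<theta> only through cos \<theta> and is
    increasing in it, while cos (t - s) - cos (t + s) = 2 * sin t * sin s is nonnegative on the
    square.\<close>
  moreover have "C (t + s) \<le> C (t - s)"
  proof -
    have "sin t * sin s \<ge> 0" using assms by (intro mult_nonneg_nonneg sin_ge_zero) auto
    then have le: "cos (t + s) \<le> cos (t - s)" by (simp add: cos_add cos_diff)
    have pos: "1 + r\<^sup>2 + 2 * r * cos \<theta> > 0" "1 + r\<^sup>2 - 2 * r * cos \<theta> > 0" for \<theta>
    proof -
      have "2 * r * \<bar>cos \<theta>\<bar> \<le> 2 * r * 1" using r by (intro mult_left_mono) auto
      then have "\<bar>2 * r * cos \<theta>\<bar> \<le> 2 * r" using r by (simp add: abs_mult)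
      moreover have "(1 - r)\<^sup>2 > 0" using r by simp
      ultimately show "1 + r\<^sup>2 + 2 * r * cos \<theta> > 0" "1 + r\<^sup>2 - 2 * r * cos \<theta> > 0"
        by (auto simp: power2_diff abs_le_iff)
    qed
    have "(1 + r\<^sup>2 + 2 * r * cos (t + s)) / (1 + r\<^sup>2 - 2 * r * cos (t + s))
       \<le> (1 + r\<^sup>2 + 2 * r * cos (t - s)) / (1 + r\<^sup>2 - 2 * r * cos (t - s))"
      using le r pos by (intro frac_le) (auto intro: less_imp_le)
    then show ?thesis using pos by (auto simp: C_def)
  qed
  ultimately show ?thesis by simp
qed

text \<open>Termwise integration by the M-test. The terms are written as coefficient times bounded
  function so that the kernels of both Abel arguments, for positivity and for the window integral,
  fit the same statement.\<close>

lemma integral_suminf_abs: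
  fixes c :: "nat \<Rightarrow> real" and e :: "nat \<Rightarrow> real \<Rightarrow> real"
  assumes "summable (\<lambda>j. \<bar>c j\<bar>)" "\<And>j x. x \<in> {u..v} \<Longrightarrow> \<bar>e j x\<bar> \<le> M" "\<And>j. continuous_on {u..v} (e j)"
    and f: "continuous_on {u..v} f"
  shows "(\<lambda>j. c j * integral {u..v} (\<lambda>x. f x * e j x)) sums integral {u..v} (\<lambda>x. f x * (\<Sum>j. c j * e j x))"
proof -
  obtain B where B: "\<And>x. x \<in> {u..v} \<Longrightarrow> \<bar>f x\<bar> \<le> B"
    using compact_imp_bounded[OF compact_continuous_image[OF f compact_Icc]]
    unfolding bounded_iff by fastforce
  have "uniform_limit {u..v} (\<lambda>n x. \<Sum>j<n. f x * (c j * e j x)) (\<lambda>x. \<Sum>j. f x * (c j * e j x)) sequentially"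
  proof (rule Weierstrass_m_test)
    show "summable (\<lambda>j. B * (\<bar>c j\<bar> * M))"
      by (intro summable_mult summable_mult2 assms(1))
    show "norm (f x * (c j * e j x)) \<le> B * (\<bar>c j\<bar> * M)" if "x \<in> {u..v}" for j x
    proof -
      have "B \<ge> 0" using B[OF that] by linarith
      then show ?thesis
        using assms(2)[OF that, of j] B[OF that] by (auto simp: abs_mult intro!: mult_mono)
    qed
  qed
  then obtain I J where IJ: "\<And>n. ((\<lambda>x. \<Sum>j<n. f x * (c j * e j x)) has_integral I n) {u..v}"
    "((\<lambda>x. \<Sum>j. f x * (c j * e j x)) has_integral J) {u..v}" "I \<longlonglongrightarrow> J"
    by (rule uniform_limit_integral) (intro continuous_intros f assms(3), auto)
  have "summable (\<lambda>j. c j * e j x)" if "x \<in> {u..v}" for x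
    by (rule summable_comparison_test'[OF summable_mult2[OF assms(1), of M]])
      (use assms(2)[OF that] in \<open>auto simp: abs_mult intro!: mult_left_mono\<close>)
  then have "integral {u..v} (\<lambda>x. f x * (\<Sum>j. c j * e j x)) = integral {u..v} (\<lambda>x. \<Sum>j. f x * (c j * e j x))"
    by (intro integral_cong suminf_mult[symmetric])
  then have J: "J = integral {u..v} (\<lambda>x. f x * (\<Sum>j. c j * e j x))"
    using IJ(2) by (simp add: integral_unique)
  have "I n = (\<Sum>j<n. c j * integral {u..v} (\<lambda>x. f x * e j x))" for n
  proof -
    have "((\<lambda>x. \<Sum>j<n. c j * (f x * e j x)) has_integral (\<Sum>j<n. c j * integral {u..v} (\<lambda>x. f x * e j x))) {u..v}"
      by (intro has_integral_sum has_integral_mult_right integrable_integral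
          integrable_continuous_real continuous_intros f assms(3)) auto
    then show ?thesis
      using IJ(1)[of n] by (auto simp: mult.left_commute intro: has_integral_unique)
  qed
  then show ?thesis
    using IJ(3) unfolding sums_def J by presburger
qed

text \<open>A sequence increasing to 1 lets Abel limits be taken with sequential convergence
  theorems. The offset 2 keeps the first radius at 1 / 2, strictly inside the unit interval.\<close>

definition abel_radius :: "nat \<Rightarrow> real" where
  "abel_radius n = 1 - 1 / real (n + 2)"

lemma abel_radius: "0 < abel_radius n" "abel_radius n < 1"
  by (auto simp: abel_radius_def field_simps)

lemma abel_radius_tendsto: "abel_radius \<longlonglongrightarrow> 1"
proof -
  have "(\<lambda>n. 1 - 1 / real (n + 2)) \<longlonglongrightarrow> 1 - 0"
    by (intro tendsto_diff tendsto_const LIMSEQ_ignore_initial_segment lim_1_over_n)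
  then show ?thesis by (simp add: abel_radius_def[abs_def])
qed

text \<open>The damping factors lie in [0, 1], so |c_j| is a summable majorant and Tannery's theorem
  exchanges limit and sum.\<close>

lemma abel_sum_tendsto:
  fixes c :: "nat \<Rightarrow> real"
  assumes "summable (\<lambda>j. \<bar>c j\<bar>)"
  shows "(\<lambda>n. \<Sum>j. abel_radius n ^ (2 * j + 1) * c j) \<longlonglongrightarrow> (\<Sum>j. c j)"
proof -
  have "(\<lambda>n. abel_radius n ^ (2 * j + 1) * c j) \<longlonglongrightarrow> c j" for j
    using tendsto_mult_right[OF tendsto_power[OF abel_radius_tendsto, of "2 * j + 1"], of "c j"] by simp
  moreover have "\<forall>\<^sub>F (j, n) in at_top \<times>\<^sub>F sequentially. norm (abel_radius n ^ (2 * j + 1) * c j) \<le> \<bar>c j\<bar>"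
  proof (intro always_eventually allI, clarify)
    fix j n
    have "0 \<le> abel_radius n ^ (2 * j + 1)" "abel_radius n ^ (2 * j + 1) \<le> 1"
      using abel_radius[of n] by (auto intro!: power_le_one simp del: power_Suc)
    then show "norm (abel_radius n ^ (2 * j + 1) * c j) \<le> \<bar>c j\<bar>"
      by (auto simp: abs_mult simp del: power_Suc intro!: mult_left_le_one_le)
  qed
  ultimately show ?thesis
    using tannerys_theorem[of "\<lambda>j n. abel_radius n ^ (2 * j + 1) * c j" c sequentially "\<lambda>j. \<bar>c j\<bar>"] assms
    by auto
qed

lemma summable_abel_weights:
  assumes "0 < r" "r < (1::real)"
  shows "summable (\<lambda>j. \<bar>r ^ (2 * j + 1) / od j\<bar>)"
proof (rule summable_comparison_test')
  show "summable (\<lambda>j. r ^ j)" using assms by (intro summable_geometric) auto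
  show "norm \<bar>r ^ (2 * j + 1) / od j\<bar> \<le> r ^ j" for j
  proof -
    have "\<bar>r ^ (2 * j + 1) / od j\<bar> \<le> r ^ (2 * j + 1) / 1"
      using assms od_ge_1[of j] unfolding abs_divide by (intro frac_le) auto
    also have "\<dots> \<le> r ^ j" using assms by (simp del: power_Suc add: power_decreasing)
    finally show ?thesis by simp
  qed
qed

text \<open>The Abel mean of the series is 2 / pi times the integral of \<open>f\<close> against a
  nonnegative kernel. Working with r < 1 avoids the undamped kernel, which has a logarithmic
  singularity on the diagonal; nonnegativity survives the limit r to 1.\<close>

lemma smoothing_nonneg:
  assumes f: "continuous_on {0..pi} f" and nn: "\<And>s. s \<in> {0..pi} \<Longrightarrow> f s \<ge> 0" and t: "t \<in> {0..pi}"
  shows "smoothing f t \<ge> 0"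
proof (rule tendsto_lowerbound)
  have "summable (\<lambda>j. \<bar>sine_coeff f j / od j * sin (od j * t)\<bar>)"
    by (rule summable_comparison_test'[OF sine_coeff_over_od(1)[OF f]])
      (simp only: real_norm_def abs_idempotent, intro abs_mult_le_left, simp)
  then show "(\<lambda>n. \<Sum>j. abel_radius n ^ (2 * j + 1) * (sine_coeff f j / od j * sin (od j * t))) \<longlonglongrightarrow> smoothing f t"
    unfolding smoothing_def by (rule abel_sum_tendsto)
  have "(\<Sum>j. r ^ (2 * j + 1) * (sine_coeff f j / od j * sin (od j * t))) \<ge> 0" if r: "0 < r" "r < 1" for r
  proof -
    have "(\<lambda>j. r ^ (2 * j + 1) / od j * integral {0..pi} (\<lambda>s. f s * (sin (od j * t) * sin (od j * s))))
      sums integral {0..pi} (\<lambda>s. f s * (\<Sum>j. r ^ (2 * j + 1) / od j * (sin (od j * t) * sin (od j * s))))"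
      by (rule integral_suminf_abs[where M = 1, OF summable_abel_weights[OF r]])
        (auto intro!: continuous_intros f mult_le_one simp: abs_mult)
    \<comment> \<open>If the integrand were not integrable, its integral would be 0 by convention,
      so the inequality holds in either case.\<close>
    moreover have "integral {0..pi} (\<lambda>s. f s * (\<Sum>j. r ^ (2 * j + 1) / od j * (sin (od j * t) * sin (od j * s)))) \<ge> 0"
      by (cases "(\<lambda>s. f s * (\<Sum>j. r ^ (2 * j + 1) / od j * (sin (od j * t) * sin (od j * s)))) integrable_on {0..pi}")
        (simp_all only: integral_nonneg mult_nonneg_nonneg nn od_sin_sin_series_nonneg[OF r _ t] not_integrable_integral order_refl simp_thms)
    moreover have "r ^ (2 * j + 1) / od j * integral {0..pi} (\<lambda>s. f s * (sin (od j * t) * sin (od j * s)))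
      = pi / 2 * (r ^ (2 * j + 1) * (sine_coeff f j / od j * sin (od j * t)))" for j
    proof -
      have "integral {0..pi} (\<lambda>s. f s * (sin (od j * t) * sin (od j * s)))
         = sin (od j * t) * integral {0..pi} (\<lambda>s. f s * sin (od j * s))"
        by (simp add: mult.left_commute flip: integral_mult_right)
      then show ?thesis by (simp add: sine_coeff_def)
    qed
    ultimately have "(\<lambda>j. pi / 2 * (r ^ (2 * j + 1) * (sine_coeff f j / od j * sin (od j * t)))) sums
       integral {0..pi} (\<lambda>s. f s * (\<Sum>j. r ^ (2 * j + 1) / od j * (sin (od j * t) * sin (od j * s))))"
      and ge: "integral {0..pi} (\<lambda>s. f s * (\<Sum>j. r ^ (2 * j + 1) / od j * (sin (od j * t) * sin (od j * s)))) \<ge> 0"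
      by simp_all
    from sums_mult[OF this(1), of "2 / pi"]
    have "(\<lambda>j. r ^ (2 * j + 1) * (sine_coeff f j / od j * sin (od j * t))) sums (2 / pi *
       integral {0..pi} (\<lambda>s. f s * (\<Sum>j. r ^ (2 * j + 1) / od j * (sin (od j * t) * sin (od j * s)))))"
      by (simp only: mult.assoc[symmetric]) simp
    then show ?thesis
      using ge by (simp only: sums_iff) simp
  qed
  then show "\<forall>\<^sub>F n in sequentially. 0 \<le> (\<Sum>j. abel_radius n ^ (2 * j + 1) * (sine_coeff f j / od j * sin (od j * t)))"
    using abel_radius by (intro always_eventually allI) blast
qed auto

lemma smoothing_mono:
  assumes "continuous_on {0..pi} f" "continuous_on {0..pi} h"
    and "\<And>s. s \<in> {0..pi} \<Longrightarrow> f s \<le> h s" and "t \<in> {0..pi}"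
  shows "smoothing f t \<le> smoothing h t"
  using smoothing_nonneg[of "\<lambda>s. h s - f s" t] smoothing_diff[of h f t] assms
  by (auto intro!: continuous_intros)

text \<open>\<open>sin\<close> is the lowest mode, an eigenfunction with eigenvalue 1; this is what
  makes it a subsolution of the cubic equation.\<close>

lemma smoothing_sin: "smoothing sin t = sin t"
proof -
  have "sine_coeff sin j = (if j = 0 then 1 else 0)" for j
  proof -
    have "integral {0..pi} (\<lambda>s. sin s * sin (od j * s)) = (if j = 0 then pi / 2 else 0)"
      using sine_orthogonal[of 0 j] by (auto simp: od_def integral_unique)
    then show ?thesis by (simp add: sine_coeff_def)
  qed
  then have "smoothing sin t = (\<Sum>j. if j = 0 then sin t else 0)"
    unfolding smoothing_def by (intro suminf_cong) (auto simp: od_def)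
  also have "\<dots> = sin t"
    using sums_single[of 0 "\<lambda>_. sin t"] by (simp add: sums_iff)
  finally show ?thesis .
qed

section \<open>The cubic fixed point equation\<close>

lemma abs_smoothing_le_sup:
  assumes f: "continuous_on {0..pi} f" and le: "\<And>s. s \<in> {0..pi} \<Longrightarrow> \<bar>f s\<bar> \<le> d"
  shows "\<bar>smoothing f t\<bar> \<le> sqrt (smoothing_const * pi) * d"
proof -
  have d: "d \<ge> 0" using le[of 0] by simp
  have "integral {0..pi} (\<lambda>s. (f s)\<^sup>2) \<le> integral {0..pi} (\<lambda>s. d\<^sup>2)"
    using d by (intro integral_le integrable_continuous_real continuous_intros f)
      (auto simp flip: abs_le_square_iff intro!: le)
  then have "integral {0..pi} (\<lambda>s. (f s)\<^sup>2) \<le> pi * d\<^sup>2" by simp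
  then have "sqrt (smoothing_const * integral {0..pi} (\<lambda>s. (f s)\<^sup>2)) \<le> sqrt (smoothing_const * (pi * d\<^sup>2))"
    using smoothing_const_pos by simp
  also have "\<dots> = sqrt (smoothing_const * pi) * d"
    using d by (simp add: real_sqrt_mult)
  finally show ?thesis using abs_smoothing_le[OF f, of t] by linarith
qed

text \<open>For ordered nonnegative functions this bounds the squared L2 distance by the difference
  of the squared L2 norms.\<close>

lemma diff_power2_le:
  fixes x y :: real
  assumes "0 \<le> y" "y \<le> x"
  shows "(x - y)\<^sup>2 \<le> x\<^sup>2 - y\<^sup>2"
proof -
  have "y * y \<le> x * y" using assms by (intro mult_right_mono) auto
  then show ?thesis by (simp add: power2_eq_square algebra_simps)
qed

text \<open>The cube root's Hoelder continuity with exponent 1 / 3, stated for cubes so that no root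
  has to be estimated.\<close>

lemma diff_power3_le:
  fixes x y :: real
  assumes "0 \<le> y" "y \<le> x"
  shows "(x - y) ^ 3 \<le> x ^ 3 - y ^ 3"
proof -
  have "x ^ 3 - y ^ 3 - (x - y) ^ 3 = 3 * (x * y) * (x - y)"
    by (simp add: power3_eq_cube algebra_simps)
  moreover have "3 * (x * y) * (x - y) \<ge> 0" using assms by (intro mult_nonneg_nonneg) auto
  ultimately show ?thesis by linarith
qed

primrec cubic_iter :: "nat \<Rightarrow> real \<Rightarrow> real" where
  "cubic_iter 0 = sin"
| "cubic_iter (Suc n) = (\<lambda>t. root 3 (smoothing (cubic_iter n) t))"

lemma continuous_on_cubic_iter: "continuous_on {0..pi} (cubic_iter n)"
  by (induction n) (auto intro!: continuous_intros continuous_on_smoothing)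

lemma cubic_iter_power3: "cubic_iter (Suc n) t ^ 3 = smoothing (cubic_iter n) t"
  by (simp add: odd_real_root_pow)

lemma cubic_iter_le_Suc:
  assumes "t \<in> {0..pi}"
  shows "cubic_iter n t \<le> cubic_iter (Suc n) t"
  using assms
proof (induction n arbitrary: t)
  case 0
  then have "0 \<le> sin t" "sin t \<le> 1" by (auto intro: sin_ge_zero)
  \<comment> \<open>On [0, pi] the sine lies in [0, 1], where cubing decreases; taking cube roots
    gives sin \<le> root 3 sin, the start of the monotone induction.\<close>
  then have "sin t ^ 3 \<le> sin t ^ 1" by (intro power_decreasing) auto
  then have "root 3 (sin t ^ 3) \<le> root 3 (sin t)" by simp
  then show ?case by (simp add: smoothing_sin odd_real_root_power_cancel)
next
  case (Suc n)
  then have "smoothing (cubic_iter n) t \<le> smoothing (cubic_iter (Suc n)) t"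
    by (intro smoothing_mono continuous_on_cubic_iter) auto
  then show ?case by (subst (1 2) cubic_iter.simps(2)) simp
qed

lemma cubic_iter_mono:
  assumes "t \<in> {0..pi}" "k \<le> n"
  shows "cubic_iter k t \<le> cubic_iter n t"
  using lift_Suc_mono_le[of "\<lambda>n. cubic_iter n t" k n] cubic_iter_le_Suc[OF assms(1)] assms(2) by blast

lemma cubic_iter_nonneg: "t \<in> {0..pi} \<Longrightarrow> cubic_iter n t \<ge> 0"
  using cubic_iter_mono[of t 0 n] sin_ge_zero[of t] by auto

lemma cubic_iter_bounded: "\<exists>M\<ge>0. \<forall>n. \<forall>t\<in>{0..pi}. cubic_iter n t \<le> M"
proof -
  \<comment> \<open>With K the sup-norm bound of the operator, K \<le> M and 1 \<le> M give K * M
    \<le> M ^ 3, so the cube root maps the bound M to itself. The exponent 1 / 3 < 1 is what makes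
    such an M exist whatever the size of K.\<close>
  define M where "M = 1 + sqrt (smoothing_const * pi)"
  have M: "M \<ge> 1" using smoothing_const_pos by (simp add: M_def)
  have "\<forall>t\<in>{0..pi}. cubic_iter n t \<le> M" for n
  proof (induction n)
    case 0
    show ?case
    proof
      fix t show "cubic_iter 0 t \<le> M" using M sin_le_one[of t] by (simp del: sin_le_one)
    qed
  next
    case (Suc n)
    show ?case
    proof
      fix t :: real assume "t \<in> {0..pi}"
      have "\<bar>smoothing (cubic_iter n) t\<bar> \<le> sqrt (smoothing_const * pi) * M"
        using Suc cubic_iter_nonneg by (intro abs_smoothing_le_sup continuous_on_cubic_iter) auto
      also have "\<dots> \<le> M * M" using M by (intro mult_right_mono) (auto simp: M_def)
      also have "\<dots> \<le> M ^ 3" using M by (simp add: power3_eq_cube)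
      finally have "root 3 (smoothing (cubic_iter n) t) \<le> root 3 (M ^ 3)" by simp
      then show "cubic_iter (Suc n) t \<le> M" by (simp add: odd_real_root_power_cancel)
    qed
  qed
  then show ?thesis using M by (intro exI[of _ M]) auto
qed

text \<open>Because the iterates are ordered, the uniform distance of two later iterates is
  controlled by the increment of a single real sequence, the squared L2 norms \<open>I\<close>:
  cubes of differences are bounded by differences of cubes, these by the L2 distance, and this by
  \<open>I n - I k\<close>.\<close>

lemma cubic_iter_Suc_diff_le:
  assumes t: "t \<in> {0..pi}" and kn: "k \<le> n"
  defines "I \<equiv> \<lambda>n. integral {0..pi} (\<lambda>s. (cubic_iter n s)\<^sup>2)"
  shows "(cubic_iter (Suc n) t - cubic_iter (Suc k) t) ^ 3 \<le> sqrt (smoothing_const * (I n - I k))"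
proof -
  note cont = continuous_on_cubic_iter
  have "(cubic_iter (Suc n) t - cubic_iter (Suc k) t) ^ 3 \<le> cubic_iter (Suc n) t ^ 3 - cubic_iter (Suc k) t ^ 3"
    using cubic_iter_mono[OF t, of "Suc k" "Suc n"] kn
    by (intro diff_power3_le cubic_iter_nonneg[OF t]) simp
  also have "\<dots> = smoothing (\<lambda>s. cubic_iter n s - cubic_iter k s) t"
    unfolding cubic_iter_power3 using smoothing_diff[OF cont cont] by simp
  also have "\<dots> \<le> sqrt (smoothing_const * integral {0..pi} (\<lambda>s. (cubic_iter n s - cubic_iter k s)\<^sup>2))"
    using abs_smoothing_le[OF continuous_on_diff[OF cont cont], of n k t] by linarith
  also have "integral {0..pi} (\<lambda>s. (cubic_iter n s - cubic_iter k s)\<^sup>2) \<le> I n - I k"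
  proof -
    have "integral {0..pi} (\<lambda>s. (cubic_iter n s - cubic_iter k s)\<^sup>2)
      \<le> integral {0..pi} (\<lambda>s. (cubic_iter n s)\<^sup>2 - (cubic_iter k s)\<^sup>2)"
      using kn by (intro integral_le integrable_continuous_real continuous_intros cont diff_power2_le
          cubic_iter_nonneg cubic_iter_mono)
    also have "\<dots> = I n - I k"
      unfolding I_def by (intro Henstock_Kurzweil_Integration.integral_diff integrable_continuous_real continuous_intros cont)
    finally show ?thesis .
  qed
  finally show ?thesis using smoothing_const_pos by simp
qed

text \<open>The squared norms \<open>I\<close> increase and are bounded, hence form a Cauchy
  sequence; the preceding estimate turns this into a uniform Cauchy property of the
  iterates.\<close>

lemma uniformly_convergent_cubic_iter: "uniformly_convergent_on {0..pi} (\<lambda>n. cubic_iter (Suc n))"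
proof -
  define I where "I = (\<lambda>n. integral {0..pi} (\<lambda>s. (cubic_iter n s)\<^sup>2))"
  obtain M where M: "M \<ge> 0" "\<And>n t. t \<in> {0..pi} \<Longrightarrow> cubic_iter n t \<le> M"
    using cubic_iter_bounded by blast
  have inc: "incseq I"
    unfolding I_def incseq_def
    by (auto intro!: integral_le integrable_continuous_real continuous_intros continuous_on_cubic_iter
        power_mono cubic_iter_mono cubic_iter_nonneg)
  have "I n \<le> pi * M\<^sup>2" for n
  proof -
    have "I n \<le> integral {0..pi} (\<lambda>s. M\<^sup>2)" unfolding I_def
      by (intro integral_le integrable_continuous_real continuous_intros continuous_on_cubic_iter
        power_mono M(2) cubic_iter_nonneg)
    then show ?thesis by simp
  qed
  then have "Cauchy I"
    using incseq_convergent[OF inc] by (metis LIMSEQ_imp_Cauchy)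
  show ?thesis
  proof (rule Cauchy_uniformly_convergent, rule uniformly_Cauchy_onI')
    fix e :: real assume e: "e > 0"
    \<comment> \<open>The sixth power undoes the square root and then the cube in the estimate for
      the difference of two iterates.\<close>
    then have "e ^ 6 / smoothing_const > 0" using smoothing_const_pos by simp
    then obtain N where N: "\<And>m n. m \<ge> N \<Longrightarrow> n \<ge> N \<Longrightarrow> dist (I m) (I n) < e ^ 6 / smoothing_const"
      using \<open>Cauchy I\<close> unfolding Cauchy_def by blast
    show "\<exists>N. \<forall>t\<in>{0..pi}. \<forall>m\<ge>N. \<forall>n>m. dist (cubic_iter (Suc m) t) (cubic_iter (Suc n) t) < e"
    proof (intro exI[of _ N] ballI allI impI)
      fix t and m n :: nat assume t: "t \<in> {0..pi}" and mn: "N \<le> m" "m < n"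
      define d where "d = cubic_iter (Suc n) t - cubic_iter (Suc m) t"
      have d: "d \<ge> 0" using cubic_iter_mono[OF t, of "Suc m" "Suc n"] mn by (simp add: d_def)
      have "d ^ 3 \<le> sqrt (smoothing_const * (I n - I m))"
        unfolding d_def I_def using cubic_iter_Suc_diff_le[OF t, of m n] mn by simp
      also have "\<dots> < sqrt ((e ^ 3)\<^sup>2)"
      proof -
        have "I n - I m < e ^ 6 / smoothing_const" using N[of n m] mn by (simp add: dist_real_def)
        then have "smoothing_const * (I n - I m) < e ^ 6"
          using smoothing_const_pos by (simp add: pos_less_divide_eq mult.commute)
        then show ?thesis by (simp flip: power_mult)
      qed
      also have "\<dots> = e ^ 3" using e by (subst real_sqrt_abs) simp
      finally have "d < e" using e by (intro power_less_imp_less_base[of d 3 e]) auto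
      then show "dist (cubic_iter (Suc m) t) (cubic_iter (Suc n) t) < e"
        using d by (simp add: dist_real_def d_def)
    qed
  qed
qed

lemma smoothing_tendsto:
  assumes u: "uniform_limit {0..pi} f v sequentially" and f: "\<And>n. continuous_on {0..pi} (f n)"
    and v: "continuous_on {0..pi} v"
  shows "(\<lambda>n. smoothing (f n) t) \<longlonglongrightarrow> smoothing v t"
proof (rule metric_LIMSEQ_I)
  fix e :: real assume e: "e > 0"
  define C where "C = sqrt (smoothing_const * pi)"
  have C: "C \<ge> 0" using smoothing_const_pos by (simp add: C_def)
  have "\<forall>\<^sub>F n in sequentially. \<forall>s\<in>{0..pi}. dist (f n s) (v s) < e / (C + 1)"
    using uniform_limitD[OF u, of "e / (C + 1)"] e C by simp
  then obtain N where N: "\<And>n s. n \<ge> N \<Longrightarrow> s \<in> {0..pi} \<Longrightarrow> \<bar>f n s - v s\<bar> < e / (C + 1)"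
    unfolding eventually_sequentially dist_real_def by metis
  show "\<exists>N. \<forall>n\<ge>N. dist (smoothing (f n) t) (smoothing v t) < e"
  proof (intro exI[of _ N] allI impI)
    fix n assume "n \<ge> N"
    then have "\<bar>smoothing (\<lambda>s. f n s - v s) t\<bar> \<le> C * (e / (C + 1))"
      unfolding C_def using N[of n]
      by (intro abs_smoothing_le_sup continuous_intros f v) (auto simp: C_def intro: less_imp_le)
    also have "\<dots> < e" using e C by (simp add: field_simps)
    finally show "dist (smoothing (f n) t) (smoothing v t) < e"
      by (simp add: smoothing_diff[OF f v] dist_real_def)
  qed
qed

proposition cubic_fixed_point:
  obtains V where "continuous_on UNIV V" "\<And>t. V t ^ 3 = smoothing V t" "\<And>t. t \<in> {0..pi} \<Longrightarrow> sin t \<le> V t"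
proof -
  obtain v where u: "uniform_limit {0..pi} (\<lambda>n. cubic_iter (Suc n)) v sequentially"
    using uniformly_convergent_cubic_iter unfolding uniformly_convergent_on_def by blast
  have v: "continuous_on {0..pi} v"
    by (rule uniform_limit_theorem[OF _ u]) (auto intro!: always_eventually continuous_on_cubic_iter simp del: cubic_iter.simps)
  have lim: "(\<lambda>n. cubic_iter (Suc n) t) \<longlonglongrightarrow> v t" if "t \<in> {0..pi}" for t
    using tendsto_uniform_limitI[OF u that] .
  have fix3: "v t ^ 3 = smoothing v t" if t: "t \<in> {0..pi}" for t
  proof (rule LIMSEQ_unique)
    show "(\<lambda>n. cubic_iter (Suc (Suc n)) t ^ 3) \<longlonglongrightarrow> v t ^ 3"
      by (intro tendsto_power LIMSEQ_Suc lim t)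
    show "(\<lambda>n. cubic_iter (Suc (Suc n)) t ^ 3) \<longlonglongrightarrow> smoothing v t"
      unfolding cubic_iter_power3 by (intro smoothing_tendsto u v continuous_on_cubic_iter)
  qed
  have ge: "sin t \<le> v t" if t: "t \<in> {0..pi}" for t
    by (rule LIMSEQ_le_const[OF lim[OF t]]) (use cubic_iter_mono[OF t, of 0] in \<open>auto simp del: cubic_iter.simps(2)\<close>)
  \<comment> \<open>The uniform limit \<open>v\<close> is determined on [0, pi] only. The right-hand
    side of the equation is defined and continuous on the whole line, and the sine coefficients see
    only [0, pi], so this extension leaves \<open>smoothing\<close> unchanged and solves the
    equation everywhere.\<close>
  define V where "V = (\<lambda>t. root 3 (smoothing v t))"
  have eq: "V t = v t" if "t \<in> {0..pi}" for t
    unfolding V_def fix3[OF that, symmetric] by (simp add: odd_real_root_power_cancel)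
  have "sine_coeff V j = sine_coeff v j" for j
    unfolding sine_coeff_def using eq by (intro arg_cong2[where f="(*)"] refl integral_cong) auto
  then have "smoothing V = smoothing v" by (simp add: smoothing_def fun_eq_iff)
  then have "V t ^ 3 = smoothing V t" for t by (simp add: V_def odd_real_root_pow)
  moreover have "continuous_on UNIV V"
    unfolding V_def by (intro continuous_intros continuous_on_smoothing v)
  ultimately show ?thesis using that ge eq by simp
qed

section \<open>The primitive of the profile\<close>

lemma sin_od_add_pi: "sin (od j * (t + pi)) = - sin (od j * t)"
  and cos_od_add_pi: "cos (od j * (t + pi)) = - cos (od j * t)"
proof -
  have e: "od j * (t + pi) = (od j * t + pi) + 2 * real j * pi"
    by (simp add: od_def algebra_simps)
  have "sin (od j * t + pi + 2 * real j * pi) = sin (od j * t + pi)"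
    using sin_2npi[of j] cos_2npi[of j] by (subst sin_add) (simp add: mult.assoc)
  then show "sin (od j * (t + pi)) = - sin (od j * t)" unfolding e by simp
  have "cos (od j * t + pi + 2 * real j * pi) = cos (od j * t + pi)"
    using sin_2npi[of j] cos_2npi[of j] by (subst cos_add) (simp add: mult.assoc)
  then show "cos (od j * (t + pi)) = - cos (od j * t)" unfolding e by simp
qed

lemma smoothing_minus:
  assumes "continuous_on {0..pi} f"
  shows "smoothing f (- t) = - smoothing f t"
  using summable_smoothing[OF assms, of "\<lambda>j. sin (od j * t)"]
  by (simp add: smoothing_def suminf_minus)

lemma smoothing_add_pi:
  "smoothing f (t + pi) = smoothing f (- t)"
  by (simp add: smoothing_def sin_od_add_pi)

lemma window_integral_has_derivative:
  fixes h :: "real \<Rightarrow> real"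
  assumes h: "continuous_on UNIV h" and L: "L \<ge> 0"
  shows "((\<lambda>s. integral {s..s + L} h) has_real_derivative h (s + L) - h s) (at s)"
proof -
  define u v where "u = s - 1" and "v = s + L + 1"
  define G where "G = (\<lambda>x. integral {u..x} h)"
  have int: "h integrable_on A" if "A = {x..y}" for A x y
    unfolding that by (intro integrable_continuous_real continuous_on_subset[OF h]) auto
  have G: "(G has_real_derivative h x) (at x)" if "u < x" "x < v" for x
  proof -
    have "(G has_real_derivative h x) (at x within {u..v})"
      unfolding G_def using that
      by (intro integral_has_real_derivative continuous_on_subset[OF h]) auto
    then show ?thesis using that by (simp add: at_within_Icc_at)
  qed
  have "((\<lambda>s. G (s + L) - G s) has_real_derivative h (s + L) * 1 - h s) (at s)"
    using L by (intro DERIV_diff DERIV_chain2[of G] G) (auto intro!: derivative_eq_intros simp: u_def v_def)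
  then have "((\<lambda>s. G (s + L) - G s) has_real_derivative h (s + L) - h s) (at s)" by simp
  moreover have "\<forall>\<^sub>F x in nhds s. G (x + L) - G x = integral {x..x + L} h"
  proof (rule eventually_nhds_in_open[of "{u<..}", THEN eventually_mono])
    show "s \<in> {u<..}" by (simp add: u_def)
    fix x assume "x \<in> {u<..}"
    then have "G x + integral {x..x + L} h = G (x + L)"
      unfolding G_def using L by (intro Henstock_Kurzweil_Integration.integral_combine int) auto
    then show "G (x + L) - G x = integral {x..x + L} h" by simp
  qed auto
  ultimately show ?thesis
    using DERIV_cong_ev[OF refl, of "\<lambda>s. G (s + L) - G s" "\<lambda>s. integral {s..s + L} h" s] by auto
qed

lemma window_integral_periodic:
  fixes h :: "real \<Rightarrow> real"
  assumes h: "continuous_on UNIV h" and L: "L \<ge> 0" and per: "\<And>t. h (t + L) = h t"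
  shows "integral {s..s + L} h = integral {s'..s' + L} h"
proof -
  have "((\<lambda>s. integral {s..s + L} h) has_real_derivative 0) (at s)" for s
    using window_integral_has_derivative[OF h L, of s] by (simp add: per)
  then show ?thesis
    by (metis DERIV_isconst_all)
qed

text \<open>Half of this expression is the Abel mean of the series of sin (\<open>od j\<close> * y)
  / \<open>od j\<close>, so the limit identifies that series with the square wave of height pi / 4
  on (0, pi).\<close>

lemma arctan_abel_tendsto:
  assumes "0 < y" "y < pi"
  shows "(\<lambda>n. arctan (2 * abel_radius n * sin y / (1 - (abel_radius n)\<^sup>2))) \<longlonglongrightarrow> pi / 2"
proof -
  have "(\<lambda>n. 1 - (abel_radius n)\<^sup>2) \<longlonglongrightarrow> 1 - 1\<^sup>2"
    by (intro tendsto_intros abel_radius_tendsto)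
  moreover have "1 - (abel_radius n)\<^sup>2 > 0" for n
    using abel_radius[of n] by (simp add: abs_square_less_1)
  ultimately have "filterlim (\<lambda>n. inverse (1 - (abel_radius n)\<^sup>2)) at_top sequentially"
    by (intro filterlim_inverse_at_top) auto
  moreover have "(\<lambda>n. 2 * abel_radius n * sin y) \<longlonglongrightarrow> 2 * 1 * sin y"
    by (intro tendsto_intros abel_radius_tendsto)
  ultimately have "filterlim (\<lambda>n. 2 * abel_radius n * sin y * inverse (1 - (abel_radius n)\<^sup>2)) at_top sequentially"
    using sin_gt_zero[OF assms] by (intro filterlim_tendsto_pos_mult_at_top[where c = "2 * 1 * sin y"]) auto
  then show ?thesis
    unfolding divide_inverse[of "2 * _ * _"] by (rule filterlim_compose[OF tendsto_arctan_at_top])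
qed

text \<open>The zero function also satisfies the cubic equation; the lower bound by
  \<open>sin\<close> is the assumption that excludes it.\<close>

locale cubic_profile =
  fixes V :: "real \<Rightarrow> real"
  assumes continuous_V: "continuous_on UNIV V"
    and V_power3: "V t ^ 3 = smoothing V t"
    and V_ge_sin: "t \<in> {0..pi} \<Longrightarrow> sin t \<le> V t"
begin

lemma V_eq_root: "V t = root 3 (smoothing V t)"
  by (metis V_power3 odd_numeral odd_real_root_power_cancel numeral_3_eq_3 odd_Suc_minus_one even_Suc odd_one)

lemma continuous_on_V: "continuous_on A V"
  using continuous_V by (rule continuous_on_subset) simp

lemma V_minus: "V (- t) = - V t"
  by (subst (1 2) V_eq_root) (simp add: smoothing_minus[OF continuous_on_V] real_root_minus)

lemma V_add_pi: "V (t + pi) = - V t"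
  by (subst (1 2) V_eq_root) (simp add: smoothing_add_pi smoothing_minus[OF continuous_on_V] real_root_minus)

text \<open>Both factors change sign under a shift by pi, so the product has period pi and may be
  integrated over [-pi/2, pi/2] instead, where it is odd.\<close>

lemma integral_V_cos: "integral {0..pi} (\<lambda>y. V y * cos (od j * y)) = 0"
proof -
  define h where "h = (\<lambda>y. V y * cos (od j * y))"
  have h: "continuous_on UNIV h" unfolding h_def by (intro continuous_intros continuous_on_V)
  have "integral {0..0 + pi} h = integral {- (pi / 2)..- (pi / 2) + pi} h"
    by (rule window_integral_periodic[OF h]) (auto simp: h_def V_add_pi cos_od_add_pi)
  then have e: "integral {0..pi} h = integral {- (pi / 2)..pi / 2} h" by simp
  have "integral {- (pi / 2)..pi / 2} h = integral {- (pi / 2)..- (- (pi / 2))} (\<lambda>x. h (- x))"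
    by (subst Henstock_Kurzweil_Integration.integral_reflect_real) simp
  also have "\<dots> = - integral {- (pi / 2)..pi / 2} h"
    by (simp add: h_def V_minus)
  finally show ?thesis using e unfolding h_def by simp
qed

text \<open>A translation moves the shift onto the sine, periodicity moves the window back to
  [0, pi], and in the addition formula the cosine part integrates to zero.\<close>

lemma integral_shifted_V_sin:
  "integral {0..pi} (\<lambda>y. V (s + y) * sin (od j * y)) = pi / 2 * sine_coeff V j * cos (od j * s)"
proof -
  define h where "h = (\<lambda>y. V y * sin (od j * (y - s)))"
  have h: "continuous_on UNIV h" unfolding h_def by (intro continuous_intros continuous_on_V)
  have per: "h (t + pi) = h t" for t
    using sin_od_add_pi[of j "t - s"] by (simp add: h_def V_add_pi add_diff_eq diff_add_eq)
  have "integral {0..pi} (\<lambda>y. V (s + y) * sin (od j * y)) = integral {0..pi} (h \<circ> (+) s)"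
    by (simp add: h_def o_def)
  also have "\<dots> = integral {s..s + pi} h"
    by (subst integral_shift_Icc_real) (simp add: add.commute)
  also have "\<dots> = integral {0..0 + pi} h"
    by (rule window_integral_periodic[OF h _ per]) simp
  also have "\<dots> = integral {0..pi} (\<lambda>y. cos (od j * s) * (V y * sin (od j * y)) - sin (od j * s) * (V y * cos (od j * y)))"
    by (simp add: h_def right_diff_distrib sin_diff mult_ac)
  also have "\<dots> = cos (od j * s) * integral {0..pi} (\<lambda>y. V y * sin (od j * y))
      - sin (od j * s) * integral {0..pi} (\<lambda>y. V y * cos (od j * y))"
    by (subst Henstock_Kurzweil_Integration.integral_diff)
      (auto intro!: integrable_continuous_real continuous_intros continuous_on_V)
  finally show ?thesis by (simp add: integral_V_cos sine_coeff_def)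
qed

lemma summable_V: "summable (\<lambda>j. \<bar>sine_coeff V j / od j\<bar>)"
  by (rule sine_coeff_over_od(1)[OF continuous_on_V])

text \<open>The square wave is the boundary value of the Abel means computed in
  \<open>od_sin_series\<close>; convolving with it gives the window integral of \<open>V\<close>.\<close>

lemma window_integral_V:
  "integral {s..s + pi} V = 2 * (\<Sum>j. sine_coeff V j / od j * cos (od j * s))"
proof -
  define f where "f = (\<lambda>y. V (s + y))"
  have f: "continuous_on A f" for A
    unfolding f_def by (rule continuous_on_compose2[OF continuous_V]) (auto intro!: continuous_intros)
  obtain B where B: "\<And>y. y \<in> {0..pi} \<Longrightarrow> \<bar>f y\<bar> \<le> B"
    using compact_imp_bounded[OF compact_continuous_image[OF f compact_Icc]]
    unfolding bounded_iff by fastforce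
  define A where "A = (\<lambda>n y. arctan (2 * abel_radius n * sin y / (1 - (abel_radius n)\<^sup>2)) / 2)"
  \<comment> \<open>Pointwise limit of the integrands: at both endpoints the sine vanishes and every
    \<open>A n\<close> is 0, while inside the limit is the square wave. The two exceptional points
    do not affect the integral.\<close>
  define g where "g = (\<lambda>y. f y * (if y = 0 \<or> y = pi then 0 else pi / 4))"
  have sums: "(\<Sum>j. abel_radius n ^ (2 * j + 1) / od j * sin (od j * y)) = A n y" for n y
    using od_sin_series[OF abel_radius, of n y] unfolding A_def sums_iff by blast
  have r2: "1 - (abel_radius n)\<^sup>2 > 0" for n
    using abel_radius[of n] by (simp add: abs_square_less_1)
  have contA: "continuous_on S (A n)" for n S
    unfolding A_def using r2[of n] by (intro continuous_intros) auto
  have "(\<lambda>n. integral {0..pi} (\<lambda>y. f y * A n y)) \<longlonglongrightarrow> integral {0..pi} g"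
  proof (rule dominated_convergence(2))
    show "(\<lambda>y. f y * A n y) integrable_on {0..pi}" for n
      by (intro integrable_continuous_real continuous_intros f contA)
    show "(\<lambda>_. B * (pi / 4)) integrable_on {0..pi}" by (simp add: integrable_const_ivl)
    show "norm (f y * A n y) \<le> B * (pi / 4)" if "y \<in> {0..pi}" for n y
    proof -
      have "\<bar>A n y\<bar> \<le> pi / 4" unfolding A_def
        using arctan_bounded[of "2 * abel_radius n * sin y / (1 - (abel_radius n)\<^sup>2)"] by auto
      then show ?thesis unfolding real_norm_def abs_mult
        using B[OF that] by (intro mult_mono) auto
    qed
    show "(\<lambda>n. f y * A n y) \<longlonglongrightarrow> g y" if "y \<in> {0..pi}" for y
    proof (cases "y = 0 \<or> y = pi")
      case True
      then show ?thesis by (auto simp: g_def A_def)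
    next
      case False
      then have "(\<lambda>n. A n y) \<longlonglongrightarrow> pi / 2 / 2"
        unfolding A_def using that by (intro tendsto_divide arctan_abel_tendsto tendsto_const) auto
      then have "(\<lambda>n. f y * A n y) \<longlonglongrightarrow> f y * (pi / 2 / 2)" by (intro tendsto_mult tendsto_const)
      then show ?thesis using False by (simp add: g_def)
    qed
  qed
  also have "integral {0..pi} g = integral {0..pi} (\<lambda>y. f y * (pi / 4))"
    by (rule integral_spike[of "{0, pi}"]) (auto simp: g_def)
  also have "\<dots> = pi / 4 * integral {0..pi} f"
    by simp
  also have "integral {0..pi} f = integral {s..s + pi} V"
    unfolding f_def using integral_shift_Icc_real[of 0 pi V s] by (simp add: o_def add.commute)
  finally have lim1: "(\<lambda>n. integral {0..pi} (\<lambda>y. f y * A n y)) \<longlonglongrightarrow> pi / 4 * integral {s..s + pi} V" .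
  \<comment> \<open>The same integrals, evaluated term by term, are Abel means of the cosine series;
    comparing the two limits gives the identity.\<close>
  have "integral {0..pi} (\<lambda>y. f y * A n y) = pi / 2 * (\<Sum>j. abel_radius n ^ (2 * j + 1) * (sine_coeff V j / od j * cos (od j * s)))" for n
  proof -
    define r where "r = abel_radius n"
    have "(\<lambda>j. r ^ (2 * j + 1) / od j * integral {0..pi} (\<lambda>y. f y * sin (od j * y))) sums
       integral {0..pi} (\<lambda>y. f y * (\<Sum>j. r ^ (2 * j + 1) / od j * sin (od j * y)))"
      unfolding r_def
      by (rule integral_suminf_abs[where M = 1, OF summable_abel_weights[OF abel_radius]])
        (auto intro!: continuous_intros f)
    moreover have "r ^ (2 * j + 1) / od j * integral {0..pi} (\<lambda>y. f y * sin (od j * y))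
       = pi / 2 * (r ^ (2 * j + 1) * (sine_coeff V j / od j * cos (od j * s)))" for j
      unfolding f_def integral_shifted_V_sin by (simp add: mult_ac)
    ultimately have "(\<lambda>j. pi / 2 * (r ^ (2 * j + 1) * (sine_coeff V j / od j * cos (od j * s)))) sums
       integral {0..pi} (\<lambda>y. f y * A n y)"
      unfolding sums[symmetric] r_def by (simp only:)
    then have "(\<lambda>j. 2 / pi * (pi / 2 * (r ^ (2 * j + 1) * (sine_coeff V j / od j * cos (od j * s))))) sums
       (2 / pi * integral {0..pi} (\<lambda>y. f y * A n y))"
      by (rule sums_mult)
    then have "(\<Sum>j. r ^ (2 * j + 1) * (sine_coeff V j / od j * cos (od j * s))) = 2 / pi * integral {0..pi} (\<lambda>y. f y * A n y)"
      by (simp only: mult.assoc[symmetric] sums_iff) simp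
    then show ?thesis unfolding r_def by simp
  qed
  moreover have "(\<lambda>n. pi / 2 * (\<Sum>j. abel_radius n ^ (2 * j + 1) * (sine_coeff V j / od j * cos (od j * s))))
     \<longlonglongrightarrow> pi / 2 * (\<Sum>j. sine_coeff V j / od j * cos (od j * s))"
  proof (intro tendsto_mult tendsto_const abel_sum_tendsto)
    show "summable (\<lambda>j. \<bar>sine_coeff V j / od j * cos (od j * s)\<bar>)"
      by (rule summable_comparison_test'[OF summable_V])
        (simp only: real_norm_def abs_idempotent, intro abs_mult_le_left, simp)
  qed
  ultimately have "pi / 4 * integral {s..s + pi} V = pi / 2 * (\<Sum>j. sine_coeff V j / od j * cos (od j * s))"
    using lim1 by (simp only:) (rule LIMSEQ_unique)
  then show ?thesis by simp
qed

text \<open>The formal term-by-term antiderivative of the sine series of \<open>V\<close>, without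
  constant mode.\<close>

definition primitive :: "real \<Rightarrow> real" where
  "primitive t = - (\<Sum>j. sine_coeff V j / od j * cos (od j * t))"

lemma primitive_eq: "primitive t = - integral {t..t + pi} V / 2"
  by (simp add: primitive_def window_integral_V)

text \<open>In the window form of \<open>primitive\<close> both endpoints move, contributing -(V (t
  + pi) - V t) / 2, and antiperiodicity makes this V t. Term-by-term differentiation would instead
  call for convergence of the sine series of \<open>V\<close> itself.\<close>

lemma primitive_has_derivative: "(primitive has_real_derivative V t) (at t)"
proof -
  have "((\<lambda>t. - integral {t..t + pi} V / 2) has_real_derivative - (V (t + pi) - V t) / 2) (at t)"
    by (intro DERIV_cdivide DERIV_minus window_integral_has_derivative continuous_V) simp
  then show ?thesis by (simp add: V_add_pi primitive_eq[abs_def])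
qed

text \<open>This number is, up to a positive amplitude, the value of each solution at the origin;
  being nonzero, it shows that the solutions are nontrivial and tells them apart.\<close>

lemma primitive_0_neg: "primitive 0 < 0"
proof -
  have "2 = integral {0..pi} (\<lambda>t. sin t)"
  proof -
    have "((\<lambda>t. sin t) has_integral (- cos pi - - cos 0)) {0..pi}"
      by (intro fundamental_theorem_of_calculus)
        (auto intro!: derivative_eq_intros simp flip: has_real_derivative_iff_has_vector_derivative)
    then show ?thesis by (simp add: integral_unique)
  qed
  also have "\<dots> \<le> integral {0..pi} V"
    by (intro integral_le integrable_continuous_real continuous_on_V continuous_intros V_ge_sin)
  finally show ?thesis by (simp add: primitive_eq)
qed

end

section \<open>Completeness of square integrable functions\<close>

text \<open>Young's inequality; the free weight \<delta> lets a small L2 norm of one factor absorb a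
  fixed norm of the other.\<close>

lemma abs_mult_le_weighted_squares:
  fixes u v \<delta> :: real
  assumes "\<delta> > 0"
  shows "\<bar>u * v\<bar> \<le> u\<^sup>2 / (2 * \<delta>) + \<delta> / 2 * v\<^sup>2"
proof -
  have "0 \<le> (\<bar>u\<bar> - \<delta> * \<bar>v\<bar>)\<^sup>2" by simp
  also have "\<dots> = u\<^sup>2 - 2 * \<delta> * \<bar>u * v\<bar> + \<delta>\<^sup>2 * v\<^sup>2"
    by (simp add: power2_diff power_mult_distrib abs_mult)
  finally have "2 * \<delta> * \<bar>u * v\<bar> \<le> u\<^sup>2 + \<delta>\<^sup>2 * v\<^sup>2" by simp
  then show ?thesis using assms by (simp add: field_simps power2_eq_square)
qed

lemma integrable_mult_L2:
  fixes u v :: "'a \<Rightarrow> real"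
  assumes [measurable]: "u \<in> borel_measurable M" "v \<in> borel_measurable M"
    and "integrable M (\<lambda>x. (u x)\<^sup>2)" "integrable M (\<lambda>x. (v x)\<^sup>2)"
  shows "integrable M (\<lambda>x. u x * v x)"
proof (rule Bochner_Integration.integrable_bound)
  show "integrable M (\<lambda>x. (u x)\<^sup>2 / (2 * 1) + 1 / 2 * (v x)\<^sup>2)"
    using assms by (intro Bochner_Integration.integrable_add integrable_divide integrable_mult_right) auto
  show "AE x in M. norm (u x * v x) \<le> norm ((u x)\<^sup>2 / (2 * 1) + 1 / 2 * (v x)\<^sup>2)"
    using abs_mult_le_weighted_squares[of 1] by (intro AE_I2) (smt (verit) real_norm_def)
qed auto

lemma integrable_diff_L2:
  fixes u v :: "'a \<Rightarrow> real"
  assumes "u \<in> borel_measurable M" "v \<in> borel_measurable M"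
    and "integrable M (\<lambda>x. (u x)\<^sup>2)" "integrable M (\<lambda>x. (v x)\<^sup>2)"
  shows "integrable M (\<lambda>x. (u x - v x)\<^sup>2)"
  unfolding power2_diff using integrable_mult_L2[OF assms] assms
  by (intro Bochner_Integration.integrable_add Bochner_Integration.integrable_diff) (auto simp: mult.assoc)

lemma integral_abs_mult_le:
  fixes u v :: "'a \<Rightarrow> real"
  assumes [measurable]: "u \<in> borel_measurable M" "v \<in> borel_measurable M"
    and u: "integrable M (\<lambda>x. (u x)\<^sup>2)" and v: "integrable M (\<lambda>x. (v x)\<^sup>2)" and \<delta>: "\<delta> > 0"
  shows "(LINT x|M. \<bar>u x * v x\<bar>) \<le> (LINT x|M. (u x)\<^sup>2) / (2 * \<delta>) + \<delta> / 2 * (LINT x|M. (v x)\<^sup>2)"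
proof -
  have "(LINT x|M. \<bar>u x * v x\<bar>) \<le> (LINT x|M. (u x)\<^sup>2 / (2 * \<delta>) + \<delta> / 2 * (v x)\<^sup>2)"
    using integrable_mult_L2[OF assms(1-4)] u v
    by (intro integral_mono abs_mult_le_weighted_squares \<delta>) auto
  also have "\<dots> = (LINT x|M. (u x)\<^sup>2) / (2 * \<delta>) + \<delta> / 2 * (LINT x|M. (v x)\<^sup>2)"
    using u v by simp
  finally show ?thesis .
qed

text \<open>The weight \<delta> makes the \<open>v\<close> part of Young's inequality at most e / 2,
  and the assumed bound makes the \<open>u\<close> part less than e / 2. The summand 1 in the
  denominator covers a vanishing \<open>v\<close>.\<close>

lemma integral_abs_mult_less:
  fixes u v :: "'a \<Rightarrow> real"
  assumes "u \<in> borel_measurable M" "v \<in> borel_measurable M"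
    and "integrable M (\<lambda>x. (u x)\<^sup>2)" "integrable M (\<lambda>x. (v x)\<^sup>2)" and e: "e > 0"
  defines "\<delta> \<equiv> e / (1 + (LINT x|M. (v x)\<^sup>2))"
  assumes less: "(LINT x|M. (u x)\<^sup>2) < \<delta> * e"
  shows "(LINT x|M. \<bar>u x * v x\<bar>) < e"
proof -
  define H where "H = (LINT x|M. (v x)\<^sup>2)"
  have H: "H \<ge> 0" by (simp add: H_def)
  have \<delta>: "\<delta> > 0" using e H by (simp add: \<delta>_def H_def[symmetric])
  have "(LINT x|M. (u x)\<^sup>2) / (2 * \<delta>) < \<delta> * e / (2 * \<delta>)"
    using less \<delta> by (intro divide_strict_right_mono) auto
  moreover have "\<delta> / 2 * H \<le> e / 2"
    using e H by (simp add: \<delta>_def H_def[symmetric] field_simps)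
  ultimately show ?thesis
    using integral_abs_mult_le[OF assms(1-4) \<delta>] \<delta> by (simp add: H_def)
qed

lemma L2_pairing_tendsto:
  fixes f :: "nat \<Rightarrow> 'a \<Rightarrow> real"
  assumes f: "\<And>n. f n \<in> borel_measurable M" "\<And>n. integrable M (\<lambda>x. (f n x)\<^sup>2)"
    and F: "F \<in> borel_measurable M" "integrable M (\<lambda>x. (F x)\<^sup>2)"
    and v: "v \<in> borel_measurable M" "integrable M (\<lambda>x. (v x)\<^sup>2)"
    and lim: "(\<lambda>n. LINT x|M. (f n x - F x)\<^sup>2) \<longlonglongrightarrow> 0"
  shows "(\<lambda>n. LINT x|M. f n x * v x) \<longlonglongrightarrow> (LINT x|M. F x * v x)"
proof (rule metric_LIMSEQ_I)
  fix e :: real assume e: "e > 0"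
  define \<delta> where "\<delta> = e / (1 + (LINT x|M. (v x)\<^sup>2))"
  have "\<delta> > 0" using e unfolding \<delta>_def by (intro divide_pos_pos add_pos_nonneg) auto
  then have "\<delta> * e > 0" using e by simp
  then obtain N where N: "\<And>n. n \<ge> N \<Longrightarrow> (LINT x|M. (f n x - F x)\<^sup>2) < \<delta> * e"
    using metric_LIMSEQ_D[OF lim] by fastforce
  show "\<exists>N. \<forall>n\<ge>N. dist (LINT x|M. f n x * v x) (LINT x|M. F x * v x) < e"
  proof (intro exI[of _ N] allI impI)
    fix n assume n: "n \<ge> N"
    have d: "integrable M (\<lambda>x. (f n x - F x)\<^sup>2)" "(\<lambda>x. f n x - F x) \<in> borel_measurable M"
      using integrable_diff_L2[OF f(1) F(1) f(2) F(2)] f(1) F(1) by auto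
    have "(LINT x|M. f n x * v x) - (LINT x|M. F x * v x) = (LINT x|M. (f n x - F x) * v x)"
      using integrable_mult_L2[OF f(1) v(1) f(2) v(2)] integrable_mult_L2[OF F(1) v(1) F(2) v(2)]
      by (simp add: left_diff_distrib)
    also have "\<bar>\<dots>\<bar> \<le> (LINT x|M. \<bar>(f n x - F x) * v x\<bar>)"
      by (rule integral_abs_bound)
    also have "\<dots> < e"
      using N[OF n] unfolding \<delta>_def by (intro integral_abs_mult_less d v e)
    finally show "dist (LINT x|M. f n x * v x) (LINT x|M. F x * v x) < e"
      by (simp add: dist_real_def)
  qed
qed

text \<open>The positive weight \<open>h\<close> turns \<open>L\<^sup>2\<close>-Cauchy into \<open>L\<^sup>1\<close>-Cauchy on a space of infinite measure.\<close>

lemma L2_complete: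
  fixes f :: "nat \<Rightarrow> 'a \<Rightarrow> real" and h :: "'a \<Rightarrow> real"
  assumes f [measurable]: "\<And>n. f n \<in> borel_measurable M" and f2: "\<And>n. integrable M (\<lambda>x. (f n x)\<^sup>2)"
    and h [measurable]: "h \<in> borel_measurable M" and h2: "integrable M (\<lambda>x. (h x)\<^sup>2)" and h_pos: "\<And>x. h x > 0"
    and Cauchy: "\<And>e. e > 0 \<Longrightarrow> \<exists>N. \<forall>m\<ge>N. \<forall>n\<ge>N. (LINT x|M. (f m x - f n x)\<^sup>2) < e"
  obtains F where "F \<in> borel_measurable M" "integrable M (\<lambda>x. (F x)\<^sup>2)"
    "(\<lambda>n. LINT x|M. (f n x - F x)\<^sup>2) \<longlonglongrightarrow> 0"
proof -
  have d2: "integrable M (\<lambda>x. (f m x - f n x)\<^sup>2)" for m n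
    by (intro integrable_diff_L2 f f2)
  obtain r where r: "strict_mono r" "AE x in M. Cauchy (\<lambda>i. f (r i) x * h x)"
  proof (rule cauchy_L1_AE_cauchy_subseq[of M "\<lambda>n x. f n x * h x"])
    show "integrable M (\<lambda>x. f n x * h x)" for n by (intro integrable_mult_L2 f f2 h h2)
    fix e :: real assume e: "e > 0"
    define \<delta> where "\<delta> = e / (1 + (LINT x|M. (h x)\<^sup>2))"
    have "\<delta> > 0" using e unfolding \<delta>_def by (intro divide_pos_pos add_pos_nonneg) auto
    then obtain N where N: "\<And>m n. m \<ge> N \<Longrightarrow> n \<ge> N \<Longrightarrow> (LINT x|M. (f m x - f n x)\<^sup>2) < \<delta> * e"
      using Cauchy[of "\<delta> * e"] e by auto
    have "(LINT x|M. norm (f m x * h x - f n x * h x)) < e" if "m \<ge> N" "n \<ge> N" for m n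
      using integral_abs_mult_less[OF _ h d2 h2 e, of m n] N[OF that] unfolding \<delta>_def
      by (simp add: left_diff_distrib)
    then show "\<exists>N. \<forall>i\<ge>N. \<forall>j\<ge>N. (LINT x|M. norm (f i x * h x - f j x * h x)) < e" by blast
  qed auto
  define F where "F = (\<lambda>x. lim (\<lambda>i. f (r i) x))"
  have F [measurable]: "F \<in> borel_measurable M"
    unfolding F_def by (rule borel_measurable_lim_metric) auto
  have AE: "AE x in M. (\<lambda>i. f (r i) x) \<longlonglongrightarrow> F x"
  proof (rule AE_mp[OF r(2)], intro AE_I2 impI)
    fix x assume "Cauchy (\<lambda>i. f (r i) x * h x)"
    then obtain l where "(\<lambda>i. f (r i) x * h x) \<longlonglongrightarrow> l"
      using Cauchy_convergent convergent_def by blast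
    then have "(\<lambda>i. f (r i) x * h x / h x) \<longlonglongrightarrow> l / h x"
      using h_pos[of x] by (intro tendsto_divide tendsto_const) auto
    then have "convergent (\<lambda>i. f (r i) x)"
      using h_pos[of x] by (auto simp: convergent_def less_imp_neq[symmetric])
    then show "(\<lambda>i. f (r i) x) \<longlonglongrightarrow> F x" unfolding F_def by (rule convergent_LIMSEQ_iff[THEN iffD1])
  qed
  \<comment> \<open>Fatou's lemma along the almost everywhere convergent subsequence transfers the
    Cauchy bound to the limit. The nonnegative integral is used since integrability of the
    difference is itself a consequence of this bound.\<close>
  have fatou: "(\<integral>\<^sup>+x. ennreal ((f n x - F x)\<^sup>2) \<partial>M) \<le> ennreal e"
    if N: "\<And>m. m \<ge> N \<Longrightarrow> (LINT x|M. (f n x - f m x)\<^sup>2) < e" for n N e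
  proof -
    have "(\<integral>\<^sup>+x. ennreal ((f n x - F x)\<^sup>2) \<partial>M) = (\<integral>\<^sup>+x. liminf (\<lambda>i. ennreal ((f n x - f (r i) x)\<^sup>2)) \<partial>M)"
    proof (rule nn_integral_cong_AE, rule AE_mp[OF AE], intro AE_I2 impI)
      fix x assume "(\<lambda>i. f (r i) x) \<longlonglongrightarrow> F x"
      then have "(\<lambda>i. ennreal ((f n x - f (r i) x)\<^sup>2)) \<longlonglongrightarrow> ennreal ((f n x - F x)\<^sup>2)"
        by (intro tendsto_ennrealI tendsto_intros)
      then show "ennreal ((f n x - F x)\<^sup>2) = liminf (\<lambda>i. ennreal ((f n x - f (r i) x)\<^sup>2))"
        by (intro lim_imp_Liminf[symmetric]) auto
    qed
    also have "\<dots> \<le> liminf (\<lambda>i. \<integral>\<^sup>+x. ennreal ((f n x - f (r i) x)\<^sup>2) \<partial>M)"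
      by (rule nn_integral_liminf) auto
    also have "\<dots> \<le> ennreal e"
    proof (rule Liminf_le)
      show "\<forall>\<^sub>F i in sequentially. (\<integral>\<^sup>+x. ennreal ((f n x - f (r i) x)\<^sup>2) \<partial>M) \<le> ennreal e"
        using eventually_ge_at_top[of N]
      proof eventually_elim
        case (elim i)
        then have "r i \<ge> N" using seq_suble[OF r(1), of i] by linarith
        then show ?case
          using N[of "r i"] by (subst nn_integral_eq_integral[OF d2]) (auto intro!: ennreal_leI)
      qed
    qed auto
    finally show ?thesis .
  qed
  have main: "integrable M (\<lambda>x. (f n x - F x)\<^sup>2) \<and> (LINT x|M. (f n x - F x)\<^sup>2) \<le> e"
    if e: "e > 0" and "\<And>m. m \<ge> N \<Longrightarrow> (LINT x|M. (f n x - f m x)\<^sup>2) < e" for n N e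
  proof -
    have le: "(\<integral>\<^sup>+x. ennreal ((f n x - F x)\<^sup>2) \<partial>M) \<le> ennreal e" by (rule fatou[OF that(2)])
    have i: "integrable M (\<lambda>x. (f n x - F x)\<^sup>2)"
      using le by (intro integrableI_nonneg) (auto intro: le_less_trans)
    have "ennreal (LINT x|M. (f n x - F x)\<^sup>2) \<le> ennreal e"
      using le by (subst (asm) nn_integral_eq_integral[OF i]) auto
    then show ?thesis using i e by simp
  qed
  have lim: "(\<lambda>n. LINT x|M. (f n x - F x)\<^sup>2) \<longlonglongrightarrow> 0"
  proof (rule LIMSEQ_I)
    fix e :: real assume "e > 0"
    then have e: "e / 2 > 0" by simp
    obtain N where N: "\<And>m n. m \<ge> N \<Longrightarrow> n \<ge> N \<Longrightarrow> (LINT x|M. (f m x - f n x)\<^sup>2) < e / 2"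
      using Cauchy[OF e] by blast
    have "(LINT x|M. (f n x - F x)\<^sup>2) \<le> e / 2" if "n \<ge> N" for n
      using main[OF e, of N n] N that by blast
    then show "\<exists>N. \<forall>n\<ge>N. norm ((LINT x|M. (f n x - F x)\<^sup>2) - 0) < e"
      using \<open>e > 0\<close> by (intro exI[of _ N]) fastforce
  qed
  obtain N where N: "\<And>m n. m \<ge> N \<Longrightarrow> n \<ge> N \<Longrightarrow> (LINT x|M. (f m x - f n x)\<^sup>2) < 1"
    using Cauchy[of 1] by auto
  have "integrable M (\<lambda>x. (f N x - F x)\<^sup>2)" using main[of 1 N N] N by auto
  \<comment> \<open>Here F is recovered as f N - (f N - F), a difference of two square integrable
    functions.\<close>
  from integrable_diff_L2[OF f[of N] _ f2[of N] this] have "integrable M (\<lambda>x. (F x)\<^sup>2)" by simp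
  then show ?thesis using that F lim by blast
qed

section \<open>Weak identities for a single mode\<close>

text \<open>Integrals over the fundamental domain become integrals over a whole measure space, to
  which the L2 lemmas of arbitrary measures apply directly.\<close>

definition dom_measure :: "real \<Rightarrow> (real \<times> real) measure" where
  "dom_measure T = restrict_space lborel (Dom T)"

lemma Dom_sets [measurable]: "Dom T \<in> sets borel"
  unfolding Dom_def by (intro borel_closed closed_Times) auto

lemma measurable_dom_measure: "f \<in> borel_measurable borel \<Longrightarrow> f \<in> borel_measurable (dom_measure T)"
  unfolding dom_measure_def by (rule measurable_restrict_space1) simp

lemma L2_D_iff:
  "L2_D T f \<longleftrightarrow> f \<in> borel_measurable (dom_measure T) \<and> integrable (dom_measure T) (\<lambda>z. (f z)\<^sup>2)"
  unfolding L2_D_def dom_measure_def set_borel_measurable_def set_integrable_def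
  by (simp add: borel_measurable_restrict_space_iff integrable_restrict_space)

lemma set_integral_Dom:
  fixes f :: "real \<times> real \<Rightarrow> real"
  shows "set_lebesgue_integral lborel (Dom T) f = (LINT z|dom_measure T. f z)"
  unfolding dom_measure_def set_lebesgue_integral_def by (simp add: integral_restrict_space)

lemma set_integral_half_Dom:
  fixes f :: "real \<times> real \<Rightarrow> real"
  shows "set_lebesgue_integral lborel ({0<..} \<times> {0..T}) f
    = (LINT z|dom_measure T. f z * indicator ({0<..} \<times> UNIV) z)"
  unfolding set_integral_Dom[symmetric] set_lebesgue_integral_def
  by (rule Bochner_Integration.integral_cong) (auto simp: Dom_def indicator_def)

lemma integrable_dom_iff:
  "integrable (dom_measure T) f \<longleftrightarrow> integrable (lborel \<Otimes>\<^sub>M lborel) (\<lambda>z. indicator (Dom T) z *\<^sub>R f z)"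
  for f :: "real \<times> real \<Rightarrow> real"
  unfolding dom_measure_def lborel_prod by (simp add: integrable_restrict_space)

lemma integral_dom_x_inner:
  fixes f :: "real \<times> real \<Rightarrow> real"
  assumes "integrable (dom_measure T) f"
  shows "(LINT z|dom_measure T. f z) = (LINT t:{0..T}|lborel. (LINT x|lborel. f (x, t)))"
proof -
  have i: "integrable (lborel \<Otimes>\<^sub>M lborel) (\<lambda>(x, t). indicator (Dom T) (x, t) *\<^sub>R f (x, t))"
    using assms unfolding integrable_dom_iff by (simp add: case_prod_beta')
  have "(LINT z|dom_measure T. f z) = integral\<^sup>L (lborel \<Otimes>\<^sub>M lborel) (\<lambda>z. indicator (Dom T) z *\<^sub>R f z)"
    unfolding dom_measure_def lborel_prod by (simp add: integral_restrict_space)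
  also have "\<dots> = (LINT t|lborel. LINT x|lborel. indicator (Dom T) (x, t) *\<^sub>R f (x, t))"
    using lborel_pair.integral_snd[OF i] by (simp add: case_prod_beta')
  also have "\<dots> = (LINT t|lborel. indicator {0..T} t *\<^sub>R (LINT x|lborel. f (x, t)))"
    by (intro Bochner_Integration.integral_cong refl) (auto simp: Dom_def indicator_def)
  finally show ?thesis by (simp add: set_lebesgue_integral_def)
qed

lemma integral_dom_t_inner:
  fixes f :: "real \<times> real \<Rightarrow> real"
  assumes "integrable (dom_measure T) f"
  shows "(LINT z|dom_measure T. f z) = (LINT x|lborel. (LINT t:{0..T}|lborel. f (x, t)))"
proof -
  have i: "integrable (lborel \<Otimes>\<^sub>M lborel) (\<lambda>(x, t). indicator (Dom T) (x, t) *\<^sub>R f (x, t))"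
    using assms unfolding integrable_dom_iff by (simp add: case_prod_beta')
  have "(LINT z|dom_measure T. f z) = integral\<^sup>L (lborel \<Otimes>\<^sub>M lborel) (\<lambda>z. indicator (Dom T) z *\<^sub>R f z)"
    unfolding dom_measure_def lborel_prod by (simp add: integral_restrict_space)
  also have "\<dots> = (LINT x|lborel. LINT t|lborel. indicator (Dom T) (x, t) *\<^sub>R f (x, t))"
    using lborel_pair.integral_fst[OF i] by (simp add: case_prod_beta')
  also have "\<dots> = (LINT x|lborel. (LINT t:{0..T}|lborel. f (x, t)))"
    by (intro Bochner_Integration.integral_cong refl) (auto simp: Dom_def indicator_def set_lebesgue_integral_def)
  finally show ?thesis .
qed

lemma integrable_compact_support:
  fixes f :: "'a::euclidean_space \<Rightarrow> real"
  assumes [measurable]: "f \<in> borel_measurable borel" and K: "compact K"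
    and "\<And>z. z \<in> K \<Longrightarrow> \<bar>f z\<bar> \<le> B" "\<And>z. z \<notin> K \<Longrightarrow> f z = 0"
  shows "integrable lborel f"
proof (rule Bochner_Integration.integrable_bound)
  have "integrable lborel (indicat_real K)"
    using K by (intro integrable_real_indicator) (auto simp: borel_compact emeasure_compact_finite[unfolded infinity_ennreal_def])
  then show "integrable lborel (\<lambda>z. B * indicat_real K z)" by simp
  show "AE z in lborel. norm (f z) \<le> norm (B * indicat_real K z)"
    using assms by (intro AE_I2) (force simp: indicator_def)
qed simp

lemma measurable_half_indicator: "indicat_real ({0::real<..} \<times> (UNIV::real set)) \<in> borel_measurable borel"
  by (intro borel_measurable_indicator borel_open open_Times) auto

lemma integrable_dom_half:
  assumes "integrable (dom_measure T) f"
  shows "integrable (dom_measure T) (\<lambda>z. f z * indicat_real ({0<..} \<times> UNIV) z)"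
proof (rule Bochner_Integration.integrable_bound[OF assms])
  show "(\<lambda>z. f z * indicat_real ({0<..} \<times> UNIV) z) \<in> borel_measurable (dom_measure T)"
    using assms measurable_dom_measure[OF measurable_half_indicator] by (intro borel_measurable_times) auto
qed (auto simp: indicator_def)

lemma integrable_dom_times_continuous:
  assumes [measurable]: "u \<in> borel_measurable borel" and u: "\<And>z. \<bar>u z\<bar> \<le> B"
    and \<phi>: "continuous_on UNIV \<phi>" "\<And>x t. \<bar>x\<bar> \<ge> R \<Longrightarrow> \<phi> (x, t) = (0::real)"
  shows "integrable (dom_measure T) (\<lambda>z. u z * \<phi> z)"
proof -
  have [measurable]: "\<phi> \<in> borel_measurable borel" by (rule borel_measurable_continuous_onI[OF \<phi>(1)])
  define K where "K = {-R..R} \<times> {0..T}"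
  have K: "compact K" unfolding K_def by (intro compact_Times) auto
  obtain C where C: "\<And>z. z \<in> K \<Longrightarrow> \<bar>\<phi> z\<bar> \<le> C"
    using compact_imp_bounded[OF compact_continuous_image[OF continuous_on_subset[OF \<phi>(1)] K]]
    unfolding bounded_iff by fastforce
  have "B \<ge> 0" using u[of "(0,0)"] by linarith
  have "integrable lborel (\<lambda>z. indicator (Dom T) z *\<^sub>R (u z * \<phi> z))"
  proof (rule integrable_compact_support[OF _ K])
    show "\<bar>indicator (Dom T) z *\<^sub>R (u z * \<phi> z)\<bar> \<le> B * C" if "z \<in> K" for z
      using u[of z] C[OF that] \<open>B \<ge> 0\<close> by (auto simp: indicator_def abs_mult intro!: mult_mono)
    show "indicator (Dom T) z *\<^sub>R (u z * \<phi> z) = 0" if "z \<notin> K" for z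
    proof (cases "z \<in> Dom T")
      case True
      then have "\<bar>fst z\<bar> \<ge> R" using that by (cases z) (auto simp: K_def Dom_def)
      then show ?thesis using \<phi>(2)[of "fst z" "snd z"] by simp
    qed simp
  qed measurable
  then show ?thesis unfolding dom_measure_def by (simp add: integrable_restrict_space)
qed

lemma integrable_lborel_times_continuous:
  fixes u :: "real \<Rightarrow> real"
  assumes [measurable]: "u \<in> borel_measurable borel" and u: "\<And>x. \<bar>u x\<bar> \<le> B"
    and \<phi>: "continuous_on UNIV \<phi>" "\<And>x. \<bar>x\<bar> \<ge> R \<Longrightarrow> \<phi> x = (0::real)"
  shows "integrable lborel (\<lambda>x. u x * \<phi> x)"
proof -
  have [measurable]: "\<phi> \<in> borel_measurable borel" by (rule borel_measurable_continuous_onI[OF \<phi>(1)])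
  obtain C where C: "\<And>z. z \<in> {-R..R} \<Longrightarrow> \<bar>\<phi> z\<bar> \<le> C"
    using compact_imp_bounded[OF compact_continuous_image[OF continuous_on_subset[OF \<phi>(1)] compact_Icc]]
    unfolding bounded_iff by (metis imageI real_norm_def subset_UNIV)
  have "B \<ge> 0" using u[of 0] by linarith
  show ?thesis
  proof (rule integrable_compact_support[of _ "{-R..R}"])
    show "\<bar>u z * \<phi> z\<bar> \<le> B * C" if "z \<in> {-R..R}" for z
      using u[of z] C[OF that] \<open>B \<ge> 0\<close> by (auto simp: abs_mult intro!: mult_mono)
    show "u z * \<phi> z = 0" if "z \<notin> {-R..R}" for z
      using that by (subst \<phi>(2)) auto
  qed auto
qed

lemma test_fun_regular:
  assumes "test_fun T \<psi>"
  shows "continuous_on UNIV \<psi>" "continuous_on UNIV (px \<psi>)" "continuous_on UNIV (pt \<psi>)"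
    "((\<lambda>s. \<psi> (s, t)) has_real_derivative px \<psi> (x, t)) (at x)"
    "((\<lambda>s. \<psi> (x, s)) has_real_derivative pt \<psi> (x, t)) (at t)"
    "\<psi> (x, t + T) = \<psi> (x, t)"
proof -
  have s: "continuous_on UNIV (pd bs \<psi>) \<and>
     (\<forall>x t. ((\<lambda>s. pd bs \<psi> (s, t)) has_real_derivative px (pd bs \<psi>) (x, t)) (at x) \<and>
            ((\<lambda>s. pd bs \<psi> (x, s)) has_real_derivative pt (pd bs \<psi>) (x, t)) (at t))" for bs
    using assms unfolding test_fun_def smooth2_def by blast
  show "continuous_on UNIV \<psi>" "continuous_on UNIV (px \<psi>)" "continuous_on UNIV (pt \<psi>)"
    "((\<lambda>s. \<psi> (s, t)) has_real_derivative px \<psi> (x, t)) (at x)"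
    "((\<lambda>s. \<psi> (x, s)) has_real_derivative pt \<psi> (x, t)) (at t)"
    using s[of "[]"] s[of "[True]"] s[of "[False]"] by auto
  show "\<psi> (x, t + T) = \<psi> (x, t)"
    using assms unfolding test_fun_def periodic_t_def by blast
qed

lemma test_fun_support:
  assumes "test_fun T \<psi>"
  obtains R where "R > 0" "\<And>x t. \<bar>x\<bar> \<ge> R \<Longrightarrow> \<psi> (x, t) = 0"
    "\<And>x t. \<bar>x\<bar> \<ge> R \<Longrightarrow> px \<psi> (x, t) = 0" "\<And>x t. \<bar>x\<bar> \<ge> R \<Longrightarrow> pt \<psi> (x, t) = 0"
proof -
  obtain R0 where R0: "\<And>x t. \<bar>x\<bar> > R0 \<Longrightarrow> \<psi> (x, t) = 0"
    using assms unfolding test_fun_def by blast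
  define R where "R = \<bar>R0\<bar> + 1"
  have z: "\<psi> (x, t) = 0" if "\<bar>x\<bar> \<ge> R" for x t
    using R0[of x t] that by (auto simp: R_def)
  have "px \<psi> (x, t) = 0" if "\<bar>x\<bar> \<ge> R" for x t
  proof -
    have "open {x::real. \<bar>x\<bar> > R0}" by (intro open_Collect_less continuous_intros)
    then have "\<forall>\<^sub>F s in nhds x. s \<in> {x. \<bar>x\<bar> > R0}"
      using that by (intro eventually_nhds_in_open) (auto simp: R_def)
    then have ev: "\<forall>\<^sub>F s in nhds x. \<psi> (s, t) = 0"
      by eventually_elim (use R0 in auto)
    have "((\<lambda>s. \<psi> (s, t)) has_real_derivative 0) (at x)"
      using DERIV_cong_ev[OF refl ev refl, of 0] by simp
    then show ?thesis using DERIV_unique test_fun_regular(4)[OF assms] by blast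
  qed
  moreover have "pt \<psi> (x, t) = 0" if "\<bar>x\<bar> \<ge> R" for x t
  proof -
    have "((\<lambda>s. \<psi> (x, s)) has_real_derivative 0) (at t)"
      using z[OF that] by simp
    then show ?thesis using DERIV_unique test_fun_regular(5)[OF assms] by blast
  qed
  ultimately show ?thesis using that[of R] z by (auto simp: R_def)
qed

lemma continuous_on_slice:
  assumes "continuous_on UNIV \<phi>"
  shows "continuous_on A (\<lambda>x. \<phi> (x, t))" "continuous_on A (\<lambda>t. \<phi> (x, t))"
  by (auto intro!: continuous_on_compose2[OF assms] continuous_intros)

lemma set_integrable_continuous_Icc:
  fixes f :: "real \<Rightarrow> real"
  assumes "continuous_on {u..v} f"
  shows "set_integrable lborel {u..v} f"
  unfolding set_integrable_def by (rule borel_integrable_compact[OF compact_Icc assms])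

section \<open>Integration by parts against test functions\<close>

text \<open>The boundary terms at 0 and T cancel because both the test function and \<open>e\<close>
  take equal values there.\<close>

lemma time_integration_by_parts:
  fixes e e1 :: "real \<Rightarrow> real"
  assumes \<psi>: "test_fun T \<psi>" and T: "T \<ge> 0"
    and e: "\<And>t. (e has_real_derivative e1 t) (at t)" "continuous_on UNIV e1" "e T = e 0"
  shows "(LINT t:{0..T}|lborel. e t * pt \<psi> (x, t)) = - (LINT t:{0..T}|lborel. e1 t * \<psi> (x, t))"
proof -
  note reg = test_fun_regular[OF \<psi>]
  have ce: "continuous_on A e" for A
    using e(1) DERIV_isCont continuous_at_imp_continuous_on by blast
  have ce1: "continuous_on A e1" for A
    using continuous_on_subset[OF e(2)] by simp
  have "((\<lambda>t. e t * pt \<psi> (x, t) + e1 t * \<psi> (x, t)) has_integral (e T * \<psi> (x, T) - e 0 * \<psi> (x, 0))) {0..T}"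
  proof (rule fundamental_theorem_of_calculus[OF T])
    fix t
    have "((\<lambda>t. e t * \<psi> (x, t)) has_real_derivative (e t * pt \<psi> (x, t) + e1 t * \<psi> (x, t))) (at t within {0..T})"
      using has_field_derivative_at_within[OF DERIV_mult[OF e(1) reg(5)]] by (simp add: algebra_simps)
    then show "((\<lambda>t. e t * \<psi> (x, t)) has_vector_derivative (e t * pt \<psi> (x, t) + e1 t * \<psi> (x, t))) (at t within {0..T})"
      by (simp add: has_real_derivative_iff_has_vector_derivative)
  qed
  then have "integral {0..T} (\<lambda>t. e t * pt \<psi> (x, t) + e1 t * \<psi> (x, t)) = 0"
    using reg(6)[of x 0] e(3) by (simp add: integral_unique)
  moreover have i: "set_integrable lborel {0..T} (\<lambda>t. e t * pt \<psi> (x, t))" "set_integrable lborel {0..T} (\<lambda>t. e1 t * \<psi> (x, t))"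
    by (intro set_integrable_continuous_Icc continuous_intros ce ce1 continuous_on_slice reg)+
  ultimately have "(LINT t:{0..T}|lborel. e t * pt \<psi> (x, t) + e1 t * \<psi> (x, t)) = 0"
    using set_borel_integral_eq_integral(2)[OF set_integral_add(1)[OF i]] by simp
  then show ?thesis using set_integral_add(2)[OF i] by simp
qed

text \<open>The finite set \<open>S\<close> holds the points where a profile has a kink, namely the
  origin and the interfaces at distance c; continuity of \<open>P\<close> across them prevents extra
  boundary terms.\<close>

lemma has_integral_space_parts:
  fixes P P1 :: "real \<Rightarrow> real"
  assumes \<psi>: "test_fun T \<psi>" and "u \<le> v" "finite S" "continuous_on {u..v} P"
    and "\<And>x. x \<in> {u<..<v} - S \<Longrightarrow> (P has_real_derivative P1 x) (at x)"
  shows "((\<lambda>x. P x * px \<psi> (x, t) + P1 x * \<psi> (x, t)) has_integral (P v * \<psi> (v, t) - P u * \<psi> (u, t))) {u..v}"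
proof (rule fundamental_theorem_of_calculus_interior_strong[OF assms(3,2)])
  note reg = test_fun_regular[OF \<psi>]
  show "continuous_on {u..v} (\<lambda>x. P x * \<psi> (x, t))"
    by (intro continuous_intros assms(4) continuous_on_slice reg)
  fix x assume "x \<in> {u<..<v} - S"
  then have "((\<lambda>x. P x * \<psi> (x, t)) has_real_derivative (P x * px \<psi> (x, t) + P1 x * \<psi> (x, t))) (at x)"
    using DERIV_mult[OF assms(5) reg(4)] by (simp add: algebra_simps)
  then show "((\<lambda>x. P x * \<psi> (x, t)) has_vector_derivative (P x * px \<psi> (x, t) + P1 x * \<psi> (x, t))) (at x)"
    by (simp add: has_real_derivative_iff_has_vector_derivative)
qed

lemma lborel_integral_eq_has_integral:
  fixes f :: "real \<Rightarrow> real"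
  assumes "integrable lborel f" "(f has_integral I) {-R..R}" "\<And>x. \<bar>x\<bar> \<ge> R \<Longrightarrow> f x = 0"
  shows "(LINT x|lborel. f x) = I"
proof -
  have "(f has_integral I) UNIV"
    using assms(2) by (rule has_integral_on_superset) (auto intro!: assms(3))
  then show ?thesis
    using has_integral_integral_lborel[OF assms(1)] has_integral_unique by blast
qed

lemma lborel_half_integral_eq_has_integral:
  fixes f :: "real \<Rightarrow> real"
  assumes "integrable lborel f" "(f has_integral I) {0..R}" "\<And>x. \<bar>x\<bar> \<ge> R \<Longrightarrow> f x = 0" "R > 0"
  shows "(LINT x|lborel. f x * indicator {0<..} x) = I"
proof -
  have "((\<lambda>x. f x * indicator {0<..} x) has_integral I) {0..R}"
    by (rule has_integral_spike[OF _ _ assms(2), of "{0}"]) auto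
  then have "((\<lambda>x. f x * indicator {0<..} x) has_integral I) UNIV"
    by (rule has_integral_on_superset) (auto intro!: assms(3))
  moreover have "integrable lborel (\<lambda>x. f x * indicator {0<..} x)"
    by (intro integrable_real_mult_indicator assms(1)) simp
  ultimately show ?thesis
    using has_integral_integral_lborel has_integral_unique by blast
qed

text \<open>\<open>F\<close> is the spatial profile on the half-line \<open>x \<ge> 0\<close>, extended evenly.\<close>

locale even_mode =
  fixes g :: "real \<Rightarrow> real" and c \<mu> G B :: real and F F1 :: "real \<Rightarrow> real" and T :: real
  assumes g_meas [measurable]: "g \<in> borel_measurable borel" and g_bound: "\<And>x. \<bar>g x\<bar> \<le> G"
    and g_even: "\<And>x. \<bar>x\<bar> \<noteq> c \<Longrightarrow> g (- x) = g x"
    and F_cont: "continuous_on {0..} F" and F1_cont: "continuous_on {0..} F1"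
    and F_deriv: "\<And>x. 0 < x \<Longrightarrow> x \<noteq> c \<Longrightarrow> (F has_real_derivative F1 x) (at x)"
    and F1_deriv: "\<And>x. 0 < x \<Longrightarrow> x \<noteq> c \<Longrightarrow> (F1 has_real_derivative - (\<mu>\<^sup>2 * g x * F x)) (at x)"
    and F_bound: "\<And>x. x \<ge> 0 \<Longrightarrow> \<bar>F x\<bar> \<le> B" and F1_bound: "\<And>x. x \<ge> 0 \<Longrightarrow> \<bar>F1 x\<bar> \<le> B"
    and T_nonneg: "T \<ge> 0" and sin_T: "sin (\<mu> * T) = 0" and cos_T: "cos (\<mu> * T) = 1"
begin

definition W where "W z = F \<bar>fst z\<bar> * cos (\<mu> * snd z)"
definition Wx where "Wx z = sgn (fst z) * F1 \<bar>fst z\<bar> * cos (\<mu> * snd z)"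
definition Wt where "Wt z = - (\<mu> * F \<bar>fst z\<bar> * sin (\<mu> * snd z))"

lemma B_nonneg: "B \<ge> 0"
  using F_bound[of 0] by simp

lemma F_abs_cont: "continuous_on A (\<lambda>x. F \<bar>x\<bar>)" and F1_abs_cont: "continuous_on A (\<lambda>x. F1 \<bar>x\<bar>)"
  by (auto intro!: continuous_on_compose2[OF F_cont] continuous_on_compose2[OF F1_cont] continuous_intros)

lemma F_abs_meas [measurable]: "(\<lambda>x. F \<bar>x\<bar>) \<in> borel_measurable borel"
  and F1_abs_meas [measurable]: "(\<lambda>x. F1 \<bar>x\<bar>) \<in> borel_measurable borel"
  by (intro borel_measurable_continuous_onI F_abs_cont F1_abs_cont)+

lemma meas_pair: "(\<lambda>z. h (fst z) * k (snd z)) \<in> borel_measurable borel"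
  if "h \<in> borel_measurable borel" "k \<in> borel_measurable borel" for h k :: "real \<Rightarrow> real"
  using that unfolding borel_prod[symmetric] by measurable

lemma W_meas: "W \<in> borel_measurable borel"
  unfolding W_def[abs_def] by (rule meas_pair) auto

lemma Wx_meas: "Wx \<in> borel_measurable borel"
  unfolding Wx_def[abs_def] by (rule meas_pair) auto

lemma Wt_meas: "Wt \<in> borel_measurable borel"
proof -
  have "(\<lambda>z. - (\<mu> * F \<bar>fst z\<bar>) * sin (\<mu> * snd z)) \<in> borel_measurable borel"
    by (rule meas_pair) auto
  then show ?thesis by (simp add: Wt_def[abs_def])
qed

lemma W_bound: "\<bar>W z\<bar> \<le> B"
  using mult_mono[OF F_bound[of "\<bar>fst z\<bar>"] abs_cos_le_one[of "\<mu> * snd z"]] B_nonneg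
  by (simp add: W_def abs_mult)

lemma sgn_F1_bound: "\<bar>sgn x * F1 \<bar>x\<bar>\<bar> \<le> B"
  using F1_bound[of "\<bar>x\<bar>"] B_nonneg by (auto simp: abs_mult sgn_if)

lemma Wx_bound: "\<bar>Wx z\<bar> \<le> B"
  using mult_mono[OF sgn_F1_bound[of "fst z"] abs_cos_le_one[of "\<mu> * snd z"]] B_nonneg
  by (simp add: Wx_def abs_mult)

lemma Wt_bound: "\<bar>Wt z\<bar> \<le> \<bar>\<mu>\<bar> * B"
  using mult_left_mono[OF mult_mono[OF F_bound[of "\<bar>fst z\<bar>"] abs_sin_le_one[of "\<mu> * snd z"]], of "\<bar>\<mu>\<bar>"] B_nonneg
  by (simp add: Wt_def abs_mult mult.assoc)

lemma F_abs_deriv: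
  assumes "x \<notin> {0, c, - c}"
  shows "((\<lambda>x. F \<bar>x\<bar>) has_real_derivative sgn x * F1 \<bar>x\<bar>) (at x)"
proof (cases "x > 0")
  case True
  then have ev: "\<forall>\<^sub>F y in nhds x. F \<bar>y\<bar> = F y"
    using eventually_nhds_in_open[of "{0<..}" x] by (auto elim!: eventually_mono)
  show ?thesis using DERIV_cong_ev[OF refl ev refl] F_deriv[of x] True assms by simp
next
  case False
  then have x: "x < 0" using assms by auto
  then have ev: "\<forall>\<^sub>F y in nhds x. F \<bar>y\<bar> = F (- y)"
    using eventually_nhds_in_open[of "{..<0}" x] by (auto elim!: eventually_mono)
  have "((\<lambda>y. F (- y)) has_real_derivative F1 (- x) * (- 1)) (at x)"
    by (rule DERIV_chain2[OF F_deriv]) (use x assms in \<open>auto intro!: derivative_eq_intros\<close>)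
  then show ?thesis using DERIV_cong_ev[OF refl ev refl] x by simp
qed

context
  fixes \<psi> :: "real \<times> real \<Rightarrow> real"
  assumes \<psi>: "test_fun T \<psi>"
begin

lemma integrable_W_test:
  "integrable (dom_measure T) (\<lambda>z. W z * px \<psi> z)" "integrable (dom_measure T) (\<lambda>z. W z * pt \<psi> z)"
  "integrable (dom_measure T) (\<lambda>z. Wx z * \<psi> z)" "integrable (dom_measure T) (\<lambda>z. Wx z * px \<psi> z)"
  "integrable (dom_measure T) (\<lambda>z. Wt z * \<psi> z)"
proof -
  obtain R where "R > 0" "\<And>x t. \<bar>x\<bar> \<ge> R \<Longrightarrow> \<psi> (x, t) = 0"
    "\<And>x t. \<bar>x\<bar> \<ge> R \<Longrightarrow> px \<psi> (x, t) = 0" "\<And>x t. \<bar>x\<bar> \<ge> R \<Longrightarrow> pt \<psi> (x, t) = 0"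
    using test_fun_support[OF \<psi>] by blast
  note R = this and reg = test_fun_regular[OF \<psi>]
  show "integrable (dom_measure T) (\<lambda>z. W z * px \<psi> z)" "integrable (dom_measure T) (\<lambda>z. W z * pt \<psi> z)"
    "integrable (dom_measure T) (\<lambda>z. Wx z * \<psi> z)" "integrable (dom_measure T) (\<lambda>z. Wx z * px \<psi> z)"
    "integrable (dom_measure T) (\<lambda>z. Wt z * \<psi> z)"
    by (rule integrable_dom_times_continuous[OF W_meas W_bound reg(2) R(3)]
      integrable_dom_times_continuous[OF W_meas W_bound reg(3) R(4)]
      integrable_dom_times_continuous[OF Wx_meas Wx_bound reg(1) R(2)]
      integrable_dom_times_continuous[OF Wx_meas Wx_bound reg(2) R(3)]
      integrable_dom_times_continuous[OF Wt_meas Wt_bound reg(1) R(2)]; assumption)+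
qed

lemma slice_integrable:
  assumes "u \<in> borel_measurable borel" "\<And>x. \<bar>u x\<bar> \<le> C"
  shows "integrable lborel (\<lambda>x. u x * px \<psi> (x, t))" "integrable lborel (\<lambda>x. u x * \<psi> (x, t))"
proof -
  obtain R where "\<And>x t. \<bar>x\<bar> \<ge> R \<Longrightarrow> \<psi> (x, t) = 0" "\<And>x t. \<bar>x\<bar> \<ge> R \<Longrightarrow> px \<psi> (x, t) = 0"
    using test_fun_support[OF \<psi>] by metis
  note R = this and reg = test_fun_regular[OF \<psi>]
  show "integrable lborel (\<lambda>x. u x * px \<psi> (x, t))" "integrable lborel (\<lambda>x. u x * \<psi> (x, t))"
    by (rule integrable_lborel_times_continuous[OF assms continuous_on_slice(1)[OF reg(2)] R(2)]
       integrable_lborel_times_continuous[OF assms continuous_on_slice(1)[OF reg(1)] R(1)]; assumption)+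
qed

lemma W_weak_dx: "(LINT z|dom_measure T. W z * px \<psi> z) = - (LINT z|dom_measure T. Wx z * \<psi> z)"
proof -
  obtain R where R: "R > 0" "\<And>x t. \<bar>x\<bar> \<ge> R \<Longrightarrow> \<psi> (x, t) = 0" "\<And>x t. \<bar>x\<bar> \<ge> R \<Longrightarrow> px \<psi> (x, t) = 0"
    using test_fun_support[OF \<psi>] by metis
  have inner: "(LINT x|lborel. F \<bar>x\<bar> * px \<psi> (x, t) + sgn x * F1 \<bar>x\<bar> * \<psi> (x, t)) = 0" for t
  proof (rule lborel_integral_eq_has_integral)
    show "integrable lborel (\<lambda>x. F \<bar>x\<bar> * px \<psi> (x, t) + sgn x * F1 \<bar>x\<bar> * \<psi> (x, t))"
      by (intro Bochner_Integration.integrable_add slice_integrable[of _ B] F_bound sgn_F1_bound) auto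
    show "((\<lambda>x. F \<bar>x\<bar> * px \<psi> (x, t) + sgn x * F1 \<bar>x\<bar> * \<psi> (x, t)) has_integral 0) {-R..R}"
      using has_integral_space_parts[OF \<psi>, of "-R" R "{0, c, - c}" "\<lambda>x. F \<bar>x\<bar>" "\<lambda>x. sgn x * F1 \<bar>x\<bar>" t]
        F_abs_cont F_abs_deriv R by auto
    show "F \<bar>x\<bar> * px \<psi> (x, t) + sgn x * F1 \<bar>x\<bar> * \<psi> (x, t) = 0" if "\<bar>x\<bar> \<ge> R" for x
      using R that by simp
  qed
  have "(LINT z|dom_measure T. W z * px \<psi> z + Wx z * \<psi> z)
     = (LINT t:{0..T}|lborel. LINT x|lborel. W (x, t) * px \<psi> (x, t) + Wx (x, t) * \<psi> (x, t))"
    by (intro integral_dom_x_inner Bochner_Integration.integrable_add integrable_W_test)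
  also have "\<dots> = (LINT t:{0..T}|lborel. cos (\<mu> * t) * (LINT x|lborel. F \<bar>x\<bar> * px \<psi> (x, t) + sgn x * F1 \<bar>x\<bar> * \<psi> (x, t)))"
    unfolding integral_mult_right_zero[symmetric] W_def Wx_def by (simp add: algebra_simps)
  also have "\<dots> = 0" unfolding inner by simp
  finally show ?thesis using integrable_W_test by simp
qed

lemma W_weak_dt: "(LINT z|dom_measure T. W z * pt \<psi> z) = - (LINT z|dom_measure T. Wt z * \<psi> z)"
proof -
  have inner: "(LINT t:{0..T}|lborel. cos (\<mu> * t) * pt \<psi> (x, t)) = - (LINT t:{0..T}|lborel. - \<mu> * sin (\<mu> * t) * \<psi> (x, t))" for x
    by (rule time_integration_by_parts[OF \<psi> T_nonneg])
      (auto intro!: derivative_eq_intros continuous_intros simp: cos_T)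
  have "(LINT z|dom_measure T. W z * pt \<psi> z) = (LINT x|lborel. (LINT t:{0..T}|lborel. F \<bar>x\<bar> * (cos (\<mu> * t) * pt \<psi> (x, t))))"
    by (subst integral_dom_t_inner[OF integrable_W_test(2)]) (simp add: W_def mult.assoc)
  also have "\<dots> = - (LINT x|lborel. (LINT t:{0..T}|lborel. F \<bar>x\<bar> * (- \<mu> * sin (\<mu> * t) * \<psi> (x, t))))"
    unfolding set_integral_mult_right inner by simp
  also have "\<dots> = - (LINT z|dom_measure T. Wt z * \<psi> z)"
    by (subst integral_dom_t_inner[OF integrable_W_test(5)]) (simp add: Wt_def mult_ac)
  finally show ?thesis .
qed

text \<open>On the half-line x > 0 the product rule leaves only the boundary term at 0, so the trace
  of the mode is F 0 * cos (\<mu> * t).\<close>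

lemma W_trace:
  "(LINT z|dom_measure T. (W z * px \<psi> z + Wx z * \<psi> z) * indicator ({0<..} \<times> UNIV) z)
    = - F 0 * (LINT t:{0..T}|lborel. cos (\<mu> * t) * \<psi> (0, t))"
proof -
  obtain R where R: "R > 0" "\<And>x t. \<bar>x\<bar> \<ge> R \<Longrightarrow> \<psi> (x, t) = 0" "\<And>x t. \<bar>x\<bar> \<ge> R \<Longrightarrow> px \<psi> (x, t) = 0"
    using test_fun_support[OF \<psi>] by metis
  have inner: "(LINT x|lborel. (F \<bar>x\<bar> * px \<psi> (x, t) + sgn x * F1 \<bar>x\<bar> * \<psi> (x, t)) * indicator {0<..} x) = - F 0 * \<psi> (0, t)" for t
  proof (rule lborel_half_integral_eq_has_integral)
    show "integrable lborel (\<lambda>x. F \<bar>x\<bar> * px \<psi> (x, t) + sgn x * F1 \<bar>x\<bar> * \<psi> (x, t))"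
      by (intro Bochner_Integration.integrable_add slice_integrable[of _ B] F_bound sgn_F1_bound) auto
    show "((\<lambda>x. F \<bar>x\<bar> * px \<psi> (x, t) + sgn x * F1 \<bar>x\<bar> * \<psi> (x, t)) has_integral - F 0 * \<psi> (0, t)) {0..R}"
    proof -
      have "((\<lambda>x. F \<bar>x\<bar> * px \<psi> (x, t) + sgn x * F1 \<bar>x\<bar> * \<psi> (x, t)) has_integral (F \<bar>R\<bar> * \<psi> (R, t) - F \<bar>0\<bar> * \<psi> (0, t))) {0..R}"
        using R(1) by (intro has_integral_space_parts[OF \<psi>, of 0 R "{0, c, - c}"] F_abs_cont F_abs_deriv) auto
      then show ?thesis using R by simp
    qed
    show "F \<bar>x\<bar> * px \<psi> (x, t) + sgn x * F1 \<bar>x\<bar> * \<psi> (x, t) = 0" if "\<bar>x\<bar> \<ge> R" for x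
      using R that by simp
  qed (rule R(1))
  have "integrable (dom_measure T) (\<lambda>z. (W z * px \<psi> z + Wx z * \<psi> z) * indicator ({0<..} \<times> UNIV) z)"
    by (intro integrable_dom_half Bochner_Integration.integrable_add integrable_W_test)
  from integral_dom_x_inner[OF this] 
  have "(LINT z|dom_measure T. (W z * px \<psi> z + Wx z * \<psi> z) * indicator ({0<..} \<times> UNIV) z)
     = (LINT t:{0..T}|lborel. LINT x|lborel. (W (x, t) * px \<psi> (x, t) + Wx (x, t) * \<psi> (x, t)) * indicator ({0<..} \<times> UNIV) (x, t))" .
  also have "\<dots> = (LINT t:{0..T}|lborel. LINT x|lborel. cos (\<mu> * t) * ((F \<bar>x\<bar> * px \<psi> (x, t) + sgn x * F1 \<bar>x\<bar> * \<psi> (x, t)) * indicator {0<..} x))"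
    unfolding W_def Wx_def by (simp add: algebra_simps indicator_times)
  also have "\<dots> = (LINT t:{0..T}|lborel. - F 0 * (cos (\<mu> * t) * \<psi> (0, t)))"
    unfolding integral_mult_right_zero inner by (simp add: algebra_simps)
  finally show ?thesis by (simp only: set_integral_mult_right)
qed

text \<open>A mode solves the linear equation off the line x = 0, so the weak form reduces to the
  flux jump there. Integration by parts in time turns the first term into one containing
  \<open>F1\<close>'s derivative, and integration by parts in space on each half-line then
  contributes -F1 0 from either side.\<close>

lemma W_flux:
  "(LINT z|dom_measure T. - g (fst z) * Wt z * pt \<psi> z + Wx z * px \<psi> z)
    = - 2 * F1 0 * (LINT t:{0..T}|lborel. cos (\<mu> * t) * \<psi> (0, t))"
proof -
  obtain R where R: "R > 0" "\<And>x t. \<bar>x\<bar> \<ge> R \<Longrightarrow> \<psi> (x, t) = 0" "\<And>x t. \<bar>x\<bar> \<ge> R \<Longrightarrow> px \<psi> (x, t) = 0"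
    "\<And>x t. \<bar>x\<bar> \<ge> R \<Longrightarrow> pt \<psi> (x, t) = 0"
    using test_fun_support[OF \<psi>] by metis
  note reg = test_fun_regular[OF \<psi>]
  \<comment> \<open>Away from 0 and the interfaces, \<open>H\<close> is the second derivative of the
    evenly extended profile.\<close>
  define H where "H = (\<lambda>x. - (\<mu>\<^sup>2 * g x * F \<bar>x\<bar>))"
  have H_meas [measurable]: "H \<in> borel_measurable borel" unfolding H_def by measurable
  have gF: "\<bar>g x * F \<bar>x\<bar>\<bar> \<le> G * B" for x
    unfolding abs_mult using g_bound[of x] F_bound[of "\<bar>x\<bar>"] g_bound[of 0] by (intro mult_mono) auto
  have H_bound: "\<bar>H x\<bar> \<le> \<mu>\<^sup>2 * (G * B)" for x
    using mult_left_mono[OF gF[of x], of "\<mu>\<^sup>2"] by (simp add: H_def abs_mult mult.assoc)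
  have inner_x: "(LINT x|lborel. sgn x * F1 \<bar>x\<bar> * px \<psi> (x, t) + H x * \<psi> (x, t)) = - 2 * F1 0 * \<psi> (0, t)" for t
  proof (rule lborel_integral_eq_has_integral)
    show "integrable lborel (\<lambda>x. sgn x * F1 \<bar>x\<bar> * px \<psi> (x, t) + H x * \<psi> (x, t))"
      by (intro Bochner_Integration.integrable_add slice_integrable[OF _ sgn_F1_bound] slice_integrable[OF _ H_bound]) auto
    \<comment> \<open>The odd extension of \<open>F1\<close> jumps at 0, so each half-interval is
      treated with its one-sided continuous version, which differs from the integrand at the single
      point 0.\<close>
    have right: "((\<lambda>x. sgn x * F1 \<bar>x\<bar> * px \<psi> (x, t) + H x * \<psi> (x, t)) has_integral - F1 0 * \<psi> (0, t)) {0..R}"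
    proof (rule has_integral_spike[of "{0}"])
      have "((\<lambda>x. F1 x * px \<psi> (x, t) + H x * \<psi> (x, t)) has_integral (F1 R * \<psi> (R, t) - F1 0 * \<psi> (0, t))) {0..R}"
      proof (rule has_integral_space_parts[OF \<psi>])
        show "continuous_on {0..R} F1" by (rule continuous_on_subset[OF F1_cont]) auto
        show "(F1 has_real_derivative H x) (at x)" if "x \<in> {0<..<R} - {c}" for x
          using F1_deriv[of x] that by (simp add: H_def)
      qed (use R in auto)
      then show "((\<lambda>x. F1 x * px \<psi> (x, t) + H x * \<psi> (x, t)) has_integral - F1 0 * \<psi> (0, t)) {0..R}"
        using R by simp
    qed auto
    have left: "((\<lambda>x. sgn x * F1 \<bar>x\<bar> * px \<psi> (x, t) + H x * \<psi> (x, t)) has_integral - F1 0 * \<psi> (0, t)) {-R..0}"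
    proof (rule has_integral_spike[of "{0}"])
      have "((\<lambda>x. - F1 (- x) * px \<psi> (x, t) + H x * \<psi> (x, t)) has_integral (- F1 (- 0) * \<psi> (0, t) - - F1 (- (- R)) * \<psi> (- R, t))) {-R..0}"
      proof (rule has_integral_space_parts[OF \<psi>])
        show "continuous_on {-R..0} (\<lambda>x. - F1 (- x))"
          by (intro continuous_intros continuous_on_compose2[OF F1_cont]) auto
        show "((\<lambda>x. - F1 (- x)) has_real_derivative H x) (at x)" if x: "x \<in> {-R<..<0} - {- c}" for x
        proof -
          have "((\<lambda>x. F1 (- x)) has_real_derivative - (\<mu>\<^sup>2 * g (- x) * F (- x)) * (- 1)) (at x)"
            by (rule DERIV_chain2[OF F1_deriv]) (use x in \<open>auto intro!: derivative_eq_intros\<close>)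
          from DERIV_minus[OF this] show ?thesis
            using x g_even[of x] by (auto simp: H_def abs_if)
        qed
      qed (use R in auto)
      then show "((\<lambda>x. - F1 (- x) * px \<psi> (x, t) + H x * \<psi> (x, t)) has_integral - F1 0 * \<psi> (0, t)) {-R..0}"
        using R by simp
    qed auto
    show "((\<lambda>x. sgn x * F1 \<bar>x\<bar> * px \<psi> (x, t) + H x * \<psi> (x, t)) has_integral - 2 * F1 0 * \<psi> (0, t)) {-R..R}"
      using has_integral_combine[OF _ _ left right] R by (simp add: mult.assoc)
    show "sgn x * F1 \<bar>x\<bar> * px \<psi> (x, t) + H x * \<psi> (x, t) = 0" if "\<bar>x\<bar> \<ge> R" for x
      using R that by simp
  qed
  have inner_t: "(LINT t:{0..T}|lborel. sin (\<mu> * t) * pt \<psi> (x, t)) = - (LINT t:{0..T}|lborel. \<mu> * cos (\<mu> * t) * \<psi> (x, t))" for x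
    by (rule time_integration_by_parts[OF \<psi> T_nonneg])
      (auto intro!: derivative_eq_intros continuous_intros simp: sin_T)
  define HC where "HC = (\<lambda>z. H (fst z) * cos (\<mu> * snd z))"
  define gWt where "gWt = (\<lambda>z. \<mu> * g (fst z) * F \<bar>fst z\<bar> * sin (\<mu> * snd z))"
  have HC_meas: "HC \<in> borel_measurable borel" unfolding HC_def by (rule meas_pair) auto
  have gWt_meas: "gWt \<in> borel_measurable borel" unfolding gWt_def by (rule meas_pair) auto
  have HC_bound: "\<bar>HC z\<bar> \<le> \<mu>\<^sup>2 * (G * B) * 1" for z
    unfolding HC_def abs_mult[of "H _"] using order_trans[OF abs_ge_zero H_bound[of 0]] by (intro mult_mono H_bound) auto
  have gWt_bound: "\<bar>gWt z\<bar> \<le> \<bar>\<mu>\<bar> * (G * B) * 1" for z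
    unfolding gWt_def abs_mult[of _ "sin _"] using gF order_trans[OF abs_ge_zero gF[of 0]]
    by (intro mult_mono) (auto simp: abs_mult mult.assoc intro!: mult_left_mono)
  have i1: "integrable (dom_measure T) (\<lambda>z. gWt z * pt \<psi> z)"
    by (rule integrable_dom_times_continuous[OF gWt_meas gWt_bound reg(3) R(4)])
  have i2: "integrable (dom_measure T) (\<lambda>z. HC z * \<psi> z)"
    by (rule integrable_dom_times_continuous[OF HC_meas HC_bound reg(1) R(2)])
  have "(LINT z|dom_measure T. gWt z * pt \<psi> z) = (LINT x|lborel. (LINT t:{0..T}|lborel. \<mu> * g x * F \<bar>x\<bar> * (sin (\<mu> * t) * pt \<psi> (x, t))))"
    by (subst integral_dom_t_inner[OF i1]) (simp add: gWt_def mult.assoc)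
  also have "\<dots> = (LINT x|lborel. - (LINT t:{0..T}|lborel. \<mu> * g x * F \<bar>x\<bar> * (\<mu> * cos (\<mu> * t) * \<psi> (x, t))))"
    unfolding set_integral_mult_right[of _ _ "\<mu> * g _ * F _"] inner_t by simp
  also have "\<dots> = (LINT x|lborel. (LINT t:{0..T}|lborel. HC (x, t) * \<psi> (x, t)))"
    unfolding HC_def H_def by (simp add: power2_eq_square mult_ac set_integral_uminus set_lebesgue_integral_def)
  also have "\<dots> = (LINT z|dom_measure T. HC z * \<psi> z)"
    by (rule integral_dom_t_inner[OF i2, symmetric])
  finally have eq: "(LINT z|dom_measure T. gWt z * pt \<psi> z) = (LINT z|dom_measure T. HC z * \<psi> z)" .
  have "(LINT z|dom_measure T. - g (fst z) * Wt z * pt \<psi> z + Wx z * px \<psi> z)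
     = (LINT z|dom_measure T. gWt z * pt \<psi> z + Wx z * px \<psi> z)"
    by (simp add: gWt_def Wt_def mult_ac)
  also have "\<dots> = (LINT z|dom_measure T. Wx z * px \<psi> z + HC z * \<psi> z)"
    using i1 i2 integrable_W_test(4) eq by simp
  also have "\<dots> = (LINT t:{0..T}|lborel. LINT x|lborel. Wx (x, t) * px \<psi> (x, t) + HC (x, t) * \<psi> (x, t))"
    by (intro integral_dom_x_inner Bochner_Integration.integrable_add i2 integrable_W_test)
  also have "\<dots> = (LINT t:{0..T}|lborel. LINT x|lborel. cos (\<mu> * t) * (sgn x * F1 \<bar>x\<bar> * px \<psi> (x, t) + H x * \<psi> (x, t)))"
    unfolding Wx_def HC_def by (simp add: algebra_simps)
  also have "\<dots> = (LINT t:{0..T}|lborel. - 2 * F1 0 * (cos (\<mu> * t) * \<psi> (0, t)))"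
    unfolding integral_mult_right_zero inner_x by (simp add: algebra_simps)
  finally show ?thesis by (simp only: set_integral_mult_right)
qed

end

end

section \<open>Series of orthogonal modes\<close>

lemma integrable_exp_abs:
  assumes s: "s > 0"
  shows "integrable lborel (\<lambda>x::real. exp (- s * \<bar>x\<bar>))"
proof -
  have "(\<lambda>x. exp (- s * x)) absolutely_integrable_on {0..}"
    by (intro nonnegative_absolutely_integrable_1 integrable_on_exp_minus_to_infinity s) auto
  then have "integrable lebesgue (\<lambda>x. indicator {0..} x *\<^sub>R exp (- s * x))"
    by (simp add: set_integrable_def)
  then have r: "integrable lborel (\<lambda>x. indicator {0..} x *\<^sub>R exp (- s * x))"
    by (subst (asm) integrable_completion) auto
  then have l: "integrable lborel (\<lambda>x. indicator {0..} (0 + (- 1) * x) *\<^sub>R exp (- s * (0 + (- 1) * x)))"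
    by (rule lborel_integrable_real_affine) simp
  show ?thesis
  proof (rule Bochner_Integration.integrable_bound[OF Bochner_Integration.integrable_add[OF r l]])
    show "AE x in lborel. norm (exp (- s * \<bar>x\<bar>)) \<le> norm (indicator {0..} x *\<^sub>R exp (- s * x)
       + indicator {0..} (0 + (- 1) * x) *\<^sub>R exp (- s * (0 + (- 1) * x)))"
      by (intro AE_I2) (auto simp: indicator_def abs_if)
  qed simp
qed

lemma integrable_dom_fst:
  fixes h :: "real \<Rightarrow> real"
  assumes h: "integrable lborel h" and T: "T \<ge> 0"
  shows "integrable (dom_measure T) (\<lambda>z. h (fst z))"
proof -
  have [measurable]: "h \<in> borel_measurable borel" using h by auto
  have "integrable (lborel \<Otimes>\<^sub>M lborel) (\<lambda>z. indicator {0..T} (snd z) *\<^sub>R h (fst z))"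
  proof (rule lborel_pair.Fubini_integrable)
    have "(\<integral> y. norm (indicator {0..T} (snd (x, y)) *\<^sub>R h (fst (x, y))) \<partial>lborel) = T * \<bar>h x\<bar>" for x
    proof -
      have "(\<integral> y. norm (indicator {0..T} (snd (x, y)) *\<^sub>R h (fst (x, y))) \<partial>lborel) = (\<integral> y. indicator {0..T} y * \<bar>h x\<bar> \<partial>lborel)"
        by (intro Bochner_Integration.integral_cong) (auto simp: abs_mult indicator_def)
      then show ?thesis using T by simp
    qed
    then show "integrable lborel (\<lambda>x. \<integral> y. norm (indicator {0..T} (snd (x, y)) *\<^sub>R h (fst (x, y))) \<partial>lborel)"
      using h by simp
    show "AE x in lborel. integrable lborel (\<lambda>y. indicator {0..T} (snd (x, y)) *\<^sub>R h (fst (x, y)))"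
      using T by simp
  qed measurable
  moreover have "(\<lambda>z. indicator {0..T} (snd z) *\<^sub>R h (fst z)) = (\<lambda>z. indicator (Dom T) z *\<^sub>R h (fst z))"
    by (auto simp: Dom_def indicator_def fun_eq_iff)
  ultimately show ?thesis unfolding integrable_dom_iff by simp
qed

text \<open>Orthogonality of the time factors gives Parseval at every fixed x, and the common
  envelope \<open>E\<close> makes the result integrable in x. Square summable weights
  \<open>d\<close> thus suffice for convergence in L2 over the unbounded strip; they need not be
  summable.\<close>

locale mode_series =
  fixes T :: real and p e :: "nat \<Rightarrow> real \<Rightarrow> real" and d :: "nat \<Rightarrow> real" and E :: "real \<Rightarrow> real"
  assumes T: "T \<ge> 0"
    and p_meas [measurable]: "\<And>j. p j \<in> borel_measurable borel"
    and p_bound: "\<And>j x. \<bar>p j x\<bar> \<le> d j * E x"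
    and e_cont: "\<And>j. continuous_on UNIV (e j)" and e_bound: "\<And>j t. \<bar>e j t\<bar> \<le> 1"
    and e_orth: "\<And>i j. ((\<lambda>t. e i t * e j t) has_integral (if i = j then T / 2 else 0)) {0..T}"
    and E_meas [measurable]: "E \<in> borel_measurable borel" and E_pos: "\<And>x. E x > 0"
    and E_int: "integrable lborel (\<lambda>x. (E x)\<^sup>2)"
    and d_sum: "summable (\<lambda>j. (d j)\<^sup>2)"
begin

lemma e_meas [measurable]: "e j \<in> borel_measurable borel"
  by (rule borel_measurable_continuous_onI[OF e_cont])

lemma d_nonneg: "d j \<ge> 0"
  using p_bound[of j 0] E_pos[of 0] by (smt (verit) zero_le_mult_iff)

definition S :: "nat set \<Rightarrow> real \<times> real \<Rightarrow> real" where
  "S J z = (\<Sum>j\<in>J. p j (fst z) * e j (snd z))"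

lemma S_meas [measurable]: "S J \<in> borel_measurable borel"
  unfolding S_def[abs_def] borel_prod[symmetric] by measurable

lemma S_meas_dom: "S J \<in> borel_measurable (dom_measure T)"
  by (rule measurable_dom_measure[OF S_meas])

lemma E_dom: "integrable (dom_measure T) (\<lambda>z. (E (fst z))\<^sup>2)"
  by (rule integrable_dom_fst[OF E_int T])

lemma S_bound: "\<bar>S J z\<bar> \<le> (\<Sum>j\<in>J. d j) * E (fst z)"
proof -
  have "\<bar>S J z\<bar> \<le> (\<Sum>j\<in>J. \<bar>p j (fst z) * e j (snd z)\<bar>)"
    unfolding S_def by (rule sum_abs)
  also have "\<dots> \<le> (\<Sum>j\<in>J. d j * E (fst z))"
  proof (rule sum_mono)
    fix j
    show "\<bar>p j (fst z) * e j (snd z)\<bar> \<le> d j * E (fst z)"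
      using mult_mono[OF p_bound[of j "fst z"] e_bound[of j "snd z"]] d_nonneg[of j] E_pos[of "fst z"]
      by (simp add: abs_mult)
  qed
  finally show ?thesis by (simp add: sum_distrib_right)
qed

lemma S_int: "integrable (dom_measure T) (\<lambda>z. (S J z)\<^sup>2)"
proof (rule Bochner_Integration.integrable_bound)
  show "integrable (dom_measure T) (\<lambda>z. (\<Sum>j\<in>J. d j)\<^sup>2 * (E (fst z))\<^sup>2)"
    using E_dom by simp
  show "AE z in dom_measure T. norm ((S J z)\<^sup>2) \<le> norm ((\<Sum>j\<in>J. d j)\<^sup>2 * (E (fst z))\<^sup>2)"
  proof (intro AE_I2)
    fix z
    show "norm ((S J z)\<^sup>2) \<le> norm ((\<Sum>j\<in>J. d j)\<^sup>2 * (E (fst z))\<^sup>2)"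
      using power_mono[OF S_bound[of J z], of 2] by (simp add: power_mult_distrib)
  qed
qed (use S_meas_dom in auto)

lemma S_integral_le:
  assumes J: "finite J"
  shows "(LINT z|dom_measure T. (S J z)\<^sup>2) \<le> (\<Sum>j\<in>J. (d j)\<^sup>2) * (T / 2 * (LINT x|lborel. (E x)\<^sup>2))"
proof -
  have inner: "(LINT t:{0..T}|lborel. (S J (x, t))\<^sup>2) = T / 2 * (\<Sum>j\<in>J. (p j x)\<^sup>2)" for x
  proof -
    have "set_integrable lborel {0..T} (\<lambda>t. (S J (x, t))\<^sup>2)"
      unfolding S_def fst_conv snd_conv
      by (intro set_integrable_continuous_Icc continuous_intros continuous_on_subset[OF e_cont] subset_UNIV)
    moreover have "((\<lambda>t. (S J (x, t))\<^sup>2) has_integral T / 2 * (\<Sum>j\<in>J. (p j x)\<^sup>2)) {0..T}"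
      unfolding S_def fst_conv snd_conv by (rule has_integral_orthogonal_sum_squared[OF J e_orth])
    ultimately show ?thesis
      by (simp add: set_borel_integral_eq_integral(2) integral_unique)
  qed
  have p2: "(p j x)\<^sup>2 \<le> (d j)\<^sup>2 * (E x)\<^sup>2" for j x
    using power_mono[OF p_bound[of j x], of 2] by (simp add: power_mult_distrib)
  have "integrable lborel (\<lambda>x. (p j x)\<^sup>2)" for j
  proof (rule Bochner_Integration.integrable_bound)
    show "integrable lborel (\<lambda>x. (d j)\<^sup>2 * (E x)\<^sup>2)" using E_int by simp
    show "AE x in lborel. norm ((p j x)\<^sup>2) \<le> norm ((d j)\<^sup>2 * (E x)\<^sup>2)"
      using p2 by (intro AE_I2) simp
  qed simp
  then have "(LINT x|lborel. T / 2 * (\<Sum>j\<in>J. (p j x)\<^sup>2)) \<le> (LINT x|lborel. T / 2 * (\<Sum>j\<in>J. (d j)\<^sup>2 * (E x)\<^sup>2))"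
    using E_int T by (intro integral_mono mult_left_mono sum_mono p2) auto
  also have "\<dots> = (\<Sum>j\<in>J. (d j)\<^sup>2) * (T / 2 * (LINT x|lborel. (E x)\<^sup>2))"
    by (simp flip: sum_distrib_right)
  finally show ?thesis
    unfolding integral_dom_t_inner[OF S_int] inner .
qed

lemma L2_limit:
  obtains f where "f \<in> borel_measurable (dom_measure T)" "integrable (dom_measure T) (\<lambda>z. (f z)\<^sup>2)"
    "(\<lambda>N. LINT z|dom_measure T. (S {..<N} z - f z)\<^sup>2) \<longlonglongrightarrow> 0"
\<comment> \<open>The envelope serves as the strictly positive square integrable weight; the Cauchy
  property is the tail bound of the series of squared weights.\<close>
proof (rule L2_complete[of "\<lambda>N. S {..<N}" "dom_measure T" "\<lambda>z. E (fst z)"])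
  have "(\<lambda>z::real \<times> real. E (fst z)) \<in> borel_measurable borel"
    unfolding borel_prod[symmetric] by measurable
  then show "(\<lambda>z. E (fst z)) \<in> borel_measurable (dom_measure T)"
    by (rule measurable_dom_measure)
  fix \<epsilon> :: real assume \<epsilon>: "\<epsilon> > 0"
  define K where "K = T / 2 * (LINT x|lborel. (E x)\<^sup>2)"
  have K: "K \<ge> 0" using T by (simp add: K_def)
  have "\<epsilon> / (K + 1) > 0" using \<epsilon> K by simp
  then obtain N where N: "\<And>m n. m \<ge> N \<Longrightarrow> norm (\<Sum>j\<in>{m..<n}. (d j)\<^sup>2) < \<epsilon> / (K + 1)"
    using d_sum unfolding summable_Cauchy by blast
  have le: "(LINT z|dom_measure T. (S {..<n} z - S {..<m} z)\<^sup>2) < \<epsilon>" if "m \<ge> N" "m \<le> n" for m n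
  proof -
    have "S {..<n} z - S {..<m} z = S {m..<n} z" for z
      unfolding S_def using sum_diff[of "{..<n}" "{..<m}" "\<lambda>j. p j (fst z) * e j (snd z)"] that
      by (auto simp: lessThan_minus_lessThan)
    then have "(LINT z|dom_measure T. (S {..<n} z - S {..<m} z)\<^sup>2) \<le> (\<Sum>j\<in>{m..<n}. (d j)\<^sup>2) * K"
      using S_integral_le[of "{m..<n}"] by (simp add: K_def)
    also have "\<dots> \<le> \<epsilon> / (K + 1) * K"
      using N[OF that(1), of n] K by (intro mult_right_mono) auto
    also have "\<dots> < \<epsilon>" using \<epsilon> K by (simp add: field_simps)
    finally show ?thesis .
  qed
  show "\<exists>N. \<forall>m\<ge>N. \<forall>n\<ge>N. (LINT z|dom_measure T. (S {..<m} z - S {..<n} z)\<^sup>2) < \<epsilon>"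
  proof (intro exI[of _ N] allI impI)
    fix m n assume "m \<ge> N" "n \<ge> N"
    then show "(LINT z|dom_measure T. (S {..<m} z - S {..<n} z)\<^sup>2) < \<epsilon>"
      using le[of m n] le[of n m] by (cases "m \<le> n") (auto simp: power2_commute)
  qed
qed (use S_meas_dom S_int E_dom E_pos that in auto)

end

section \<open>The solution for one admissible frequency\<close>

lemma cos_od_half_pi: "cos (od n * (pi / 2)) = 0"
proof -
  have "od n * (pi / 2) = real n * pi + pi / 2" by (simp add: od_def field_simps)
  then show ?thesis by (simp only: cos_add) simp
qed

text \<open>Closure of odd numbers under products, with explicit index: it passes resonance from a
  frequency to its odd multiples.\<close>

lemma od_mult_od: "od i * od j = od (2 * i * j + i + j)"
  by (simp add: od_def algebra_simps)

text \<open>The base frequency \<Omega> may be a multiple of that belonging to T: \<open>k\<close>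
  counts the periods of length 2 * pi / \<Omega> inside T, and \<open>od m\<close> is the odd
  multiple of pi / 2 in the resonance condition.\<close>

locale wave_setting = cubic_profile V for V +
  fixes a b c \<gamma> \<Omega> T :: real and g :: "real \<Rightarrow> real" and k m :: nat
  assumes a: "a > 0" and b: "b > 0" and c: "c > 0"
    and g_out: "\<And>x. \<bar>x\<bar> > c \<Longrightarrow> g x = - a" and g_in: "\<And>x. \<bar>x\<bar> < c \<Longrightarrow> g x = b"
    and \<gamma>: "\<gamma> < 0" and \<Omega>: "\<Omega> > 0" and T_pos: "T > 0"
    and period: "\<Omega> * T = 2 * pi * real k"
    and resonance: "sqrt b * \<Omega> * c = od m * (pi / 2)"
begin

text \<open>Forced by matching derivatives at c: where the cosine vanishes, this requires sqrt a *
  \<kappa> = sqrt b.\<close>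

definition \<kappa> where "\<kappa> = sqrt b / sqrt a"
text \<open>Decay rate of the lowest mode, hence the slowest of all.\<close>

definition \<rho> where "\<rho> = sqrt a * \<Omega>"

definition freq :: "nat \<Rightarrow> real" where "freq j = od j * \<Omega>"

text \<open>By resonance \<open>cos (sqrt b * freq j * c) = 0\<close>, so the value and the derivative of the two branches at \<open>c\<close>
  match for the same coefficient \<open>\<kappa>\<close>, whatever \<open>j\<close> is.\<close>

definition prof :: "nat \<Rightarrow> real \<Rightarrow> real" where
  "prof j x = (if x \<le> c then cos (sqrt b * freq j * x) + \<kappa> * sin (sqrt b * freq j * x)
     else \<kappa> * sin (sqrt b * freq j * c) * exp (- (sqrt a * freq j * (x - c))))"

definition prof1 :: "nat \<Rightarrow> real \<Rightarrow> real" where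
  "prof1 j x = (if x \<le> c then sqrt b * freq j * (\<kappa> * cos (sqrt b * freq j * x) - sin (sqrt b * freq j * x))
     else - (sqrt a * freq j * \<kappa> * sin (sqrt b * freq j * c) * exp (- (sqrt a * freq j * (x - c)))))"

text \<open>One envelope for all modes. The factor exp (\<rho> * c) makes it at least 1 + \<kappa>
  on the inner region, where profiles oscillate with size at most 1 + \<kappa>; outside, every mode
  decays at least at rate \<rho>.\<close>

definition env :: "real \<Rightarrow> real" where
  "env x = (1 + \<kappa>) * exp (\<rho> * c) * exp (- \<rho> * \<bar>x\<bar>)"

lemma pos: "\<kappa> > 0" "\<rho> > 0" "freq j > 0" "sqrt a > 0" "sqrt b > 0"
  using a b \<Omega> by (simp_all add: \<kappa>_def \<rho>_def freq_def)

lemma freq_ge: "freq j \<ge> \<Omega>"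
  using od_ge_1[of j] \<Omega> by (simp add: freq_def)

lemma sqrt_a_\<kappa>: "sqrt a * \<kappa> = sqrt b"
  using a by (simp add: \<kappa>_def)

lemma cos_freq_c: "cos (sqrt b * freq j * c) = 0"
proof -
  have "sqrt b * freq j * c = od j * (sqrt b * \<Omega> * c)" by (simp add: freq_def)
  also have "\<dots> = od (2 * j * m + j + m) * (pi / 2)"
    unfolding resonance by (simp flip: od_mult_od)
  finally show ?thesis by (simp only: cos_od_half_pi)
qed

lemma prof_cont: "continuous_on {0..} (prof j)"
proof -
  have "continuous_on ({0..c} \<union> {c..}) (prof j)"
    unfolding prof_def[abs_def]
    by (intro continuous_on_If continuous_intros) (auto simp: cos_freq_c)
  moreover have "{0..c} \<union> {c..} = {0..}" using c by auto
  ultimately show ?thesis by simp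
qed

lemma prof1_cont: "continuous_on {0..} (prof1 j)"
proof -
  have e: "sqrt a * freq j * \<kappa> = sqrt b * freq j" using sqrt_a_\<kappa> by (simp add: mult_ac)
  have "continuous_on ({0..c} \<union> {c..}) (prof1 j)"
    unfolding prof1_def[abs_def] e
    by (intro continuous_on_If continuous_intros) (auto simp: cos_freq_c)
  moreover have "{0..c} \<union> {c..} = {0..}" using c by auto
  ultimately show ?thesis by simp
qed

lemma prof_deriv:
  assumes "0 < x" "x \<noteq> c"
  shows "(prof j has_real_derivative prof1 j x) (at x)"
    and "(prof1 j has_real_derivative - ((freq j)\<^sup>2 * g x * prof j x)) (at x)"
proof -
  have sq: "sqrt b * sqrt b = b" "sqrt a * sqrt a = a" using a b by auto
  have "(prof j has_real_derivative prof1 j x) (at x) \<and>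
    (prof1 j has_real_derivative - ((freq j)\<^sup>2 * g x * prof j x)) (at x)"
  proof (cases "x < c")
    case True
    then have ev: "\<forall>\<^sub>F y in nhds x. y < c" by (intro eventually_nhds_in_open[of "{..<c}", simplified]) auto
    have ev0: "\<forall>\<^sub>F y in nhds x. prof j y = cos (sqrt b * freq j * y) + \<kappa> * sin (sqrt b * freq j * y)"
      using ev by eventually_elim (simp add: prof_def)
    have ev1: "\<forall>\<^sub>F y in nhds x. prof1 j y = sqrt b * freq j * (\<kappa> * cos (sqrt b * freq j * y) - sin (sqrt b * freq j * y))"
      using ev by eventually_elim (simp add: prof1_def)
    have "((\<lambda>y. cos (sqrt b * freq j * y) + \<kappa> * sin (sqrt b * freq j * y)) has_real_derivative prof1 j x) (at x)"
      using True by (auto intro!: derivative_eq_intros simp: prof1_def algebra_simps)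
    moreover have "((\<lambda>y. sqrt b * freq j * (\<kappa> * cos (sqrt b * freq j * y) - sin (sqrt b * freq j * y)))
      has_real_derivative (sqrt b * sqrt b) * (freq j)\<^sup>2 * (- \<kappa> * sin (sqrt b * freq j * x) - cos (sqrt b * freq j * x))) (at x)"
      by (auto intro!: derivative_eq_intros simp del: real_sqrt_mult_self simp: algebra_simps power2_eq_square)
    moreover have "(sqrt b * sqrt b) * (freq j)\<^sup>2 * (- \<kappa> * sin (sqrt b * freq j * x) - cos (sqrt b * freq j * x))
       = - ((freq j)\<^sup>2 * g x * prof j x)"
      unfolding sq using True assms g_in[of x] by (simp add: prof_def algebra_simps)
    ultimately show ?thesis
      using DERIV_cong_ev[OF refl ev0 refl] DERIV_cong_ev[OF refl ev1 refl] by simp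
  next
    case False
    then have x: "c < x" using assms by simp
    then have ev: "\<forall>\<^sub>F y in nhds x. c < y" by (intro eventually_nhds_in_open[of "{c<..}", simplified]) auto
    define s where "s = \<kappa> * sin (sqrt b * freq j * c)"
    have ev0: "\<forall>\<^sub>F y in nhds x. prof j y = s * exp (- (sqrt a * freq j * (y - c)))"
      using ev by eventually_elim (simp add: prof_def s_def)
    have ev1: "\<forall>\<^sub>F y in nhds x. prof1 j y = - (sqrt a * freq j * s * exp (- (sqrt a * freq j * (y - c))))"
      using ev by eventually_elim (simp add: prof1_def s_def)
    have "((\<lambda>y. s * exp (- (sqrt a * freq j * (y - c)))) has_real_derivative prof1 j x) (at x)"
      using x by (auto intro!: derivative_eq_intros simp: prof1_def s_def)
    moreover have "((\<lambda>y. - (sqrt a * freq j * s * exp (- (sqrt a * freq j * (y - c)))))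
      has_real_derivative (sqrt a * sqrt a) * (freq j)\<^sup>2 * (s * exp (- (sqrt a * freq j * (x - c))))) (at x)"
      by (auto intro!: derivative_eq_intros simp del: real_sqrt_mult_self simp: power2_eq_square)
    moreover have "(sqrt a * sqrt a) * (freq j)\<^sup>2 * (s * exp (- (sqrt a * freq j * (x - c)))) = - ((freq j)\<^sup>2 * g x * prof j x)"
      unfolding sq using x c g_out[of x] by (simp add: prof_def s_def)
    ultimately show ?thesis
      using DERIV_cong_ev[OF refl ev0 refl] DERIV_cong_ev[OF refl ev1 refl] by simp
  qed
  then show "(prof j has_real_derivative prof1 j x) (at x)"
    "(prof1 j has_real_derivative - ((freq j)\<^sup>2 * g x * prof j x)) (at x)" by auto
qed

lemma prof_bound_aux:
  assumes "0 \<le> x"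
  shows "\<bar>prof j x\<bar> \<le> env x" "\<bar>prof1 j x\<bar> \<le> sqrt b * freq j * env x"
proof -
  have "\<bar>prof j x\<bar> \<le> env x \<and> \<bar>prof1 j x\<bar> \<le> sqrt b * freq j * env x"
  proof (cases "x \<le> c")
    case True
    have "\<rho> * c + - \<rho> * \<bar>x\<bar> = \<rho> * (c - x)" using assms by (simp add: algebra_simps)
    then have "exp (\<rho> * c) * exp (- \<rho> * \<bar>x\<bar>) \<ge> 1"
      using True pos(2) by (simp flip: exp_add)
    then have E: "env x \<ge> 1 + \<kappa>"
      unfolding env_def mult.assoc using pos(1) by simp
    define \<theta> where "\<theta> = sqrt b * freq j * x"
    have k: "\<bar>\<kappa> * sin \<theta>\<bar> \<le> \<kappa>" "\<bar>\<kappa> * cos \<theta>\<bar> \<le> \<kappa>"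
      using pos(1) abs_sin_le_one[of \<theta>] abs_cos_le_one[of \<theta>] by (auto simp: abs_mult intro!: mult_left_le)
    have "\<bar>prof j x\<bar> \<le> 1 + \<kappa>"
      using True k(1) abs_cos_le_one[of \<theta>] unfolding prof_def \<theta>_def[symmetric]
      by (simp only: if_True; linarith)
    moreover have "\<bar>\<kappa> * cos \<theta> - sin \<theta>\<bar> \<le> 1 + \<kappa>"
      using k(2) abs_sin_le_one[of \<theta>] by linarith
    then have "\<bar>prof1 j x\<bar> \<le> sqrt b * freq j * (1 + \<kappa>)"
      using True pos(3)[of j] pos(5) by (simp add: prof1_def \<theta>_def[symmetric] abs_mult)
    moreover have "sqrt b * freq j * (1 + \<kappa>) \<le> sqrt b * freq j * env x"
      using E pos(3)[of j] pos(5) by (intro mult_left_mono) auto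
    ultimately show ?thesis using E by linarith
  next
    case False
    define s where "s = sin (sqrt b * freq j * c)"
    define X where "X = exp (- (sqrt a * freq j * (x - c)))"
    have s: "\<bar>s\<bar> \<le> 1" by (simp add: s_def)
    have "\<rho> * (x - c) \<le> sqrt a * freq j * (x - c)"
      using False freq_ge[of j] pos(4) by (intro mult_right_mono) (auto simp: \<rho>_def)
    then have "X \<le> exp (\<rho> * c) * exp (- \<rho> * \<bar>x\<bar>)"
      using False c by (simp add: X_def algebra_simps flip: exp_add)
    then have "\<kappa> * X \<le> \<kappa> * (exp (\<rho> * c) * exp (- \<rho> * \<bar>x\<bar>))" using pos(1) by simp
    also have "\<dots> \<le> env x" unfolding env_def mult.assoc by (intro mult_right_mono) auto
    finally have X: "\<kappa> * X \<le> env x" .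
    have "\<bar>\<kappa> * s * X\<bar> \<le> \<kappa> * 1 * X"
      unfolding abs_mult using pos(1) s by (intro mult_mono) (auto simp: X_def)
    then have 1: "\<bar>\<kappa> * s * X\<bar> \<le> env x" using X by simp
    have "prof1 j x = - (sqrt a * freq j * (\<kappa> * s * X))"
      using False by (simp add: prof1_def s_def X_def)
    also have "\<dots> = - (sqrt b * freq j * (s * X))" unfolding sqrt_a_\<kappa>[symmetric] by simp
    finally have "\<bar>prof1 j x\<bar> = sqrt b * freq j * \<bar>s * X\<bar>"
      using pos(3)[of j] pos(5) by (simp add: abs_mult)
    also have "\<bar>s * X\<bar> \<le> env x"
    proof -
      have "\<bar>s * X\<bar> \<le> 1 * X" unfolding abs_mult using s by (intro mult_mono) (auto simp: X_def)
      also have "\<dots> \<le> exp (\<rho> * c) * exp (- \<rho> * \<bar>x\<bar>)" using \<open>X \<le> _\<close> by simp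
      also have "\<dots> \<le> env x" unfolding env_def mult.assoc using pos(1) by simp
      finally show ?thesis .
    qed
    finally show ?thesis
      using 1 False pos(3)[of j] pos(5) by (simp add: prof_def s_def X_def)
  qed
  then show "\<bar>prof j x\<bar> \<le> env x" "\<bar>prof1 j x\<bar> \<le> sqrt b * freq j * env x" by auto
qed

lemma env_le: "env x \<le> (1 + \<kappa>) * exp (\<rho> * c)"
  using pos unfolding env_def by (intro mult_left_le) auto

lemma env_pos: "env x > 0"
  using pos by (simp add: env_def)

lemma env_abs [simp]: "env \<bar>x\<bar> = env x"
  by (simp add: env_def)

lemma env_cont: "continuous_on A env"
  unfolding env_def[abs_def] by (intro continuous_intros)

lemma env_meas: "env \<in> borel_measurable borel"
  by (rule borel_measurable_continuous_onI[OF env_cont])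

lemma env_int: "integrable lborel (\<lambda>x. (env x)\<^sup>2)"
proof -
  have "(\<lambda>x. (env x)\<^sup>2) = (\<lambda>x. ((1 + \<kappa>) * exp (\<rho> * c))\<^sup>2 * exp (- (2 * \<rho>) * \<bar>x\<bar>))"
    by (auto simp: env_def fun_eq_iff power2_eq_square simp flip: exp_add)
  then show ?thesis using integrable_exp_abs[of "2 * \<rho>"] pos(2) by simp
qed

text \<open>The values of \<open>g\<close> at the two interfaces are arbitrary, so they enter as
  separate cases here and as separate summands in the bound of \<open>g\<close>.\<close>

lemma g_meas: "g \<in> borel_measurable borel"
proof -
  have "g = (\<lambda>x. if \<bar>x\<bar> < c then b else if \<bar>x\<bar> > c then - a else if x = c then g c else g (- c))"
    using g_in g_out by (auto simp: fun_eq_iff abs_if)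
  moreover have "(\<lambda>x. if \<bar>x\<bar> < c then b else if \<bar>x\<bar> > c then - a else if x = c then g c else g (- c)) \<in> borel_measurable borel"
    by measurable
  ultimately show ?thesis by metis
qed

lemma g_bound: "\<bar>g x\<bar> \<le> a + b + \<bar>g c\<bar> + \<bar>g (- c)\<bar>"
proof -
  consider "\<bar>x\<bar> < c" | "\<bar>x\<bar> > c" | "x = c" | "x = - c" by linarith
  then show ?thesis using a b g_in[of x] g_out[of x] by cases auto
qed

lemma freq_T: "sin (freq j * T) = 0" "cos (freq j * T) = 1"
proof -
  have "freq j * T = od j * (\<Omega> * T)" by (simp add: freq_def)
  also have "\<dots> = 2 * pi * real ((2 * j + 1) * k)"
    unfolding period od_eq_of_nat by (simp add: algebra_simps)
  finally have e: "freq j * T = 2 * pi * real ((2 * j + 1) * k)" .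
  show "sin (freq j * T) = 0" "cos (freq j * T) = 1"
    unfolding e using sin_2npi[of "(2 * j + 1) * k"] cos_2npi[of "(2 * j + 1) * k"] by (simp_all only: mult_ac)
qed

text \<open>The bound on profile and derivative may grow with \<open>j\<close>, as it serves a
  single mode; uniformity in \<open>j\<close> comes from \<open>env\<close>.\<close>

lemma even_mode_prof:
  "even_mode g c (freq j) (a + b + \<bar>g c\<bar> + \<bar>g (- c)\<bar>) ((1 + sqrt b * freq j) * ((1 + \<kappa>) * exp (\<rho> * c))) (prof j) (prof1 j) T"
proof
  show "g \<in> borel_measurable borel" by (rule g_meas)
  show "\<bar>g x\<bar> \<le> a + b + \<bar>g c\<bar> + \<bar>g (- c)\<bar>" for x by (rule g_bound)
  show "g (- x) = g x" if "\<bar>x\<bar> \<noteq> c" for x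
    using that g_in[of x] g_in[of "-x"] g_out[of x] g_out[of "-x"] by (cases "\<bar>x\<bar> < c") auto
  have K: "(1 + \<kappa>) * exp (\<rho> * c) > 0" using pos by (simp add: add_pos_pos)
  have sf: "sqrt b * freq j > 0" using pos by simp
  show "\<bar>prof j x\<bar> \<le> (1 + sqrt b * freq j) * ((1 + \<kappa>) * exp (\<rho> * c))" if "x \<ge> 0" for x
  proof -
    have "\<bar>prof j x\<bar> \<le> 1 * ((1 + \<kappa>) * exp (\<rho> * c))" using prof_bound_aux(1)[OF that, of j] env_le[of x] by simp
    also have "\<dots> \<le> (1 + sqrt b * freq j) * ((1 + \<kappa>) * exp (\<rho> * c))"
      using K sf by (intro mult_right_mono) auto
    finally show ?thesis .
  qed
  show "\<bar>prof1 j x\<bar> \<le> (1 + sqrt b * freq j) * ((1 + \<kappa>) * exp (\<rho> * c))" if "x \<ge> 0" for x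
  proof -
    have "\<bar>prof1 j x\<bar> \<le> sqrt b * freq j * ((1 + \<kappa>) * exp (\<rho> * c))"
      using prof_bound_aux(2)[OF that, of j] mult_left_mono[OF env_le[of x] less_imp_le[OF sf]] by simp
    also have "\<dots> \<le> (1 + sqrt b * freq j) * ((1 + \<kappa>) * exp (\<rho> * c))"
      using K sf by (intro mult_right_mono) auto
    finally show ?thesis .
  qed
qed (use prof_cont prof1_cont prof_deriv T_pos freq_T in auto)

lemma prof_abs_cont: "continuous_on A (\<lambda>x. prof j \<bar>x\<bar>)"
  using even_mode.F_abs_cont[OF even_mode_prof] .

lemma prof_0: "prof j 0 = 1" "prof1 j 0 = sqrt b * \<kappa> * freq j"
  using c by (simp_all add: prof_def prof1_def)

end

lemma set_integral_series:
  fixes c :: "nat \<Rightarrow> real" and e :: "nat \<Rightarrow> real \<Rightarrow> real" and f :: "real \<Rightarrow> real"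
  assumes c: "summable (\<lambda>j. \<bar>c j\<bar>)" and e: "\<And>j t. \<bar>e j t\<bar> \<le> 1" "\<And>j. continuous_on {u..v} (e j)"
    and f: "continuous_on {u..v} f"
  shows "(\<lambda>j. c j * (LINT t:{u..v}|lborel. e j t * f t)) sums (LINT t:{u..v}|lborel. (\<Sum>j. c j * e j t) * f t)"
proof -
  have "(LINT t:{u..v}|lborel. e j t * f t) = integral {u..v} (\<lambda>t. f t * e j t)" for j
    by (subst set_borel_integral_eq_integral(2))
      (auto intro!: set_integrable_continuous_Icc continuous_intros e f simp: mult.commute)
  moreover have "(LINT t:{u..v}|lborel. (\<Sum>j. c j * e j t) * f t) = integral {u..v} (\<lambda>t. f t * (\<Sum>j. c j * e j t))"
    by (subst set_borel_integral_eq_integral(2))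
      (auto intro!: set_integrable_continuous_Icc continuous_intros continuous_on_suminf_abs[OF c, where M = 1] e f simp: mult.commute)
  ultimately show ?thesis
    using integral_suminf_abs[OF c e(1) e(2) f] by simp
qed

lemma L2_dom_times_continuous:
  assumes u: "u \<in> borel_measurable borel" "\<And>z. \<bar>u z\<bar> \<le> B"
    and \<phi>: "continuous_on UNIV \<phi>" "\<And>x t. \<bar>x\<bar> \<ge> R \<Longrightarrow> \<phi> (x, t) = (0::real)"
  shows "(\<lambda>z. u z * \<phi> z) \<in> borel_measurable (dom_measure T)"
    and "integrable (dom_measure T) (\<lambda>z. (u z * \<phi> z)\<^sup>2)"
proof -
  show "(\<lambda>z. u z * \<phi> z) \<in> borel_measurable (dom_measure T)"
    by (intro measurable_dom_measure borel_measurable_times u(1) borel_measurable_continuous_onI[OF \<phi>(1)])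
  have "integrable (dom_measure T) (\<lambda>z. (u z)\<^sup>2 * (\<phi> z)\<^sup>2)"
  proof (rule integrable_dom_times_continuous[where B = "B\<^sup>2" and R = R])
    show "\<bar>(u z)\<^sup>2\<bar> \<le> B\<^sup>2" for z using power_mono[OF u(2)[of z], of 2] by simp
  qed (use u \<phi> in \<open>auto intro!: continuous_intros\<close>)
  then show "integrable (dom_measure T) (\<lambda>z. (u z * \<phi> z)\<^sup>2)" by (simp add: power_mult_distrib)
qed

section \<open>Superposition of the modes and passage to the limit\<close>

context wave_setting
begin

definition mode where "mode j z = prof j \<bar>fst z\<bar> * cos (freq j * snd z)"
definition mode_x where "mode_x j z = sgn (fst z) * prof1 j \<bar>fst z\<bar> * cos (freq j * snd z)"
definition mode_t where "mode_t j z = - (freq j * prof j \<bar>fst z\<bar> * sin (freq j * snd z))"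

lemmas mode_defs =
  even_mode.W_def[OF even_mode_prof] even_mode.Wx_def[OF even_mode_prof] even_mode.Wt_def[OF even_mode_prof]
  mode_def mode_x_def mode_t_def

lemma mode_measurable:
  "mode j \<in> borel_measurable borel" "mode_x j \<in> borel_measurable borel" "mode_t j \<in> borel_measurable borel"
  using even_mode.W_meas[OF even_mode_prof[of j]] even_mode.Wx_meas[OF even_mode_prof[of j]]
    even_mode.Wt_meas[OF even_mode_prof[of j]]
  by (simp_all only: mode_defs[abs_def])

lemma mode_cont: "continuous_on UNIV (mode j)"
  unfolding mode_def[abs_def]
  by (intro continuous_intros continuous_on_compose2[OF prof_abs_cont[of UNIV]]) auto

lemma mode_bound: "\<bar>mode j z\<bar> \<le> env (fst z)"
  using mult_mono[OF prof_bound_aux(1)[of "\<bar>fst z\<bar>" j] abs_cos_le_one[of "freq j * snd z"]] env_pos[of "fst z"]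
  by (simp add: mode_def abs_mult)

text \<open>This equals b / sqrt a, the factor of the Dirichlet-to-Neumann map at the
  origin.\<close>

definition \<beta> where "\<beta> = sqrt b * \<kappa>"
text \<open>The amplitude \<open>\<Lambda>\<close> is chosen such that the flux jump \<open>2 * \<beta> * \<Lambda>\<close> balances the cubic term.\<close>

definition \<Lambda> where "\<Lambda> = sqrt (2 * \<beta> / (- \<gamma> * \<Omega>))"

lemma \<beta>_pos: "\<beta> > 0" using pos by (simp add: \<beta>_def)

lemma \<Lambda>_balance: "- \<gamma> * \<Lambda> ^ 3 * \<Omega> = 2 * \<beta> * \<Lambda>"
proof -
  \<comment> \<open>Here \<gamma> < 0 enters: it makes the radicand positive, so that the amplitude
    is real.\<close>
  have "2 * \<beta> / (- \<gamma> * \<Omega>) > 0"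
    using \<beta>_pos \<gamma> \<Omega> by (intro divide_pos_pos) (auto intro: mult_neg_pos)
  then have "\<Lambda>\<^sup>2 = 2 * \<beta> / (- \<gamma> * \<Omega>)" unfolding \<Lambda>_def by simp
  then have "\<Lambda>\<^sup>2 * (- \<gamma> * \<Omega>) = 2 * \<beta>" using \<gamma> \<Omega> by simp
  moreover have "- \<gamma> * \<Lambda> ^ 3 * \<Omega> = \<Lambda>\<^sup>2 * (- \<gamma> * \<Omega>) * \<Lambda>"
    by (simp add: power2_eq_square power3_eq_cube)
  ultimately show ?thesis by simp
qed

text \<open>Coefficients of \<open>primitive\<close>, rescaled in time by \<Omega> and in size by
  \<Lambda>: they are chosen so that the trace of \<open>w\<close> at x = 0 has time derivative
  \<Lambda> * V (\<Omega> * t).\<close>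

definition amp :: "nat \<Rightarrow> real" where
  "amp j = - (\<Lambda> / \<Omega>) * (sine_coeff V j / od j)"

lemma amp_summable: "summable (\<lambda>j. \<bar>amp j\<bar>)"
  unfolding amp_def abs_mult by (intro summable_mult summable_V)

lemma amp_freq: "amp j * freq j = - \<Lambda> * sine_coeff V j"
  using \<Omega> by (simp add: amp_def freq_def)

text \<open>One derivative costs the factor \<open>freq j\<close> and leaves the bare sine
  coefficients of \<open>V\<close>, which Bessel's inequality controls in l2. Hence the derivatives
  of \<open>w\<close> are sought as L2 limits.\<close>

lemma amp_freq_square_summable: "summable (\<lambda>j. (\<bar>amp j\<bar> * freq j)\<^sup>2)"
proof -
  have "(\<bar>amp j\<bar> * freq j)\<^sup>2 = \<Lambda>\<^sup>2 * (sine_coeff V j)\<^sup>2" for j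
  proof -
    have "(\<bar>amp j\<bar> * freq j)\<^sup>2 = (amp j * freq j)\<^sup>2" by (simp add: power_mult_distrib)
    then show ?thesis unfolding amp_freq by (simp add: power_mult_distrib)
  qed
  then show ?thesis
    using summable_mult[OF summable_sine_coeff_squared[OF continuous_on_V]] by simp
qed

definition w :: "real \<times> real \<Rightarrow> real" where
  "w z = (\<Sum>j. amp j * mode j z)"

lemma w_summable: "summable (\<lambda>j. amp j * mode j z)"
  by (rule summable_comparison_test'[OF summable_mult2[OF amp_summable, of "env (fst z)"]])
    (auto simp: abs_mult intro!: mult_left_mono mode_bound)

lemma w_cont: "continuous_on UNIV w"
  unfolding w_def[abs_def]
  by (rule continuous_on_suminf_abs[OF amp_summable _ mode_cont]) (rule order_trans[OF mode_bound env_le])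

lemma w_meas: "w \<in> borel_measurable borel"
  by (rule borel_measurable_continuous_onI[OF w_cont])

lemma partial_sum_bound: "\<bar>\<Sum>j<N. amp j * mode j z\<bar> \<le> (\<Sum>j. \<bar>amp j\<bar>) * env (fst z)"
proof -
  have "\<bar>\<Sum>j<N. amp j * mode j z\<bar> \<le> (\<Sum>j<N. \<bar>amp j\<bar> * env (fst z))"
    by (rule order_trans[OF sum_abs]) (auto simp: abs_mult intro!: sum_mono mult_left_mono mode_bound)
  also have "\<dots> = (\<Sum>j<N. \<bar>amp j\<bar>) * env (fst z)" by (simp add: sum_distrib_right)
  also have "\<dots> \<le> (\<Sum>j. \<bar>amp j\<bar>) * env (fst z)"
    using env_pos[of "fst z"] by (intro mult_right_mono sum_le_suminf amp_summable) auto
  finally show ?thesis .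
qed

lemma w_bound: "\<bar>w z\<bar> \<le> (\<Sum>j. \<bar>amp j\<bar>) * env (fst z)"
proof (rule LIMSEQ_le_const2)
  show "(\<lambda>N. \<bar>\<Sum>j<N. amp j * mode j z\<bar>) \<longlonglongrightarrow> \<bar>w z\<bar>"
    unfolding w_def by (intro tendsto_rabs summable_LIMSEQ w_summable)
qed (use partial_sum_bound in auto)

lemma w_periodic: "periodic_t T w"
proof -
  have "mode j (x, t + T) = mode j (x, t)" for j x t
    by (simp add: mode_def distrib_left cos_add freq_T)
  then show ?thesis by (simp add: periodic_t_def w_def)
qed

definition trace :: "real \<Rightarrow> real" where
  "trace t = \<Lambda> / \<Omega> * primitive (\<Omega> * t)"

lemma trace_eq: "trace t = (\<Sum>j. amp j * cos (freq j * t))"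
proof -
  have "summable (\<lambda>j. sine_coeff V j / od j * cos (od j * (\<Omega> * t)))"
    by (rule summable_smoothing[OF continuous_on_V]) simp
  from suminf_mult[OF this, of "- (\<Lambda> / \<Omega>)"] show ?thesis
    by (simp add: trace_def primitive_def amp_def freq_def mult.assoc)
qed

lemma w_0: "w (0, t) = trace t"
  by (simp add: w_def trace_eq mode_def prof_0)

lemma trace_deriv: "(trace has_real_derivative \<Lambda> * V (\<Omega> * t)) (at t)"
proof -
  have "((\<lambda>t. primitive (\<Omega> * t)) has_real_derivative V (\<Omega> * t) * \<Omega>) (at t)"
    by (rule DERIV_chain2[OF primitive_has_derivative]) (auto intro!: derivative_eq_intros)
  from DERIV_cmult[OF this, of "\<Lambda> / \<Omega>"] show ?thesis
    using \<Omega> by (simp add: trace_def[abs_def])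
qed

lemma V_scaled_cont: "continuous_on A (\<lambda>t. \<Lambda> * V (\<Omega> * t))"
  by (intro continuous_intros continuous_on_compose2[OF continuous_V]) auto

lemma V_scaled_power3: "(\<Lambda> * V (\<Omega> * t)) ^ 3 = \<Lambda> ^ 3 * (\<Sum>j. sine_coeff V j / od j * sin (freq j * t))"
  by (simp add: power_mult_distrib V_power3 smoothing_def freq_def mult.assoc)

lemma trace_cont: "continuous_on A trace"
  using trace_deriv DERIV_isCont continuous_at_imp_continuous_on by blast

lemma trace_T: "trace T = trace 0"
  by (simp add: trace_eq freq_T)

text \<open>The partial sums of \<open>w\<close> are uniformly bounded, so dominated convergence
  handles any integrable \<phi>; the derivative series below are paired with square integrable
  functions instead.\<close>

lemma partial_sum_pairing_tendsto:
  assumes \<phi>: "integrable (dom_measure T) \<phi>"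
  shows "(\<lambda>N. LINT z|dom_measure T. (\<Sum>j<N. amp j * mode j z) * \<phi> z) \<longlonglongrightarrow> (LINT z|dom_measure T. w z * \<phi> z)"
proof (rule integral_dominated_convergence)
  define M where "M = (\<Sum>j. \<bar>amp j\<bar>) * ((1 + \<kappa>) * exp (\<rho> * c))"
  have A: "(\<Sum>j. \<bar>amp j\<bar>) \<ge> 0" by (intro suminf_nonneg amp_summable) auto
  have [measurable]: "\<phi> \<in> borel_measurable (dom_measure T)" using \<phi> by auto
  show "integrable (dom_measure T) (\<lambda>z. M * \<bar>\<phi> z\<bar>)" using \<phi> by auto
  have [measurable]: "mode j \<in> borel_measurable (dom_measure T)" "w \<in> borel_measurable (dom_measure T)" for j
    by (rule measurable_dom_measure; rule mode_measurable w_meas)+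
  show "(\<lambda>z. w z * \<phi> z) \<in> borel_measurable (dom_measure T)" by measurable
  show "(\<lambda>z. (\<Sum>j<N. amp j * mode j z) * \<phi> z) \<in> borel_measurable (dom_measure T)" for N by measurable
  show "AE z in dom_measure T. (\<lambda>N. (\<Sum>j<N. amp j * mode j z) * \<phi> z) \<longlonglongrightarrow> w z * \<phi> z"
    unfolding w_def by (intro AE_I2 tendsto_mult tendsto_const summable_LIMSEQ w_summable)
  show "AE z in dom_measure T. norm ((\<Sum>j<N. amp j * mode j z) * \<phi> z) \<le> M * \<bar>\<phi> z\<bar>" for N
  proof (intro AE_I2)
    fix z
    have "\<bar>\<Sum>j<N. amp j * mode j z\<bar> \<le> M"
      unfolding M_def using partial_sum_bound[of z N] mult_left_mono[OF env_le[of "fst z"] A] by linarith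
    then show "norm ((\<Sum>j<N. amp j * mode j z) * \<phi> z) \<le> M * \<bar>\<phi> z\<bar>"
      by (simp add: abs_mult mult_right_mono)
  qed
qed

lemma env_series_x:
  "mode_series T (\<lambda>j x. amp j * (sgn x * prof1 j \<bar>x\<bar>)) (\<lambda>j t. cos (freq j * t)) (\<lambda>j. sqrt b * (\<bar>amp j\<bar> * freq j)) env"
proof
  show "(\<lambda>x. amp j * (sgn x * prof1 j \<bar>x\<bar>)) \<in> borel_measurable borel" for j
    using even_mode.F1_abs_meas[OF even_mode_prof[of j]] by simp
  show "\<bar>amp j * (sgn x * prof1 j \<bar>x\<bar>)\<bar> \<le> sqrt b * (\<bar>amp j\<bar> * freq j) * env x" for j x
  proof -
    have "\<bar>sgn x * prof1 j \<bar>x\<bar>\<bar> \<le> \<bar>prof1 j \<bar>x\<bar>\<bar>" by (auto simp: abs_mult sgn_if)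
    also have "\<dots> \<le> sqrt b * freq j * env x" using prof_bound_aux(2)[of "\<bar>x\<bar>" j] by simp
    finally have "\<bar>amp j\<bar> * \<bar>sgn x * prof1 j \<bar>x\<bar>\<bar> \<le> \<bar>amp j\<bar> * (sqrt b * freq j * env x)"
      by (rule mult_left_mono) simp
    then show ?thesis by (simp add: abs_mult mult_ac)
  qed
  show "summable (\<lambda>j. (sqrt b * (\<bar>amp j\<bar> * freq j))\<^sup>2)"
    unfolding power_mult_distrib[of "sqrt b"] by (intro summable_mult amp_freq_square_summable)
  show "((\<lambda>t. cos (freq i * t) * cos (freq j * t)) has_integral (if i = j then T / 2 else 0)) {0..T}" for i j
    unfolding freq_def using T_pos \<Omega> period by (intro od_modes_orthogonal(1)[where k = "2 * k"]) auto
qed (use T_pos env_meas env_pos env_int in \<open>auto intro!: continuous_intros\<close>)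

lemma env_series_t:
  "mode_series T (\<lambda>j x. - (amp j * (freq j * prof j \<bar>x\<bar>))) (\<lambda>j t. sin (freq j * t)) (\<lambda>j. \<bar>amp j\<bar> * freq j) env"
proof
  show "(\<lambda>x. - (amp j * (freq j * prof j \<bar>x\<bar>))) \<in> borel_measurable borel" for j
    using even_mode.F_abs_meas[OF even_mode_prof[of j]] by simp
  show "\<bar>- (amp j * (freq j * prof j \<bar>x\<bar>))\<bar> \<le> \<bar>amp j\<bar> * freq j * env x" for j x
    using mult_left_mono[OF prof_bound_aux(1)[of "\<bar>x\<bar>" j], of "\<bar>amp j\<bar> * freq j"] pos(3)[of j]
    by (simp add: abs_mult mult_ac)
  show "((\<lambda>t. sin (freq i * t) * sin (freq j * t)) has_integral (if i = j then T / 2 else 0)) {0..T}" for i j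
    unfolding freq_def using T_pos \<Omega> period by (intro od_modes_orthogonal(2)[where k = "2 * k"]) auto
qed (use T_pos env_meas env_pos env_int amp_freq_square_summable in \<open>auto intro!: continuous_intros\<close>)

text \<open>The limit is delivered through its pairings with L2 functions, the form in which it
  enters the weak identities.\<close>

lemma weak_derivative_x:
  obtains wx where "L2_D T wx"
    "\<And>\<phi>. \<lbrakk>\<phi> \<in> borel_measurable (dom_measure T); integrable (dom_measure T) (\<lambda>z. (\<phi> z)\<^sup>2)\<rbrakk> \<Longrightarrow>
      (\<lambda>N. LINT z|dom_measure T. (\<Sum>j<N. amp j * mode_x j z) * \<phi> z) \<longlonglongrightarrow> (LINT z|dom_measure T. wx z * \<phi> z)"
proof -
  have S: "mode_series.S (\<lambda>j x. amp j * (sgn x * prof1 j \<bar>x\<bar>)) (\<lambda>j t. cos (freq j * t)) J = (\<lambda>z. \<Sum>j\<in>J. amp j * mode_x j z)" for J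
    by (simp add: mode_series.S_def[OF env_series_x] mode_x_def fun_eq_iff mult.assoc)
  obtain wx where "wx \<in> borel_measurable (dom_measure T)" "integrable (dom_measure T) (\<lambda>z. (wx z)\<^sup>2)"
    "(\<lambda>N. LINT z|dom_measure T. ((\<Sum>j<N. amp j * mode_x j z) - wx z)\<^sup>2) \<longlonglongrightarrow> 0"
    using mode_series.L2_limit[OF env_series_x] unfolding S by blast
  moreover note mode_series.S_meas_dom[OF env_series_x, unfolded S] mode_series.S_int[OF env_series_x, unfolded S]
  ultimately show ?thesis
    by (intro that[of wx]) (auto simp: L2_D_iff intro!: L2_pairing_tendsto)
qed

lemma weak_derivative_t:
  obtains wt where "L2_D T wt"
    "\<And>\<phi>. \<lbrakk>\<phi> \<in> borel_measurable (dom_measure T); integrable (dom_measure T) (\<lambda>z. (\<phi> z)\<^sup>2)\<rbrakk> \<Longrightarrow>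
      (\<lambda>N. LINT z|dom_measure T. (\<Sum>j<N. amp j * mode_t j z) * \<phi> z) \<longlonglongrightarrow> (LINT z|dom_measure T. wt z * \<phi> z)"
proof -
  have S: "mode_series.S (\<lambda>j x. - (amp j * (freq j * prof j \<bar>x\<bar>))) (\<lambda>j t. sin (freq j * t)) J = (\<lambda>z. \<Sum>j\<in>J. amp j * mode_t j z)" for J
    by (simp add: mode_series.S_def[OF env_series_t] mode_t_def fun_eq_iff mult.assoc)
  obtain wt where "wt \<in> borel_measurable (dom_measure T)" "integrable (dom_measure T) (\<lambda>z. (wt z)\<^sup>2)"
    "(\<lambda>N. LINT z|dom_measure T. ((\<Sum>j<N. amp j * mode_t j z) - wt z)\<^sup>2) \<longlonglongrightarrow> 0"
    using mode_series.L2_limit[OF env_series_t] unfolding S by blast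
  moreover note mode_series.S_meas_dom[OF env_series_t, unfolded S] mode_series.S_int[OF env_series_t, unfolded S]
  ultimately show ?thesis
    by (intro that[of wt]) (auto simp: L2_D_iff intro!: L2_pairing_tendsto)
qed

lemma L2_D_w: "L2_D T w"
proof -
  have "integrable (dom_measure T) (\<lambda>z. (w z)\<^sup>2)"
  proof (rule Bochner_Integration.integrable_bound)
    show "integrable (dom_measure T) (\<lambda>z. (\<Sum>j. \<bar>amp j\<bar>)\<^sup>2 * (env (fst z))\<^sup>2)"
      using integrable_dom_fst[OF env_int] T_pos by simp
    show "AE z in dom_measure T. norm ((w z)\<^sup>2) \<le> norm ((\<Sum>j. \<bar>amp j\<bar>)\<^sup>2 * (env (fst z))\<^sup>2)"
    proof (intro AE_I2)
      fix z
      show "norm ((w z)\<^sup>2) \<le> norm ((\<Sum>j. \<bar>amp j\<bar>)\<^sup>2 * (env (fst z))\<^sup>2)"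
        using power_mono[OF w_bound[of z], of 2] by (simp add: power_mult_distrib)
    qed
  qed (use measurable_dom_measure[OF w_meas] in auto)
  then show ?thesis using measurable_dom_measure[OF w_meas] by (simp add: L2_D_iff)
qed

lemma integral_partial_sum:
  assumes "\<And>j. integrable M (\<lambda>z. f j z * \<phi> z)"
  shows "(LINT z|M. (\<Sum>j<N. amp j * f j z) * \<phi> z) = (\<Sum>j<N. amp j * (LINT z|M. f j z * \<phi> z))"
proof -
  have "(LINT z|M. (\<Sum>j<N. amp j * f j z) * \<phi> z) = (LINT z|M. (\<Sum>j<N. amp j * (f j z * \<phi> z)))"
    by (simp add: sum_distrib_right mult.assoc)
  then show ?thesis using assms by (simp add: Bochner_Integration.integral_sum)
qed

context
  fixes \<psi> :: "real \<times> real \<Rightarrow> real"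
  assumes \<psi>: "test_fun T \<psi>"
begin

lemma mode_integrable:
  "integrable (dom_measure T) (\<lambda>z. mode j z * px \<psi> z)" "integrable (dom_measure T) (\<lambda>z. mode j z * pt \<psi> z)"
  "integrable (dom_measure T) (\<lambda>z. mode_x j z * \<psi> z)" "integrable (dom_measure T) (\<lambda>z. mode_x j z * px \<psi> z)"
  "integrable (dom_measure T) (\<lambda>z. mode_t j z * \<psi> z)"
  using even_mode.integrable_W_test[OF even_mode_prof[of j] \<psi>] by (simp_all only: mode_defs)

lemma mode_weak:
  "(LINT z|dom_measure T. mode j z * px \<psi> z) = - (LINT z|dom_measure T. mode_x j z * \<psi> z)"
  "(LINT z|dom_measure T. mode j z * pt \<psi> z) = - (LINT z|dom_measure T. mode_t j z * \<psi> z)"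
  "(LINT z|dom_measure T. (mode j z * px \<psi> z + mode_x j z * \<psi> z) * indicator ({0<..} \<times> UNIV) z)
    = - (LINT t:{0..T}|lborel. cos (freq j * t) * \<psi> (0, t))"
  "(LINT z|dom_measure T. - g (fst z) * mode_t j z * pt \<psi> z + mode_x j z * px \<psi> z)
    = - 2 * (\<beta> * freq j) * (LINT t:{0..T}|lborel. cos (freq j * t) * \<psi> (0, t))"
  using even_mode.W_weak_dx[OF even_mode_prof[of j] \<psi>] even_mode.W_weak_dt[OF even_mode_prof[of j] \<psi>]
    even_mode.W_trace[OF even_mode_prof[of j] \<psi>] even_mode.W_flux[OF even_mode_prof[of j] \<psi>]
  unfolding mode_defs prof_0 \<beta>_def by (simp_all only: mult_minus_left mult_1)

lemma test_L2:
  "\<psi> \<in> borel_measurable (dom_measure T)" "integrable (dom_measure T) (\<lambda>z. (\<psi> z)\<^sup>2)"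
  "px \<psi> \<in> borel_measurable (dom_measure T)" "integrable (dom_measure T) (\<lambda>z. (px \<psi> z)\<^sup>2)"
  "(\<lambda>z. - g (fst z) * pt \<psi> z) \<in> borel_measurable (dom_measure T)" "integrable (dom_measure T) (\<lambda>z. (- g (fst z) * pt \<psi> z)\<^sup>2)"
  "(\<lambda>z. \<psi> z * indicator ({0<..} \<times> UNIV) z) \<in> borel_measurable (dom_measure T)"
  "integrable (dom_measure T) (\<lambda>z. (\<psi> z * indicator ({0<..} \<times> UNIV) z)\<^sup>2)"
  "integrable (dom_measure T) (px \<psi>)" "integrable (dom_measure T) (pt \<psi>)"
proof -
  obtain R where R: "\<And>x t. \<bar>x\<bar> \<ge> R \<Longrightarrow> \<psi> (x, t) = 0"
    "\<And>x t. \<bar>x\<bar> \<ge> R \<Longrightarrow> px \<psi> (x, t) = 0" "\<And>x t. \<bar>x\<bar> \<ge> R \<Longrightarrow> pt \<psi> (x, t) = 0"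
    using test_fun_support[OF \<psi>] by metis
  note reg = test_fun_regular[OF \<psi>]
  have one: "(\<lambda>z::real \<times> real. 1::real) \<in> borel_measurable borel" "\<bar>1::real\<bar> \<le> 1" by auto
  have ind: "\<bar>indicat_real ({0<..} \<times> UNIV) (z :: real \<times> real)\<bar> \<le> 1" for z by (simp add: indicator_def)
  have g: "(\<lambda>z::real \<times> real. - g (fst z)) \<in> borel_measurable borel"
    using g_meas unfolding borel_prod[symmetric] by measurable
  have gb: "\<bar>- g (fst z)\<bar> \<le> a + b + \<bar>g c\<bar> + \<bar>g (- c)\<bar>" for z :: "real \<times> real"
    using g_bound[of "fst z"] by simp
  show "\<psi> \<in> borel_measurable (dom_measure T)" "integrable (dom_measure T) (\<lambda>z. (\<psi> z)\<^sup>2)"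
    using L2_dom_times_continuous[OF one reg(1) R(1)] by simp_all
  show "px \<psi> \<in> borel_measurable (dom_measure T)" "integrable (dom_measure T) (\<lambda>z. (px \<psi> z)\<^sup>2)"
    using L2_dom_times_continuous[OF one reg(2) R(2)] by simp_all
  show "(\<lambda>z. - g (fst z) * pt \<psi> z) \<in> borel_measurable (dom_measure T)" "integrable (dom_measure T) (\<lambda>z. (- g (fst z) * pt \<psi> z)\<^sup>2)"
    by (rule L2_dom_times_continuous[OF g gb reg(3) R(3)]; assumption)+
  show "(\<lambda>z. \<psi> z * indicator ({0<..} \<times> UNIV) z) \<in> borel_measurable (dom_measure T)"
    "integrable (dom_measure T) (\<lambda>z. (\<psi> z * indicator ({0<..} \<times> UNIV) z)\<^sup>2)"
    unfolding mult.commute[of "\<psi> _"]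
    by (rule L2_dom_times_continuous[OF measurable_half_indicator ind reg(1) R(1)]; assumption)+
  show "integrable (dom_measure T) (px \<psi>)" "integrable (dom_measure T) (pt \<psi>)"
    using integrable_dom_times_continuous[OF one reg(2) R(2)] integrable_dom_times_continuous[OF one reg(3) R(3)] by simp_all
qed

text \<open>The cubic equation replaces the cube of the trace velocity by an absolutely convergent
  sine series. Integrating by parts in time yields the factor \<open>freq j\<close>, which cancels 1
  / \<open>od j\<close> up to \<Omega>, and \<open>\<Lambda>_balance\<close> then matches each term
  with the flux of the corresponding mode.\<close>

lemma flux_series:
  "(\<lambda>j. amp j * (- 2 * (\<beta> * freq j) * (LINT t:{0..T}|lborel. cos (freq j * t) * \<psi> (0, t)))) sums
    (\<gamma> * (LINT t:{0..T}|lborel. (\<Lambda> * V (\<Omega> * t)) ^ 3 * pt \<psi> (0, t)))"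
proof -
  define I where "I = (\<lambda>j. LINT t:{0..T}|lborel. cos (freq j * t) * \<psi> (0, t))"
  have parts: "(LINT t:{0..T}|lborel. sin (freq j * t) * pt \<psi> (0, t)) = - (freq j * I j)" for j
  proof -
    have "(LINT t:{0..T}|lborel. sin (freq j * t) * pt \<psi> (0, t)) = - (LINT t:{0..T}|lborel. freq j * cos (freq j * t) * \<psi> (0, t))"
      using T_pos by (intro time_integration_by_parts[OF \<psi>])
        (auto intro!: derivative_eq_intros continuous_intros simp: freq_T)
    then show ?thesis by (simp add: I_def mult.assoc)
  qed
  have "(\<lambda>j. sine_coeff V j / od j * (LINT t:{0..T}|lborel. sin (freq j * t) * pt \<psi> (0, t))) sums
     (LINT t:{0..T}|lborel. (\<Sum>j. sine_coeff V j / od j * sin (freq j * t)) * pt \<psi> (0, t))"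
    by (rule set_integral_series[OF summable_V])
      (auto intro!: continuous_intros continuous_on_slice(2)[OF test_fun_regular(3)[OF \<psi>]])
  from sums_mult[OF this, of "\<gamma> * \<Lambda> ^ 3"]
  have "(\<lambda>j. \<gamma> * \<Lambda> ^ 3 * (sine_coeff V j / od j * - (freq j * I j))) sums
     (\<gamma> * (LINT t:{0..T}|lborel. (\<Lambda> * V (\<Omega> * t)) ^ 3 * pt \<psi> (0, t)))"
    unfolding parts V_scaled_power3 by (simp add: mult.assoc)
  moreover have "\<gamma> * \<Lambda> ^ 3 * (sine_coeff V j / od j * - (freq j * I j)) = amp j * (- 2 * (\<beta> * freq j) * I j)" for j
  proof -
    have "\<gamma> * \<Lambda> ^ 3 * (sine_coeff V j / od j * - (freq j * I j)) = (- \<gamma> * \<Lambda> ^ 3 * \<Omega>) * sine_coeff V j * I j"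
      by (simp add: freq_def)
    also have "\<dots> = - 2 * \<beta> * (amp j * freq j) * I j"
      unfolding \<Lambda>_balance amp_freq by simp
    finally show ?thesis by (simp add: mult_ac)
  qed
  ultimately show ?thesis by (simp add: I_def)
qed

end

text \<open>The derivative, trace and flux identities hold for finite sums of modes by linearity.
  Both sides converge when tested against a fixed \<psi>, and uniqueness of limits gives the
  identities for \<open>w\<close>.\<close>

proposition w_weak_solution: "weak_solution g \<gamma> T w"
proof -
  obtain wx where wx: "L2_D T wx"
    "\<And>\<phi>. \<lbrakk>\<phi> \<in> borel_measurable (dom_measure T); integrable (dom_measure T) (\<lambda>z. (\<phi> z)\<^sup>2)\<rbrakk> \<Longrightarrow>
      (\<lambda>N. LINT z|dom_measure T. (\<Sum>j<N. amp j * mode_x j z) * \<phi> z) \<longlonglongrightarrow> (LINT z|dom_measure T. wx z * \<phi> z)"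
    using weak_derivative_x by blast
  obtain wt where wt: "L2_D T wt"
    "\<And>\<phi>. \<lbrakk>\<phi> \<in> borel_measurable (dom_measure T); integrable (dom_measure T) (\<lambda>z. (\<phi> z)\<^sup>2)\<rbrakk> \<Longrightarrow>
      (\<lambda>N. LINT z|dom_measure T. (\<Sum>j<N. amp j * mode_t j z) * \<phi> z) \<longlonglongrightarrow> (LINT z|dom_measure T. wt z * \<phi> z)"
    using weak_derivative_t by blast
  have L2: "wx \<in> borel_measurable (dom_measure T)" "integrable (dom_measure T) (\<lambda>z. (wx z)\<^sup>2)"
    "wt \<in> borel_measurable (dom_measure T)" "integrable (dom_measure T) (\<lambda>z. (wt z)\<^sup>2)"
    using wx(1) wt(1) by (auto simp: L2_D_iff)
  have w_dom: "w \<in> borel_measurable (dom_measure T)" "integrable (dom_measure T) (\<lambda>z. (w z)\<^sup>2)"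
    using L2_D_w by (auto simp: L2_D_iff)
  have H1: "H1_D T w wx wt"
    unfolding H1_D_def set_integral_Dom
  proof (intro conjI allI impI w_periodic L2_D_w wx(1) wt(1))
    fix \<psi> assume \<psi>: "test_fun T \<psi>"
    note L = test_L2[OF \<psi>] and mi = mode_integrable[OF \<psi>] and mw = mode_weak[OF \<psi>]
    have e1: "(LINT z|dom_measure T. (\<Sum>j<N. amp j * mode j z) * px \<psi> z) = - (LINT z|dom_measure T. (\<Sum>j<N. amp j * mode_x j z) * \<psi> z)" for N
      unfolding integral_partial_sum[of "dom_measure T" mode, OF mi(1)] integral_partial_sum[of "dom_measure T" mode_x, OF mi(3)] mw(1)
      by (simp add: sum_negf)
    show "(LINT z|dom_measure T. w z * px \<psi> z) = - (LINT z|dom_measure T. wx z * \<psi> z)"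
      by (rule LIMSEQ_unique[OF partial_sum_pairing_tendsto[OF L(9)]])
        (unfold e1, rule tendsto_minus[OF wx(2)[OF L(1,2)]])
    have e2: "(LINT z|dom_measure T. (\<Sum>j<N. amp j * mode j z) * pt \<psi> z) = - (LINT z|dom_measure T. (\<Sum>j<N. amp j * mode_t j z) * \<psi> z)" for N
      unfolding integral_partial_sum[of "dom_measure T" mode, OF mi(2)] integral_partial_sum[of "dom_measure T" mode_t, OF mi(5)] mw(2)
      by (simp add: sum_negf)
    show "(LINT z|dom_measure T. w z * pt \<psi> z) = - (LINT z|dom_measure T. wt z * \<psi> z)"
      by (rule LIMSEQ_unique[OF partial_sum_pairing_tendsto[OF L(10)]])
        (unfold e2, rule tendsto_minus[OF wt(2)[OF L(1,2)]])
  qed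
  have tr: "trace0 T w wx trace"
    unfolding trace0_def set_integral_half_Dom
  proof (intro conjI allI impI)
    show "set_integrable lborel {0..T} trace" by (intro set_integrable_continuous_Icc trace_cont)
    fix \<psi> assume \<psi>: "test_fun T \<psi>"
    note L = test_L2[OF \<psi>] and mi = mode_integrable[OF \<psi>] and mw = mode_weak[OF \<psi>]
    \<comment> \<open>The half-space indicator is absorbed into the test function: the product is
      discontinuous but still square integrable, which is all the pairings require.\<close>
    define half where "half = indicat_real ({0::real<..} \<times> (UNIV :: real set))"
    have ih: "integrable (dom_measure T) (\<lambda>z. mode j z * (px \<psi> z * half z))" "integrable (dom_measure T) (\<lambda>z. mode_x j z * (\<psi> z * half z))" for j
      using integrable_dom_half[OF mi(1)[of j]] integrable_dom_half[OF mi(3)[of j]] by (simp_all add: half_def mult.assoc)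
    have pxh: "integrable (dom_measure T) (\<lambda>z. px \<psi> z * half z)"
      unfolding half_def by (rule integrable_dom_half[OF L(9)])
    have e: "(LINT z|dom_measure T. (\<Sum>j<N. amp j * mode j z) * (px \<psi> z * half z)) + (LINT z|dom_measure T. (\<Sum>j<N. amp j * mode_x j z) * (\<psi> z * half z))
       = - (\<Sum>j<N. amp j * (LINT t:{0..T}|lborel. cos (freq j * t) * \<psi> (0, t)))" for N
    proof -
      have "(LINT z|dom_measure T. mode j z * (px \<psi> z * half z)) + (LINT z|dom_measure T. mode_x j z * (\<psi> z * half z))
        = - (LINT t:{0..T}|lborel. cos (freq j * t) * \<psi> (0, t))" for j
        unfolding mw(3)[of j, symmetric] using ih[of j] by (simp add: half_def[symmetric] distrib_right mult.assoc)
      then show ?thesis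
        unfolding integral_partial_sum[of "dom_measure T" mode, OF ih(1)] integral_partial_sum[of "dom_measure T" mode_x, OF ih(2)]
        by (simp flip: sum.distrib distrib_left sum_negf)
    qed
    have "(\<lambda>N. (LINT z|dom_measure T. (\<Sum>j<N. amp j * mode j z) * (px \<psi> z * half z)) + (LINT z|dom_measure T. (\<Sum>j<N. amp j * mode_x j z) * (\<psi> z * half z)))
       \<longlonglongrightarrow> (LINT z|dom_measure T. w z * (px \<psi> z * half z)) + (LINT z|dom_measure T. wx z * (\<psi> z * half z))"
      unfolding half_def by (intro tendsto_add partial_sum_pairing_tendsto wx(2) L(7,8) pxh[unfolded half_def])
    moreover have "(\<lambda>N. - (\<Sum>j<N. amp j * (LINT t:{0..T}|lborel. cos (freq j * t) * \<psi> (0, t))))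
       \<longlonglongrightarrow> - (LINT t:{0..T}|lborel. trace t * \<psi> (0, t))"
    proof (rule tendsto_minus)
      have "(\<lambda>j. amp j * (LINT t:{0..T}|lborel. cos (freq j * t) * \<psi> (0, t))) sums
         (LINT t:{0..T}|lborel. (\<Sum>j. amp j * cos (freq j * t)) * \<psi> (0, t))"
        by (rule set_integral_series[OF amp_summable])
          (auto intro!: continuous_intros continuous_on_slice(2)[OF test_fun_regular(1)[OF \<psi>]])
      then show "(\<lambda>N. \<Sum>j<N. amp j * (LINT t:{0..T}|lborel. cos (freq j * t) * \<psi> (0, t))) \<longlonglongrightarrow> (LINT t:{0..T}|lborel. trace t * \<psi> (0, t))"
        unfolding trace_eq sums_def .
    qed
    ultimately have "(LINT z|dom_measure T. w z * (px \<psi> z * half z)) + (LINT z|dom_measure T. wx z * (\<psi> z * half z))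
       = - (LINT t:{0..T}|lborel. trace t * \<psi> (0, t))"
      unfolding e by (rule LIMSEQ_unique)
    moreover have "(LINT z|dom_measure T. (w z * px \<psi> z + wx z * \<psi> z) * indicat_real ({0<..} \<times> UNIV) z)
      = (LINT z|dom_measure T. w z * (px \<psi> z * half z)) + (LINT z|dom_measure T. wx z * (\<psi> z * half z))"
    proof -
      have "integrable (dom_measure T) (\<lambda>z. w z * px \<psi> z)" "integrable (dom_measure T) (\<lambda>z. wx z * \<psi> z)"
        by (intro integrable_mult_L2 w_dom L2 L)+
      from integrable_dom_half[OF this(1)] integrable_dom_half[OF this(2)] show ?thesis
        by (simp add: half_def[symmetric] distrib_right mult.assoc)
    qed
    ultimately show "(LINT z|dom_measure T. (w z * px \<psi> z + wx z * \<psi> z) * indicat_real ({0<..} \<times> UNIV) z)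
      = - (LINT t:{0..T}|lborel. trace t * \<psi> (0, t))" by simp
  qed
  have dt: "dt_trace0_L3 T w wx (\<lambda>t. \<Lambda> * V (\<Omega> * t))"
    unfolding dt_trace0_L3_def
  proof (intro conjI exI[of _ trace] allI impI tr)
    show "set_borel_measurable lborel {0..T} (\<lambda>t. \<Lambda> * V (\<Omega> * t))"
      using borel_measurable_continuous_onI[OF V_scaled_cont] unfolding set_borel_measurable_def by simp
    show "set_integrable lborel {0..T} (\<lambda>t. \<bar>\<Lambda> * V (\<Omega> * t)\<bar> ^ 3)"
      by (intro set_integrable_continuous_Icc continuous_on_power continuous_on_rabs V_scaled_cont)
    show "(LINT t:{0..T}|lborel. trace t * pt \<psi> (0, t)) = - (LINT t:{0..T}|lborel. \<Lambda> * V (\<Omega> * t) * \<psi> (0, t))"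
      if "test_fun T \<psi>" for \<psi>
      using T_pos by (intro time_integration_by_parts[OF that _ trace_deriv V_scaled_cont trace_T]) simp
  qed
  have "(LINT z|dom_measure T. - g (fst z) * wt z * pt \<psi> z + wx z * px \<psi> z)
      - \<gamma> * (LINT t:{0..T}|lborel. (\<Lambda> * V (\<Omega> * t)) ^ 3 * pt \<psi> (0, t)) = 0" if \<psi>: "test_fun T \<psi>" for \<psi>
  proof -
    note L = test_L2[OF \<psi>] and mi = mode_integrable[OF \<psi>] and mw = mode_weak[OF \<psi>]
    have mt: "integrable (dom_measure T) (\<lambda>z. mode_t j z * (- g (fst z) * pt \<psi> z))" for j
    proof (rule integrable_mult_L2[OF _ L(5) _ L(6)])
      show "mode_t j \<in> borel_measurable (dom_measure T)" by (rule measurable_dom_measure[OF mode_measurable(3)])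
      show "integrable (dom_measure T) (\<lambda>z. (mode_t j z)\<^sup>2)"
      proof (rule Bochner_Integration.integrable_bound)
        show "integrable (dom_measure T) (\<lambda>z. (freq j)\<^sup>2 * (env (fst z))\<^sup>2)"
          using integrable_dom_fst[OF env_int] T_pos by simp
        show "AE z in dom_measure T. norm ((mode_t j z)\<^sup>2) \<le> norm ((freq j)\<^sup>2 * (env (fst z))\<^sup>2)"
        proof (intro AE_I2)
          fix z
          have "\<bar>prof j \<bar>fst z\<bar> * sin (freq j * snd z)\<bar> \<le> env (fst z) * 1"
            unfolding abs_mult using prof_bound_aux(1)[of "\<bar>fst z\<bar>" j] env_pos[of "fst z"] by (intro mult_mono) auto
          then have "freq j * \<bar>prof j \<bar>fst z\<bar> * sin (freq j * snd z)\<bar> \<le> freq j * env (fst z)"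
            using pos(3)[of j] by (simp add: mult_left_mono)
          then have "\<bar>mode_t j z\<bar> \<le> freq j * env (fst z)"
            using pos(3)[of j] by (simp add: mode_t_def abs_mult mult.assoc)
          from power_mono[OF this, of 2] show "norm ((mode_t j z)\<^sup>2) \<le> norm ((freq j)\<^sup>2 * (env (fst z))\<^sup>2)"
            by (simp add: power_mult_distrib)
        qed
      qed (use measurable_dom_measure[OF mode_measurable(3)] in auto)
    qed
    have e: "(LINT z|dom_measure T. (\<Sum>j<N. amp j * mode_t j z) * (- g (fst z) * pt \<psi> z)) + (LINT z|dom_measure T. (\<Sum>j<N. amp j * mode_x j z) * px \<psi> z)
       = (\<Sum>j<N. amp j * (- 2 * (\<beta> * freq j) * (LINT t:{0..T}|lborel. cos (freq j * t) * \<psi> (0, t))))" for N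
    proof -
      have "(LINT z|dom_measure T. mode_t j z * (- g (fst z) * pt \<psi> z)) + (LINT z|dom_measure T. mode_x j z * px \<psi> z)
         = - 2 * (\<beta> * freq j) * (LINT t:{0..T}|lborel. cos (freq j * t) * \<psi> (0, t))" for j
      proof -
        have "(LINT z|dom_measure T. mode_t j z * (- g (fst z) * pt \<psi> z)) + (LINT z|dom_measure T. mode_x j z * px \<psi> z)
           = (LINT z|dom_measure T. mode_t j z * (- g (fst z) * pt \<psi> z) + mode_x j z * px \<psi> z)"
          by (rule Bochner_Integration.integral_add[OF mt mi(4), symmetric])
        also have "\<dots> = (LINT z|dom_measure T. - g (fst z) * mode_t j z * pt \<psi> z + mode_x j z * px \<psi> z)"
          by (simp add: mult_ac)
        finally show ?thesis unfolding mw(4) .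
      qed
      then show ?thesis
        unfolding integral_partial_sum[of "dom_measure T" mode_t, OF mt] integral_partial_sum[of "dom_measure T" mode_x, OF mi(4)]
        by (simp only: sum.distrib[symmetric] distrib_left[symmetric])
    qed
    have "(\<lambda>N. (LINT z|dom_measure T. (\<Sum>j<N. amp j * mode_t j z) * (- g (fst z) * pt \<psi> z)) + (LINT z|dom_measure T. (\<Sum>j<N. amp j * mode_x j z) * px \<psi> z))
       \<longlonglongrightarrow> (LINT z|dom_measure T. wt z * (- g (fst z) * pt \<psi> z)) + (LINT z|dom_measure T. wx z * px \<psi> z)"
      by (intro tendsto_add wt(2) wx(2) L)
    then have "(LINT z|dom_measure T. wt z * (- g (fst z) * pt \<psi> z)) + (LINT z|dom_measure T. wx z * px \<psi> z)
       = \<gamma> * (LINT t:{0..T}|lborel. (\<Lambda> * V (\<Omega> * t)) ^ 3 * pt \<psi> (0, t))"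
      unfolding e using flux_series[OF \<psi>] unfolding sums_def by (rule LIMSEQ_unique)
    moreover have "(LINT z|dom_measure T. - g (fst z) * wt z * pt \<psi> z + wx z * px \<psi> z)
       = (LINT z|dom_measure T. wt z * (- g (fst z) * pt \<psi> z)) + (LINT z|dom_measure T. wx z * px \<psi> z)"
    proof -
      have "(LINT z|dom_measure T. - g (fst z) * wt z * pt \<psi> z + wx z * px \<psi> z) = (LINT z|dom_measure T. wt z * (- g (fst z) * pt \<psi> z) + wx z * px \<psi> z)"
        by (simp add: mult_ac)
      then show ?thesis
        by (simp only:) (intro Bochner_Integration.integral_add integrable_mult_L2 L2 L)
    qed
    ultimately show ?thesis by simp
  qed
  then show ?thesis
    unfolding weak_solution_def set_integral_Dom using H1 dt by blast
qed

lemma w_decay: "\<exists>C \<rho>'. C > 0 \<and> \<rho>' > 0 \<and> (\<forall>x t. \<bar>w (x, t)\<bar> \<le> C * exp (- \<rho>' * \<bar>x\<bar>))"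
\<comment> \<open>Adding 1 to the nonnegative sum of amplitudes makes the constant positive at
  once.\<close>
proof (rule exI[of _ "((\<Sum>j. \<bar>amp j\<bar>) + 1) * ((1 + \<kappa>) * exp (\<rho> * c))"], rule exI[of _ \<rho>], intro conjI allI)
  have A: "(\<Sum>j. \<bar>amp j\<bar>) \<ge> 0" by (intro suminf_nonneg amp_summable) auto
  show "((\<Sum>j. \<bar>amp j\<bar>) + 1) * ((1 + \<kappa>) * exp (\<rho> * c)) > 0"
    using A pos(1) by (intro mult_pos_pos) auto
  fix x t
  have "\<bar>w (x, t)\<bar> \<le> (\<Sum>j. \<bar>amp j\<bar>) * env x" using w_bound[of "(x, t)"] by simp
  also have "\<dots> \<le> ((\<Sum>j. \<bar>amp j\<bar>) + 1) * env x"
    using env_pos[of x] by (intro mult_right_mono) auto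
  finally show "\<bar>w (x, t)\<bar> \<le> ((\<Sum>j. \<bar>amp j\<bar>) + 1) * ((1 + \<kappa>) * exp (\<rho> * c)) * exp (- \<rho> * \<bar>x\<bar>)"
    by (simp add: env_def mult.assoc)
qed (rule pos)

lemma w_origin: "w (0, 0) = sqrt (2 * \<beta> / (- \<gamma> * \<Omega>)) / \<Omega> * primitive 0"
  by (simp add: w_0 trace_def \<Lambda>_def)

end

section \<open>An infinite family of distinct solutions\<close>

text \<open>The set where two continuous functions differ is open, and a nonempty open set is not
  null. Comparing values at the origin therefore separates solutions even up to null sets.\<close>

lemma continuous_AE_eq_imp_eq:
  fixes f h :: "real \<times> real \<Rightarrow> real"
  assumes f: "continuous_on UNIV f" "continuous_on UNIV h" and AE: "AE z in lborel. f z = h z"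
  shows "f z = h z"
proof (rule ccontr)
  assume ne: "f z \<noteq> h z"
  define U where "U = {z. f z \<noteq> h z}"
  have U: "open U"
    unfolding U_def using f by (intro open_Collect_neq) auto
  have "U \<in> null_sets lborel"
    using AE_iff_null_sets[of U lborel] AE U by (simp add: U_def borel_open)
  then have "negligible U"
    by (simp add: negligible_iff_null_sets null_sets_completionI)
  then have "U = {}" using open_not_negligible[OF U] by blast
  then show False using ne unfolding U_def by blast
qed

theorem theorem1p1:
  fixes a b c \<gamma> \<omega> :: real and g :: "real \<Rightarrow> real" and p q :: nat
  assumes "a > 0" "b > 0" "c > 0"
    and "\<forall>x. \<bar>x\<bar> > c \<longrightarrow> g x = - a"
    and "\<forall>x. \<bar>x\<bar> < c \<longrightarrow> g x = b"
    and "\<gamma> < 0" and "\<omega> > 0"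
    and "odd p" "odd q"
    and "sqrt b * \<omega> * c * (2 / pi) = real p / real q"
  shows "\<exists>S. infinite S \<and>
    (\<forall>w\<in>S. weak_solution g \<gamma> (2 * pi / \<omega>) w \<and> periodic_t (2 * pi / \<omega>) w \<and>
       \<not> (AE z in lborel. w z = 0) \<and>
       (\<exists>C \<rho>. C > 0 \<and> \<rho> > 0 \<and> (\<forall>x t. \<bar>w (x, t)\<bar> \<le> C * exp (- \<rho> * \<bar>x\<bar>)))) \<and>
    (\<forall>w1\<in>S. \<forall>w2\<in>S. w1 \<noteq> w2 \<longrightarrow> \<not> (AE z in lborel. w1 z = w2 z))"
proof -
  obtain V where V: "continuous_on UNIV V" "\<And>t. V t ^ 3 = smoothing V t" "\<And>t. t \<in> {0..pi} \<Longrightarrow> sin t \<le> V t"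
    using cubic_fixed_point by blast
  interpret cubic_profile V by standard (use V in auto)
  have q: "real q > 0" using \<open>odd q\<close> by (cases q) auto
  obtain p' where p': "p = 2 * p' + 1" using \<open>odd p\<close> by (elim oddE)
  \<comment> \<open>The factor \<open>q\<close> cancels the denominator of p / q, so that sqrt b *
    \<Omega> n * c is the odd number \<open>od n * p\<close> times pi / 2.\<close>
  define \<Omega> where "\<Omega> = (\<lambda>n. od n * real q * \<omega>)"
  have \<Omega>: "\<Omega> n > 0" for n using q \<open>\<omega> > 0\<close> by (simp add: \<Omega>_def)
  have setting: "wave_setting V a b c \<gamma> (\<Omega> n) (2 * pi / \<omega>) g ((2 * n + 1) * q) (2 * n * p' + n + p')" for n
  proof
    show "\<Omega> n * (2 * pi / \<omega>) = 2 * pi * real ((2 * n + 1) * q)"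
      using \<open>\<omega> > 0\<close> by (simp add: \<Omega>_def od_def algebra_simps)
    have "sqrt b * \<omega> * c * real q = od p' * (pi / 2)"
      using assms(10) q by (simp add: field_simps od_eq_of_nat p')
    then have "sqrt b * \<Omega> n * c = od n * (od p' * (pi / 2))"
      by (simp add: \<Omega>_def mult_ac)
    then show "sqrt b * \<Omega> n * c = od (2 * n * p' + n + p') * (pi / 2)"
      by (simp flip: od_mult_od)
  qed (use assms \<Omega> in auto)
  define \<beta> where "\<beta> = sqrt b * (sqrt b / sqrt a)"
  have \<beta>: "\<beta> > 0" using assms by (simp add: \<beta>_def)
  \<comment> \<open>Proportional to \<Omega> to the power -3/2, hence strictly decreasing in n;
    multiplied by the nonzero \<open>primitive 0\<close> it yields pairwise different values at the
    origin.\<close>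
  define A where "A = (\<lambda>n. sqrt (2 * \<beta> / (- \<gamma> * \<Omega> n)) / \<Omega> n)"
  have "\<exists>w. weak_solution g \<gamma> (2 * pi / \<omega>) w \<and> periodic_t (2 * pi / \<omega>) w \<and> continuous_on UNIV w \<and>
      (\<exists>C \<rho>. C > 0 \<and> \<rho> > 0 \<and> (\<forall>x t. \<bar>w (x, t)\<bar> \<le> C * exp (- \<rho> * \<bar>x\<bar>))) \<and> w (0, 0) = A n * primitive 0" for n
  proof -
    interpret S: wave_setting V a b c \<gamma> "\<Omega> n" "2 * pi / \<omega>" g "(2 * n + 1) * q" "2 * n * p' + n + p'"
      by (rule setting)
    show ?thesis
      using S.w_weak_solution S.w_periodic S.w_cont S.w_decay S.w_origin
      unfolding A_def \<beta>_def S.\<beta>_def S.\<kappa>_def by blast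
  qed
  then obtain W where W: "\<And>n. weak_solution g \<gamma> (2 * pi / \<omega>) (W n)" "\<And>n. periodic_t (2 * pi / \<omega>) (W n)"
    "\<And>n. continuous_on UNIV (W n)"
    "\<And>n. \<exists>C \<rho>. C > 0 \<and> \<rho> > 0 \<and> (\<forall>x t. \<bar>W n (x, t)\<bar> \<le> C * exp (- \<rho> * \<bar>x\<bar>))"
    "\<And>n. W n (0, 0) = A n * primitive 0"
    by metis
  have A_pos: "A n > 0" for n
    unfolding A_def using \<beta> \<Omega>[of n] \<open>\<gamma> < 0\<close>
    by (intro divide_pos_pos real_sqrt_gt_zero mult_pos_pos) auto
  have A_less: "A n < A m" if "m < n" for m n
  proof -
    have less: "\<Omega> m < \<Omega> n" using that q \<open>\<omega> > 0\<close> by (simp add: \<Omega>_def od_def)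
    have "- \<gamma> * \<Omega> m < - \<gamma> * \<Omega> n" using less \<open>\<gamma> < 0\<close> by simp
    moreover have "- \<gamma> * \<Omega> m > 0" using \<Omega>[of m] \<open>\<gamma> < 0\<close> by (simp add: mult_neg_pos)
    ultimately have "2 * \<beta> / (- \<gamma> * \<Omega> n) \<le> 2 * \<beta> / (- \<gamma> * \<Omega> m)" using \<beta>
      by (intro divide_left_mono) (auto intro: mult_neg_neg)
    then have le: "sqrt (2 * \<beta> / (- \<gamma> * \<Omega> n)) \<le> sqrt (2 * \<beta> / (- \<gamma> * \<Omega> m))" by (rule real_sqrt_le_mono)
    have "sqrt (2 * \<beta> / (- \<gamma> * \<Omega> n)) > 0"
      using \<beta> \<Omega>[of n] \<open>\<gamma> < 0\<close> by (intro real_sqrt_gt_zero divide_pos_pos mult_pos_pos) auto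
    from frac_less2[OF this le \<Omega> less] show ?thesis
      unfolding A_def .
  qed
  have distinct: "W m (0, 0) \<noteq> W n (0, 0)" if "m \<noteq> n" for m n
    using A_less[of m n] A_less[of n m] that primitive_0_neg unfolding W(5) by (cases "m < n") auto
  show ?thesis
  proof (intro exI[of _ "range W"] conjI ballI impI)
    have "inj W" using distinct by (intro injI) metis
    then show "infinite (range W)" by (rule range_inj_infinite)
  next
    fix w assume "w \<in> range W"
    then obtain n where n: "w = W n" by blast
    show "weak_solution g \<gamma> (2 * pi / \<omega>) w" "periodic_t (2 * pi / \<omega>) w"
      "\<exists>C \<rho>. C > 0 \<and> \<rho> > 0 \<and> (\<forall>x t. \<bar>w (x, t)\<bar> \<le> C * exp (- \<rho> * \<bar>x\<bar>))"
      unfolding n by (rule W)+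
    show "\<not> (AE z in lborel. w z = 0)"
    proof
      assume "AE z in lborel. w z = 0"
      then have "W n (0, 0) = 0"
        unfolding n by (rule continuous_AE_eq_imp_eq[OF W(3) continuous_on_const])
      then show False using W(5)[of n] A_pos[of n] primitive_0_neg by simp
    qed
  next
    fix w1 w2 assume "w1 \<in> range W" "w2 \<in> range W" and ne: "w1 \<noteq> w2"
    then obtain m n where mn: "w1 = W m" "w2 = W n" by blast
    then have "m \<noteq> n" using ne by auto
    show "\<not> (AE z in lborel. w1 z = w2 z)"
    proof
      assume "AE z in lborel. w1 z = w2 z"
      then have "W m (0, 0) = W n (0, 0)"
        unfolding mn by (rule continuous_AE_eq_imp_eq[OF W(3) W(3)])
      then show False using distinct[OF \<open>m \<noteq> n\<close>] by contradiction
    qed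
  qed
qed

end
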